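(* Let $\lambda>0$ and $0<\alpha_1,\alpha_2\le1$. Let $\{N_{\alpha_1,\alpha_2}(t_1,t_2),\ (t_1,t_2)\in\mathbb{R}^2_+\}$ be the time fractional Poisson random field with parameter $\lambda$. Let $\{N(t),\ t\ge0\}$ be a (one parameter) Poisson process with transition rate $\lambda$, and for $i=1,2$ let $\{T_{2\alpha_i}(t),\ t\ge0\}$ be a nonnegative random process whose one-dimensional densities are the folded solutions of the Cauchy problem $$\frac{\partial^{2\alpha_i}}{\partial t^{2\alpha_i}}u_{2\alpha_i}(x,t)=\frac{\partial^2}{\partial x^2}u_{2\alpha_i}(x,t),\quad t>0,\ x\in\mathbb{R},$$ with $u_{2\alpha_i}(x,0)=\delta(x)$ for $0<\alpha_i\le1$, and additionally $\frac{\partial}{\partial t}u_{2\alpha_i}(x,t)|_{t=0}=0$ for $\frac12<\alpha_i\le1$. Assume that $\{N(t)\}$, $\{T_{2\alpha_1}(t)\}$ and $\{T_{2\alpha_2}(t)\}$ are independent of each other. Then, for each $(t_1,t_2)\in\mathbb{R}^2_+$, $$N_{\alpha_1,\alpha_2}(t_1,t_2)\overset{d}{=}N(T_{2\alpha_1}(t_1)\,T_{2\alpha_2}(t_2)),$$ where $\overset{d}{=}$ denotes equality in distribution and the argument on the right-hand side is the product of the two random times.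
   Context: $\mathbb{R}_+=[0,\infty)$. Time fractional Poisson random field (TFPRF, also called fractional Poisson random field) with parameter $\lambda>0$ and indices $0<\alpha_1,\alpha_2\le1$: a nonnegative-integer-valued random field $\{N_{\alpha_1,\alpha_2}(t_1,t_2)\}$ on $\mathbb{R}^2_+$ whose one-point distribution $p_{\alpha_1,\alpha_2}(n,t_1,t_2)=\mathrm{Pr}\{N_{\alpha_1,\alpha_2}(t_1,t_2)=n\}$, $n\ge0$, solves $$\frac{\partial^{\alpha_1+\alpha_2}}{\partial t_2^{\alpha_2}\partial t_1^{\alpha_1}}p_{\alpha_1,\alpha_2}(n,t_1,t_2)=(n+1)\lambda p_{\alpha_1,\alpha_2}(n+1,t_1,t_2)-(2n+1)\lambda p_{\alpha_1,\alpha_2}(n,t_1,t_2)+n\lambda p_{\alpha_1,\alpha_2}(n-1,t_1,t_2)$$ with $p_{\alpha_1,\alpha_2}(0,0,0)=p_{\alpha_1,\alpha_2}(0,t_1,0)=p_{\alpha_1,\alpha_2}(0,0,t_2)=1$, where the derivatives are Caputo derivatives: $\frac{\mathrm{d}^\alpha}{\mathrm{d}t^\alpha}g(t)=\frac{1}{\Gamma(1-\alpha)}\int_0^t\frac{g'(s)}{(t-s)^\alpha}\,\mathrm{d}s$ for $0<\alpha<1$, and $g'(t)$ for $\alpha=1$. Folded solution: the density of $T_{2\alpha}(t)$ is $2u_{2\alpha}(x,t)$ for $x\ge0$ and $0$ for $x<0$ (for $\alpha=1$ this is the point mass at $x=t$, i.e. $T_2(t)=t$). The fractional time derivative in the Cauchy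 problem is of Caputo type (for order $\nu=2\alpha\in(1,2)$: $\frac{1}{\Gamma(2-\nu)}\int_0^t\frac{g''(s)}{(t-s)^{\nu-1}}\,\mathrm{d}s$). It is known (Orsingher–Beghin) that $\int_0^\infty e^{-zt}\mathrm{Pr}\{T_{2\alpha}(t)\in\mathrm{d}x\}\,\mathrm{d}t=z^{\alpha-1}e^{-z^{\alpha}x}\,\mathrm{d}x$, $z>0$. *)

theory Defs
  imports "HOL-Probability.Probability"
begin

text \<open>
  Caputo derivative of order \<open>\<nu> > 0\<close> at \<open>t > 0\<close>. With \<open>n = \<lceil>\<nu>\<rceil>\<close> it is
  \<open>1 / \<Gamma>(n - \<nu>) \<integral>\<^sub>0\<^sup>t g\<^sup>(\<^sup>n\<^sup>)(s) / (t - s)\<^sup>\<nu>\<^sup>+\<^sup>1\<^sup>-\<^sup>n ds\<close>, and the ordinary \<open>n\<close>-th derivative if \<open>\<nu> = n\<close>.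
  Only orders in \<open>(0, 2]\<close> are used below.
\<close>

definition caputo :: "real \<Rightarrow> (real \<Rightarrow> real) \<Rightarrow> real \<Rightarrow> real" where
  "caputo \<nu> g t =
     (let n = nat \<lceil>\<nu>\<rceil> in
      if \<nu> = real n then (deriv ^^ n) g t
      else 1 / Gamma (real n - \<nu>) *
             (LINT s:{0<..<t}|lborel. (deriv ^^ n) g s * (t - s) powr (real n - 1 - \<nu>)))"

text \<open>
  \<^const>\<open>deriv\<close> and the integral are total, so the existence of the Caputo derivative is a
  separate condition. Continuity at \<open>0\<close> is part of it: without it the values \<open>g(0)\<close> prescribed by
  initial conditions would be unrelated to \<open>g\<close> on \<open>(0, \<infinity>)\<close>. The derivatives themselves may be
  singular at \<open>0\<close>.
\<close>

definition caputo_differentiable :: "real \<Rightarrow> (real \<Rightarrow> real) \<Rightarrow> real \<Rightarrow> bool" where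
  "caputo_differentiable \<nu> g t \<longleftrightarrow>
     (let n = nat \<lceil>\<nu>\<rceil> in
      continuous_on {0..t} g \<and>
      (\<forall>k<n. \<forall>s\<in>{0<..t}. (deriv ^^ k) g differentiable (at s)) \<and>
      (\<nu> < real n \<longrightarrow>
         set_integrable lborel {0<..<t} (\<lambda>s. (deriv ^^ n) g s * (t - s) powr (real n - 1 - \<nu>))))"

definition time_fractional_poisson_field ::
    "real \<Rightarrow> real \<Rightarrow> real \<Rightarrow> 'a measure \<Rightarrow> (real \<Rightarrow> real \<Rightarrow> 'a \<Rightarrow> nat) \<Rightarrow> bool" where
  "time_fractional_poisson_field r \<alpha>\<^sub>1 \<alpha>\<^sub>2 M X \<longleftrightarrow>
     (\<forall>t\<^sub>1\<ge>0. \<forall>t\<^sub>2\<ge>0. X t\<^sub>1 t\<^sub>2 \<in> measurable M (count_space UNIV)) \<and>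
     (let p = (\<lambda>n t\<^sub>1 t\<^sub>2. measure M {\<omega> \<in> space M. X t\<^sub>1 t\<^sub>2 \<omega> = n});
          D\<^sub>1 = (\<lambda>n t\<^sub>1 t\<^sub>2. caputo \<alpha>\<^sub>1 (\<lambda>s. p n s t\<^sub>2) t\<^sub>1)
      in
      (\<forall>n. \<forall>t\<^sub>1>0. \<forall>t\<^sub>2>0.
         caputo_differentiable \<alpha>\<^sub>1 (\<lambda>s. p n s t\<^sub>2) t\<^sub>1 \<and>
         caputo_differentiable \<alpha>\<^sub>2 (\<lambda>s. D\<^sub>1 n t\<^sub>1 s) t\<^sub>2 \<and>
         caputo \<alpha>\<^sub>2 (\<lambda>s. D\<^sub>1 n t\<^sub>1 s) t\<^sub>2 =
           (real n + 1) * r * p (n + 1) t\<^sub>1 t\<^sub>2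
           - (2 * real n + 1) * r * p n t\<^sub>1 t\<^sub>2
           + real n * r * p (n - 1) t\<^sub>1 t\<^sub>2) \<and>
      p 0 0 0 = 1 \<and>
      (\<forall>t\<ge>0. p 0 t 0 = 1) \<and>
      (\<forall>t\<ge>0. p 0 0 t = 1))"

definition poisson_process :: "real \<Rightarrow> 'a measure \<Rightarrow> (real \<Rightarrow> 'a \<Rightarrow> nat) \<Rightarrow> bool" where
  "poisson_process r M N \<longleftrightarrow>
     (\<forall>t\<ge>0. N t \<in> measurable M (count_space UNIV)) \<and>
     (\<forall>\<omega>\<in>space M. N 0 \<omega> = 0 \<and> mono_on {0..} (\<lambda>t. N t \<omega>) \<and>
        (\<forall>t\<ge>0. ((\<lambda>s. N s \<omega>) \<longlongrightarrow> N t \<omega>) (at_right t))) \<and>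
     (\<forall>s t. 0 \<le> s \<and> s < t \<longrightarrow>
        distr M (count_space UNIV) (\<lambda>\<omega>. N t \<omega> - N s \<omega>) =
          measure_pmf (poisson_pmf (r * (t - s)))) \<and>
     (\<forall>\<tau> k. 0 \<le> \<tau> 0 \<and> mono \<tau> \<longrightarrow>
        prob_space.indep_vars M (\<lambda>_. count_space UNIV)
          (\<lambda>i \<omega>. N (\<tau> (Suc i)) \<omega> - N (\<tau> i) \<omega>) {..<k::nat})"

definition bounded_smooth :: "(real \<Rightarrow> real) \<Rightarrow> bool" where
  "bounded_smooth \<phi> \<longleftrightarrow>
     (\<forall>k. (\<forall>x. (deriv ^^ k) \<phi> differentiable (at x)) \<and> bounded (range ((deriv ^^ k) \<phi>)))"

text \<open>
  Solution of \<open>\<partial>\<^sup>\<nu>u/\<partial>t\<^sup>\<nu> = \<partial>\<^sup>2u/\<partial>x\<^sup>2\<close>, \<open>u(x, 0) = \<delta>(x)\<close>, and \<open>\<partial>u/\<partial>t(x, 0) = 0\<close> if \<open>\<nu> > 1\<close>,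
  where \<open>U t\<close> is the measure \<open>u(x, t) dx\<close>. The equation is read weakly in \<open>x\<close> and pointwise in \<open>t\<close>.
  A reading that is pointwise in \<open>x\<close> is not available: for \<open>\<nu> < 2\<close>, \<open>\<nu> \<noteq> 1\<close> the
  fundamental solution has a kink at \<open>x = 0\<close>, for \<open>\<nu> = 2\<close> it is \<open>(\<delta>(x - t) + \<delta>(x + t)) / 2\<close>, and the
  initial value is a measure in all cases.
\<close>

definition fractional_cauchy_solution :: "real \<Rightarrow> (real \<Rightarrow> real measure) \<Rightarrow> bool" where
  "fractional_cauchy_solution \<nu> U \<longleftrightarrow>
     (\<forall>t\<ge>0. finite_measure (U t) \<and> sets (U t) = sets borel) \<and>
     (\<forall>\<phi>. bounded_smooth \<phi> \<longrightarrow>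
        (\<forall>t>0. caputo_differentiable \<nu> (\<lambda>s. LINT x|U s. \<phi> x) t \<and>
               caputo \<nu> (\<lambda>s. LINT x|U s. \<phi> x) t = (LINT x|U t. (deriv ^^ 2) \<phi> x))) \<and>
     U 0 = return borel 0 \<and>
     (1 < \<nu> \<longrightarrow>
        (\<forall>\<phi>. bounded_smooth \<phi> \<longrightarrow>
           ((\<lambda>t. LINT x|U t. \<phi> x) has_real_derivative 0) (at 0 within {0..})))"

text \<open>
  Folding: for \<open>t > 0\<close> the law of \<open>T t\<close> is \<open>2 u(x, t) dx\<close> on \<open>[0, \<infinity>)\<close>. At \<open>t = 0\<close> the factor \<open>2\<close>
  would count the atom of \<open>\<delta>(x)\<close> twice; the folded \<open>\<delta>(x)\<close> is \<open>\<delta>(x)\<close>.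
\<close>

definition folded_solution_process ::
    "real \<Rightarrow> 'a measure \<Rightarrow> (real \<Rightarrow> 'a \<Rightarrow> real) \<Rightarrow> bool" where
  "folded_solution_process \<nu> M T \<longleftrightarrow>
     (\<forall>t\<ge>0. T t \<in> borel_measurable M \<and> (\<forall>\<omega>\<in>space M. 0 \<le> T t \<omega>)) \<and>
     (\<exists>U. fractional_cauchy_solution \<nu> U \<and>
        distr M borel (T 0) = U 0 \<and>
        (\<forall>t>0. distr M borel (T t) = density (U t) (\<lambda>x. if 0 \<le> x then 2 else 0)))"

definition process_events ::
    "'a measure \<Rightarrow> 'b measure \<Rightarrow> (real \<Rightarrow> 'a \<Rightarrow> 'b) \<Rightarrow> 'a set set" where
  "process_events M S X =
     sigma_sets (space M) {X t -` A \<inter> space M |t A. 0 \<le> t \<and> A \<in> sets S}"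

definition equal_in_distribution ::
    "'a measure \<Rightarrow> ('a \<Rightarrow> 'c) \<Rightarrow> 'b measure \<Rightarrow> ('b \<Rightarrow> 'c) \<Rightarrow> 'c measure \<Rightarrow> bool" where
  "equal_in_distribution M X M' Y S \<longleftrightarrow>
     X \<in> measurable M S \<and> Y \<in> measurable M' S \<and> distr M S X = distr M' S Y"

end

theory Submission
  imports Defs
begin

text \<open>
  All one-point laws are identified by their Laplace transforms in \<open>t\<^sub>1\<close> and \<open>t\<^sub>2\<close>.
  Testing the Cauchy problem of order \<open>2\<alpha>\<close> against \<open>cos (y x)\<close> and \<open>sin (y x)\<close> shows that
  \<open>u(x, t) dx\<close> averaged over an exponential time \<open>t\<close> with rate \<open>z\<close> has characteristic function
  \<open>b\<^sup>2 / (b\<^sup>2 + y\<^sup>2)\<close>, \<open>b = z\<^sup>\<alpha>\<close>, so it is the Laplace distribution, and the folded time \<open>T\<^sub>2\<^sub>\<alpha>\<close>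
  becomes exponential with rate \<open>b\<close>. Hence the transform of the law of \<open>N(T\<^sub>1 T\<^sub>2)\<close>, multiplied by
  \<open>z\<^sub>1 z\<^sub>2\<close>, is the sequence \<open>x\<^sub>n = E[e\<^sup>-\<^sup>r\<^sup>S (r S)\<^sup>n / n!]\<close> where \<open>S\<close> is a product of independent exponential
  variables with rates \<open>b\<^sub>1\<close>, \<open>b\<^sub>2\<close>. Integrating by parts,
  \<open>(b\<^sub>1 b\<^sub>2 / r) (x\<^sub>n - \<delta>\<^sub>n\<^sub>0) = (n + 1) x\<^sub>n\<^sub>+\<^sub>1 - (2n + 1) x\<^sub>n + n x\<^sub>n\<^sub>-\<^sub>1\<close>. Inverting the two Caputo derivatives
  shows that the transformed one-point law of the field solves the same recursion, which has only
  one solution tending to \<open>0\<close>.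
\<close>

section \<open>Riemann--Liouville integrals and Laplace transforms\<close>

text \<open>Caputo derivatives are never transformed directly: no growth bound on them is assumed,
  and integrating by parts against exp(-z t) would need one. Each equation is first rewritten as a
  Volterra equation g = g(0) + J^\<nu>(D^\<nu> g), with J^\<nu> the Riemann-Liouville integral, and
  only functions with a known bound are transformed: probabilities, integrals of bounded test
  functions, and the inner derivative of the field, whose bound comes out of the outer equation.
  Cosines and sines serve as test functions because they are eigenfunctions of the second
  derivative, so the Cauchy problem becomes one scalar equation per frequency. Uniqueness of Laplace
  transforms is used for bounded functions continuous on (0, \<infinity>). The field equation yields
  continuity of the probabilities in \<open>t\<^sub>1\<close> and of their inner derivative in
  \<open>t\<^sub>2\<close>, but directly neither joint measurability of the probabilities nor their
  continuity in \<open>t\<^sub>2\<close>; both are recovered from the Volterra equation. Transforms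
  do not see the axes, which are treated apart.\<close>

definition rl_kernel :: "real \<Rightarrow> real \<Rightarrow> real" where
  "rl_kernel a x = (if 0 < x then x powr (a - 1) / Gamma a else 0)"

text \<open>Riemann-Liouville fractional integral of order \<open>a\<close>, as a convolution over
  the whole line. The kernel cuts off s \<ge> t and the indicator s \<le> 0, so Fubini and
  translation apply without moving limits of integration.\<close>

definition rl_integral :: "real \<Rightarrow> (real \<Rightarrow> real) \<Rightarrow> real \<Rightarrow> real" where
  "rl_integral a f t = (LINT s|lborel. rl_kernel a (t - s) * (indicator {0<..} s * f s))"

definition laplace :: "(real \<Rightarrow> real) \<Rightarrow> real \<Rightarrow> real" where
  "laplace f z = (LINT t|lborel. indicator {0<..} t * (exp (- z * t) * f t))"

text \<open>Kept apart from the value because \<open>LINT\<close> is 0 on non-integrable functions,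
  so an equation for \<open>laplace\<close> alone says nothing about convergence.\<close>

definition laplace_integrable :: "(real \<Rightarrow> real) \<Rightarrow> real \<Rightarrow> bool" where
  "laplace_integrable f z \<longleftrightarrow> integrable lborel (\<lambda>t. indicator {0<..} t * (exp (- z * t) * f t))"

lemma rl_kernel_nonneg: "0 < a \<Longrightarrow> 0 \<le> rl_kernel a x"
  by (auto simp: rl_kernel_def intro!: divide_nonneg_nonneg less_imp_le[OF Gamma_real_pos])

lemma measurable_rl_kernel [measurable]: "rl_kernel a \<in> borel_measurable borel"
  unfolding rl_kernel_def by measurable

text \<open>Euler's integral for Gamma after the substitution t -> z t.\<close>

lemma has_bochner_integral_rl_kernel:
  assumes a: "0 < a" and z: "0 < z"
  shows "has_bochner_integral lborel (\<lambda>t. exp (- z * t) * rl_kernel a t) (z powr - a)"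
proof -
  have "has_bochner_integral lborel (\<lambda>t. indicator {0..} t * t powr (a - 1) / exp t) (Gamma a)"
    using Gamma_conv_nn_integral_real[OF a] a
    by (intro has_bochner_integral_nn_integral) (auto simp: indicator_def less_imp_le)
  then have "has_bochner_integral lborel
      (\<lambda>t. indicator {0..} (0 + z * t) * (0 + z * t) powr (a - 1) / exp (0 + z * t)) (Gamma a /\<^sub>R \<bar>z\<bar>)"
    using z by (subst (asm) lborel_has_bochner_integral_real_affine_iff[where c=z and t=0]) auto
  then have "has_bochner_integral lborel
      (\<lambda>t. z powr (1 - a) / Gamma a * (indicator {0..} (0 + z * t) * (0 + z * t) powr (a - 1) / exp (0 + z * t)))
      (z powr (1 - a) / Gamma a * (Gamma a /\<^sub>R \<bar>z\<bar>))"
    by (rule has_bochner_integral_mult_right)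
  moreover have "z powr (1 - a) / Gamma a * (Gamma a /\<^sub>R \<bar>z\<bar>) = z powr - a"
    using Gamma_real_pos[OF a] z by (simp add: field_simps powr_diff powr_minus)
  moreover have "z powr (1 - a) / Gamma a * (indicator {0..} (0 + z * t) * (0 + z * t) powr (a - 1) / exp (0 + z * t))
      = exp (- z * t) * rl_kernel a t" for t
  proof (cases "0 < t")
    case True
    have "z powr (1 - a) * z powr (a - 1) = 1"
      using z by (simp flip: powr_add)
    then show ?thesis
      using z True by (simp add: rl_kernel_def powr_mult exp_minus field_simps)
  next
    \<comment> \<open>At t = 0 both sides vanish, since \<open>0 powr (a - 1) = 0\<close> for every
      exponent.\<close>
    case False
    then show ?thesis using z
      by (cases "t = 0") (auto simp: rl_kernel_def indicator_def zero_le_mult_iff)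
  qed
  ultimately show ?thesis by simp
qed

text \<open>The substitution s = t x turns the convolution into the Beta integral, and Beta(b, a)
  Gamma(a + b) = Gamma(a) Gamma(b). This semigroup law of the kernels is what makes fractional
  integrals compose.\<close>

lemma has_bochner_integral_rl_kernel_conv:
  assumes a: "0 < a" and b: "0 < b"
  shows "has_bochner_integral lborel (\<lambda>s. rl_kernel a (t - s) * rl_kernel b s) (rl_kernel (a + b) t)"
proof (cases "0 < t")
  case False
  then have "(\<lambda>s. rl_kernel a (t - s) * rl_kernel b s) = (\<lambda>s. 0)"
    by (auto simp: rl_kernel_def)
  then show ?thesis using False by (simp add: rl_kernel_def has_bochner_integral_zero)
next
  case t: True
  have "has_bochner_integral lborel (\<lambda>x. indicator {0..1} x *\<^sub>R (x powr (b - 1) * (1 - x) powr (a - 1))) (Beta b a)"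
    using integrable_Beta[OF b a] set_borel_integral_eq_integral(2)[OF integrable_Beta[OF b a]]
      has_integral_Beta_real[OF b a]
    unfolding has_bochner_integral_iff set_integrable_def set_lebesgue_integral_def
    by (auto simp: integral_unique)
  \<comment> \<open>The two kernels contribute t^(a-1) and t^(b-1), hence the power a + b - 2; the
    missing factor t is the Jacobian of s = t x.\<close>
  then have "has_bochner_integral lborel
     (\<lambda>x. t powr (a + b - 2) / (Gamma a * Gamma b) * (indicator {0..1} x *\<^sub>R (x powr (b - 1) * (1 - x) powr (a - 1))))
     (t powr (a + b - 2) / (Gamma a * Gamma b) * Beta b a)"
    by (rule has_bochner_integral_mult_right)
  moreover have "t powr (a + b - 2) / (Gamma a * Gamma b) * (indicator {0..1} x *\<^sub>R (x powr (b - 1) * (1 - x) powr (a - 1)))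
      = rl_kernel a (t - (0 + t * x)) * rl_kernel b (0 + t * x)" for x
  proof (cases "0 < x \<and> x < 1")
    case True
    then have pos: "t - t * x > 0" "t * x > 0" using t by auto
    have e: "t - t * x = t * (1 - x)" by (simp add: algebra_simps)
    have "t powr (a + b - 2) = t powr (a - 1) * t powr (b - 1)"
      using t by (simp flip: powr_add)
    then show ?thesis
      using pos True t by (simp add: rl_kernel_def e powr_mult zero_less_mult_iff)
  next
    case False
    then consider "x = 0" | "x = 1" | "x < 0 \<or> 1 < x" by fastforce
    then show ?thesis
    proof cases
      case 3
      then have "\<not> 0 < t * x \<or> \<not> 0 < t - t * x" using t
        by (auto simp: zero_less_mult_iff)
      then show ?thesis using 3 by (auto simp: rl_kernel_def)
    qed (auto simp: rl_kernel_def)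
  qed
  moreover have "t powr (a + b - 2) / (Gamma a * Gamma b) * Beta b a = rl_kernel (a + b) t /\<^sub>R \<bar>t\<bar>"
  proof -
    have "t powr (a + b - 2) = t powr (a + b - 1) / t"
      using t powr_diff[of t "a + b - 1" 1] by simp
    then show ?thesis using t Gamma_real_pos[OF a] Gamma_real_pos[OF b]
      by (simp add: rl_kernel_def Beta_def add.commute divide_simps)
  qed
  ultimately have "has_bochner_integral lborel
     (\<lambda>x. rl_kernel a (t - (0 + t * x)) * rl_kernel b (0 + t * x)) (rl_kernel (a + b) t /\<^sub>R \<bar>t\<bar>)"
    by simp
  then show ?thesis
    using t by (subst lborel_has_bochner_integral_real_affine_iff[where c=t and t=0]) auto
qed

lemma has_bochner_integral_rl_kernel_conv_shift:
  assumes a: "0 < a" and b: "0 < b"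
  shows "has_bochner_integral lborel (\<lambda>s. rl_kernel a (t - s) * rl_kernel b (s - u)) (rl_kernel (a + b) (t - u))"
  using has_bochner_integral_rl_kernel_conv[OF a b, of "t - u"]
  by (subst lborel_has_bochner_integral_real_affine_iff[where c=1 and t=u]) (auto simp: algebra_simps)

lemma integrable_shift_lborel:
  fixes f :: "real \<Rightarrow> real"
  assumes "integrable lborel f"
  shows "integrable lborel (\<lambda>t. f (t - s))" "(LINT t|lborel. f (t - s)) = (LINT t|lborel. f t)"
  using lborel_integrable_real_affine[OF assms, of 1 "-s"] lborel_integral_real_affine[of 1 f "-s"]
  by auto

lemma lborel_convolution:
  fixes f g :: "real \<Rightarrow> real"
  assumes f: "integrable lborel f" and g: "integrable lborel g"
  shows "integrable lborel (\<lambda>t. LINT s|lborel. f (t - s) * g s)"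
    and "(LINT t|lborel. LINT s|lborel. f (t - s) * g s) = (LINT t|lborel. f t) * (LINT s|lborel. g s)"
proof -
  have [measurable]: "f \<in> borel_measurable borel" "g \<in> borel_measurable borel"
    using f g by auto
  have int: "integrable (lborel \<Otimes>\<^sub>M lborel) (\<lambda>(s, t). f (t - s) * g s)"
  proof (rule lborel_pair.Fubini_integrable)
    have "(\<lambda>s. LINT t|lborel. norm (case (s, t) of (s, t) \<Rightarrow> f (t - s) * g s)) = (\<lambda>s. (LINT t|lborel. \<bar>f t\<bar>) * \<bar>g s\<bar>)"
      using integrable_shift_lborel(2)[OF integrable_abs[OF f]] by (simp add: abs_mult)
    then show "integrable lborel (\<lambda>s. LINT t|lborel. norm (case (s, t) of (s, t) \<Rightarrow> f (t - s) * g s))"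
      using g by simp
    show "AE s in lborel. integrable lborel (\<lambda>t. case (s, t) of (s, t) \<Rightarrow> f (t - s) * g s)"
      using integrable_shift_lborel(1)[OF f] by simp
  qed measurable
  show "integrable lborel (\<lambda>t. LINT s|lborel. f (t - s) * g s)"
    using lborel_pair.integrable_snd[OF int] .
  have "(LINT t|lborel. LINT s|lborel. f (t - s) * g s) = (LINT s|lborel. LINT t|lborel. f (t - s) * g s)"
    using lborel_pair.Fubini_integral[OF int] .
  also have "\<dots> = (LINT s|lborel. (LINT t|lborel. f t) * g s)"
    using integrable_shift_lborel(2)[OF f] by simp
  finally show "(LINT t|lborel. LINT s|lborel. f (t - s) * g s) = (LINT t|lborel. f t) * (LINT s|lborel. g s)"
    by simp
qed

lemma rl_integral_nonpos: "t \<le> 0 \<Longrightarrow> rl_integral a f t = 0"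
  unfolding rl_integral_def
  by (rule integral_eq_zero_AE) (auto simp: rl_kernel_def indicator_def)

lemma rl_integral_cong:
  "(\<And>s. 0 < s \<Longrightarrow> s < t \<Longrightarrow> f s = g s) \<Longrightarrow> rl_integral a f t = rl_integral a g t"
  unfolding rl_integral_def
  by (intro Bochner_Integration.integral_cong) (auto simp: rl_kernel_def indicator_def)

lemma laplace_cong:
  "(\<And>t. 0 < t \<Longrightarrow> f t = g t) \<Longrightarrow> laplace f z = laplace g z"
  unfolding laplace_def
  by (intro Bochner_Integration.integral_cong) (auto simp: indicator_def)

lemma
  assumes a: "0 < a" and z: "0 < z"
  shows laplace_rl_kernel: "laplace (rl_kernel a) z = z powr - a"
    and laplace_integrable_rl_kernel: "laplace_integrable (rl_kernel a) z"
proof -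
  have "(\<lambda>t. indicator {0<..} t * (exp (- z * t) * rl_kernel a t)) = (\<lambda>t. exp (- z * t) * rl_kernel a t)"
    by (auto simp: rl_kernel_def indicator_def)
  then show "laplace (rl_kernel a) z = z powr - a" "laplace_integrable (rl_kernel a) z"
    using has_bochner_integral_rl_kernel[OF a z] by (simp_all add: laplace_def laplace_integrable_def has_bochner_integral_iff)
qed

text \<open>Since exp(-z t) = exp(-z (t - s)) exp(-z s), the weight distributes over the convolution
  and the transform becomes a product. Only integrability of the weighted \<open>f\<close> is
  required, no smoothness.\<close>

lemma
  assumes a: "0 < a" and z: "0 < z" and f: "laplace_integrable f z"
  shows laplace_rl_integral: "laplace (rl_integral a f) z = z powr - a * laplace f z"
    and laplace_integrable_rl_integral: "laplace_integrable (rl_integral a f) z"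
proof -
  define F where "F t = exp (- z * t) * rl_kernel a t" for t
  define G where "G s = indicator {0<..} s * (exp (- z * s) * f s)" for s
  have F: "integrable lborel F" "(LINT t|lborel. F t) = z powr - a"
    using has_bochner_integral_rl_kernel[OF a z] unfolding F_def by (auto simp: has_bochner_integral_iff)
  have G: "integrable lborel G" using f by (simp add: G_def[abs_def] laplace_integrable_def)
  have FG: "(LINT s|lborel. F (t - s) * G s) = indicator {0<..} t * (exp (- z * t) * rl_integral a f t)" for t
  proof -
    have "F (t - s) * G s = exp (- z * t) * (rl_kernel a (t - s) * (indicator {0<..} s * f s))" for s
    proof -
      have "exp (- z * (t - s)) * exp (- z * s) = exp (- z * t)"
        by (simp add: algebra_simps flip: exp_add)
      then show ?thesis by (simp add: F_def G_def)
    qed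
    then have "(LINT s|lborel. F (t - s) * G s) = exp (- z * t) * rl_integral a f t"
      by (simp add: rl_integral_def)
    then show ?thesis using rl_integral_nonpos[of t a f] by (cases "0 < t") auto
  qed
  show "laplace (rl_integral a f) z = z powr - a * laplace f z"
    using lborel_convolution(2)[OF F(1) G] unfolding FG F(2) by (simp add: laplace_def G_def)
  show "laplace_integrable (rl_integral a f) z"
    using lborel_convolution(1)[OF F(1) G] unfolding FG by (simp add: laplace_integrable_def)
qed

text \<open>Fubini reduces the claim to the semigroup law of the kernels. The condition
  \<open>1 \<le> a + b\<close> makes the composed kernel bounded on (0, t), so plain integrability
  of \<open>w\<close> there controls the double integral.\<close>

lemma rl_integral_rl_integral:
  assumes a: "0 < a" and b: "0 < b" and ab: "1 \<le> a + b"
    and w: "set_integrable lborel {0<..<t} w"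
  shows "rl_integral a (rl_integral b w) t = rl_integral (a + b) w t"
proof -
  \<comment> \<open>\<open>w\<close> may be replaced by its restriction to (0, t): the product of
    the two kernels vanishes unless u < s < t.\<close>
  define v where "v u = indicator {0<..<t} u * w u" for u
  have v: "integrable lborel v" using w by (simp add: set_integrable_def v_def[abs_def])
  then have [measurable]: "v \<in> borel_measurable borel" by auto
  have inner: "has_bochner_integral lborel (\<lambda>s. rl_kernel a (t - s) * rl_kernel b (s - u)) (rl_kernel (a + b) (t - u))" for u
    by (rule has_bochner_integral_rl_kernel_conv_shift[OF a b])
  have int: "integrable (lborel \<Otimes>\<^sub>M lborel) (\<lambda>(u, s). rl_kernel a (t - s) * rl_kernel b (s - u) * v u)"
  proof (rule lborel_pair.Fubini_integrable)
    have eq: "(\<lambda>u. LINT s|lborel. norm (case (u, s) of (u, s) \<Rightarrow> rl_kernel a (t - s) * rl_kernel b (s - u) * v u))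
        = (\<lambda>u. rl_kernel (a + b) (t - u) * \<bar>v u\<bar>)"
      using inner by (simp add: abs_mult rl_kernel_nonneg a b has_bochner_integral_iff)
    show "integrable lborel (\<lambda>u. LINT s|lborel. norm (case (u, s) of (u, s) \<Rightarrow> rl_kernel a (t - s) * rl_kernel b (s - u) * v u))"
      unfolding eq
    proof (rule Bochner_Integration.integrable_bound)
      show "integrable lborel (\<lambda>u. t powr (a + b - 1) / Gamma (a + b) * \<bar>v u\<bar>)" using v by simp
      have "rl_kernel (a + b) (t - u) * \<bar>v u\<bar> \<le> t powr (a + b - 1) / Gamma (a + b) * \<bar>v u\<bar>" for u
      proof (cases "0 < u \<and> u < t")
        case True
        then have "rl_kernel (a + b) (t - u) \<le> t powr (a + b - 1) / Gamma (a + b)"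
          using a b ab by (auto simp: rl_kernel_def intro!: divide_right_mono powr_mono2 less_imp_le[OF Gamma_real_pos])
        then show ?thesis by (intro mult_right_mono) auto
      qed (auto simp: v_def)
      then show "AE u in lborel. norm (rl_kernel (a + b) (t - u) * \<bar>v u\<bar>) \<le> norm (t powr (a + b - 1) / Gamma (a + b) * \<bar>v u\<bar>)"
        using a b by (auto simp: abs_mult rl_kernel_nonneg Gamma_real_pos less_imp_le)
    qed measurable
    show "AE u in lborel. integrable lborel (\<lambda>s. case (u, s) of (u, s) \<Rightarrow> rl_kernel a (t - s) * rl_kernel b (s - u) * v u)"
      using inner by (auto simp: has_bochner_integral_iff)
  qed measurable
  have "rl_integral a (rl_integral b w) t = (LINT s|lborel. LINT u|lborel. rl_kernel a (t - s) * rl_kernel b (s - u) * v u)"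
    unfolding rl_integral_def[of a]
  proof (intro Bochner_Integration.integral_cong refl)
    fix s :: real
    have e: "rl_kernel a (t - s) * rl_kernel b (s - u) * v u =
        rl_kernel a (t - s) * (rl_kernel b (s - u) * (indicator {0<..} u * w u))" for u
      by (auto simp: v_def rl_kernel_def indicator_def)
    have "rl_kernel a (t - s) * (indicator {0<..} s * rl_integral b w s) = rl_kernel a (t - s) * rl_integral b w s"
      using rl_integral_nonpos[of s b w] by (auto simp: indicator_def)
    then show "rl_kernel a (t - s) * (indicator {0<..} s * rl_integral b w s)
      = (LINT u|lborel. rl_kernel a (t - s) * rl_kernel b (s - u) * v u)"
      unfolding e by (simp add: rl_integral_def)
  qed
  also have "\<dots> = (LINT u|lborel. LINT s|lborel. rl_kernel a (t - s) * rl_kernel b (s - u) * v u)"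
    using lborel_pair.Fubini_integral[OF int] by simp
  also have "\<dots> = (LINT u|lborel. rl_kernel (a + b) (t - u) * v u)"
    using inner by (simp add: has_bochner_integral_iff)
  also have "\<dots> = rl_integral (a + b) w t"
    unfolding rl_integral_def
    by (intro Bochner_Integration.integral_cong) (auto simp: v_def rl_kernel_def indicator_def)
  finally show ?thesis .
qed

section \<open>Inversion of Caputo derivatives\<close>

text \<open>A derivative is a pointwise limit of difference quotients with steps 1/(k+1). The
  indicators inside the quotient make every approximant measurable on the whole line, and openness
  of \<open>S\<close> makes them equal to 1 at s + 1/(k+1) for large k.\<close>

lemma borel_measurable_deriv_indicator:
  fixes h :: "real \<Rightarrow> real"
  assumes S: "open S" and h: "\<And>s. s \<in> S \<Longrightarrow> h differentiable (at s)"
  shows "(\<lambda>s. indicator S s * deriv h s) \<in> borel_measurable borel"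
proof -
  have [measurable]: "S \<in> sets borel" using S by simp
  have cont: "continuous_on S h"
    using h by (auto intro!: continuous_at_imp_continuous_on differentiable_imp_continuous_within)
  have H [measurable]: "(\<lambda>s. indicator S s * h s) \<in> borel_measurable borel"
    using borel_measurable_continuous_on_indicator[OF _ cont] by simp
  have lim: "(\<lambda>k. indicator S s * (real (Suc k) * (indicator S (s + 1 / real (Suc k)) * h (s + 1 / real (Suc k)) - indicator S s * h s)))
        \<longlonglongrightarrow> indicator S s * deriv h s" for s
  proof (cases "s \<in> S")
    case True
    have "DERIV h s :> deriv h s"
      using h[OF True] by (metis DERIV_imp_deriv real_differentiable_def)
    then have "((\<lambda>y. (h (s + y) - h s) / y) \<longlongrightarrow> deriv h s) (at 0)"
      by (simp add: DERIV_def)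
    moreover have "filterlim (\<lambda>k. 1 / real (Suc k)) (at 0) sequentially"
      unfolding filterlim_at using LIMSEQ_inverse_real_of_nat by (auto simp: inverse_eq_divide)
    ultimately have "(\<lambda>k. (h (s + 1 / real (Suc k)) - h s) / (1 / real (Suc k))) \<longlonglongrightarrow> deriv h s"
      by (rule filterlim_compose)
    moreover
    have "\<forall>\<^sub>F k in sequentially. s + 1 / real (Suc k) \<in> S"
    proof -
      have "(\<lambda>k. s + 1 / real (Suc k)) \<longlonglongrightarrow> s + 0"
        using LIMSEQ_inverse_real_of_nat by (intro tendsto_add tendsto_const) (simp add: inverse_eq_divide)
      then show ?thesis using topological_tendstoD[OF _ S] True by auto
    qed
    then have "\<forall>\<^sub>F k in sequentially. (h (s + 1 / real (Suc k)) - h s) / (1 / real (Suc k)) =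
        indicator S s * (real (Suc k) * (indicator S (s + 1 / real (Suc k)) * h (s + 1 / real (Suc k)) - indicator S s * h s))"
      by eventually_elim (use True in \<open>simp add: field_simps\<close>)
    ultimately show ?thesis using True
      by (auto intro: Lim_transform_eventually)
  qed simp
  show ?thesis
    by (rule borel_measurable_LIMSEQ_real[OF lim]) measurable
qed

lemma nat_ceiling_order_le_2:
  fixes \<nu> :: real
  assumes "0 < \<nu>" "\<nu> \<le> 2"
  shows "nat \<lceil>\<nu>\<rceil> = (if \<nu> \<le> 1 then 1 else 2)"
proof -
  have "\<lceil>\<nu>\<rceil> = (if \<nu> \<le> 1 then 1 else 2)"
    using assms by (auto simp: ceiling_unique)
  then show ?thesis by auto
qed

lemma caputo_eq_rl_integral:
  assumes "n = nat \<lceil>\<nu>\<rceil>" "\<nu> < real n"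
  shows "caputo \<nu> g t = rl_integral (real n - \<nu>) ((deriv ^^ n) g) t"
proof -
  have "caputo \<nu> g t = 1 / Gamma (real n - \<nu>) *
      (LINT s|lborel. indicator {0<..<t} s * ((deriv ^^ n) g s * (t - s) powr (real n - 1 - \<nu>)))"
    using assms by (simp add: caputo_def Let_def set_lebesgue_integral_def)
  also have "\<dots> = (LINT s|lborel. 1 / Gamma (real n - \<nu>) *
      (indicator {0<..<t} s * ((deriv ^^ n) g s * (t - s) powr (real n - 1 - \<nu>))))"
    by simp
  also have "\<dots> = rl_integral (real n - \<nu>) ((deriv ^^ n) g) t"
    unfolding rl_integral_def
    by (intro Bochner_Integration.integral_cong) (auto simp: rl_kernel_def indicator_def algebra_simps)
  finally show ?thesis .
qed

text \<open>Bridge from the gauge integral delivered by the fundamental theorem of calculus to the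
  Lebesgue integral. The endpoints are left out of the latter because derivatives may be singular
  there.\<close>

lemma has_integral_interior_lborel:
  fixes w :: "real \<Rightarrow> real"
  assumes "(w has_integral I) {a..b}" and "set_integrable lborel {a<..<b} w"
  shows "(LINT s|lborel. indicator {a<..<b} s * w s) = I"
proof -
  have "((\<lambda>s. indicator {a<..<b} s * w s) has_integral (LINT s|lborel. indicator {a<..<b} s * w s)) UNIV"
    using has_integral_integral_lborel[of "\<lambda>s. indicator {a<..<b} s * w s"] assms(2)
    by (simp add: set_integrable_def)
  then have "(w has_integral (LINT s|lborel. indicator {a<..<b} s * w s)) {a<..<b}"
    using has_integral_restrict_UNIV[of "{a<..<b}" w] by (simp add: indicator_times_eq_if(1))
  moreover have "(w has_integral I) {a<..<b}"
    using assms(1) by (simp add: has_integral_Icc_iff_Ioo)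
  ultimately show ?thesis by (rule has_integral_unique)
qed

lemma rl_integral_1: "rl_integral 1 w t = (LINT s|lborel. indicator {0<..<t} s * w s)"
  unfolding rl_integral_def
  by (intro Bochner_Integration.integral_cong) (auto simp: rl_kernel_def indicator_def)

lemma rl_integral_2: "rl_integral 2 w t = (LINT s|lborel. indicator {0<..<t} s * ((t - s) * w s))"
  unfolding rl_integral_def
  by (intro Bochner_Integration.integral_cong)
     (auto simp: rl_kernel_def indicator_def Gamma_numeral)

text \<open>Mean value theorem on [0, t/(k+1)]: the difference quotient at 0 is
  \<open>deriv g (\<xi> k)\<close>. The derivative itself need not converge at 0; a sequence along
  which it tends to \<open>d\<close> is enough for the boundary term of an integration by
  parts.\<close>

lemma deriv_limit_seq:
  fixes g :: "real \<Rightarrow> real"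
  assumes t: "0 < t" and cont: "continuous_on {0..t} g"
    and diff: "\<And>s. 0 < s \<Longrightarrow> s \<le> t \<Longrightarrow> g differentiable (at s)"
    and d0: "(g has_real_derivative d) (at 0 within {0..})"
  obtains \<xi> where "\<And>k. 0 < \<xi> k" "\<And>k::nat. \<xi> k < t" "\<xi> \<longlonglongrightarrow> 0" "(\<lambda>k. deriv g (\<xi> k)) \<longlonglongrightarrow> d"
proof -
  have D: "DERIV g s :> deriv g s" if "0 < s" "s \<le> t" for s
    using diff[OF that] by (metis DERIV_imp_deriv real_differentiable_def)
  define \<epsilon> where "\<epsilon> k = t / real (Suc k)" for k
  have \<epsilon>: "0 < \<epsilon> k" "\<epsilon> k \<le> t" for k using t by (auto simp: \<epsilon>_def field_simps)
  have \<epsilon>0: "\<epsilon> \<longlonglongrightarrow> 0"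
    using tendsto_mult_right[OF LIMSEQ_inverse_real_of_nat, of t] by (simp add: \<epsilon>_def[abs_def] field_simps)
  have "\<exists>x. 0 < x \<and> x < \<epsilon> k \<and> g (\<epsilon> k) - g 0 = (\<epsilon> k - 0) * deriv g x" for k
  proof -
    have "continuous_on {0..\<epsilon> k} g" using \<epsilon>[of k] by (intro continuous_on_subset[OF cont]) auto
    moreover have "g differentiable (at x)" if "0 < x" "x < \<epsilon> k" for x
      using diff \<epsilon>[of k] that by auto
    ultimately obtain l z where z: "0 < z" "z < \<epsilon> k" "DERIV g z :> l" "g (\<epsilon> k) - g 0 = (\<epsilon> k - 0) * l"
      using MVT[of 0 "\<epsilon> k" g] \<epsilon>[of k] by auto
    then show ?thesis by (metis DERIV_imp_deriv)
  qed
  then obtain \<xi> where \<xi>: "\<And>k. 0 < \<xi> k" "\<And>k. \<xi> k < \<epsilon> k" "\<And>k. g (\<epsilon> k) - g 0 = (\<epsilon> k - 0) * deriv g (\<xi> k)"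
    by metis
  have "((\<lambda>y. (g y - g 0) / (y - 0)) \<longlongrightarrow> d) (at 0 within {0..})"
    using d0 by (simp add: has_field_derivative_iff)
  moreover have "filterlim \<epsilon> (at 0 within {0..}) sequentially"
    unfolding filterlim_at using \<epsilon>0 \<epsilon>(1) by (auto intro!: always_eventually simp: less_imp_le less_imp_neq[symmetric])
  ultimately have "(\<lambda>k. (g (\<epsilon> k) - g 0) / (\<epsilon> k - 0)) \<longlonglongrightarrow> d"
    by (rule filterlim_compose)
  moreover have "(g (\<epsilon> k) - g 0) / (\<epsilon> k - 0) = deriv g (\<xi> k)" for k
    using \<xi>(3)[of k] \<epsilon>(1)[of k] by simp
  ultimately have "(\<lambda>k. deriv g (\<xi> k)) \<longlonglongrightarrow> d" by simp
  moreover have "\<xi> \<longlonglongrightarrow> 0"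
    by (rule tendsto_sandwich[OF _ _ tendsto_const \<epsilon>0]) (auto intro!: always_eventually less_imp_le \<xi>)
  moreover have "\<xi> k < t" for k using \<xi>(2)[of k] \<epsilon>(2)[of k] by linarith
  ultimately show ?thesis using \<xi>(1) that by blast
qed

text \<open>Taylor's formula with integral remainder: (t - s) g'(s) + g(s) is an antiderivative of
  (t - s) g''(s). The lower limit is moved to 0 along the points of \<open>deriv_limit_seq\<close>,
  where g' tends to 0.\<close>

lemma rl_integral_second_deriv:
  fixes g :: "real \<Rightarrow> real"
  assumes t: "0 < t" and cont: "continuous_on {0..t} g"
    and diff: "\<And>s. 0 < s \<Longrightarrow> s \<le> t \<Longrightarrow> g differentiable (at s)"
    and diff': "\<And>s. 0 < s \<Longrightarrow> s \<le> t \<Longrightarrow> deriv g differentiable (at s)"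
    and d0: "(g has_real_derivative 0) (at 0 within {0..})"
    and int: "set_integrable lborel {0<..<t} (deriv (deriv g))"
  shows "rl_integral 2 (deriv (deriv g)) t = g t - g 0"
proof -
  define w where "w = deriv (deriv g)"
  obtain \<xi> where \<xi>: "\<And>k. 0 < \<xi> k" "\<And>k::nat. \<xi> k < t" "\<xi> \<longlonglongrightarrow> 0" "(\<lambda>k. deriv g (\<xi> k)) \<longlonglongrightarrow> 0"
    using deriv_limit_seq[OF t cont diff d0] by blast
  have D: "DERIV g s :> deriv g s" and D': "DERIV (deriv g) s :> w s" if "0 < s" "s \<le> t" for s
    using diff[OF that] diff'[OF that] unfolding w_def by (metis DERIV_imp_deriv real_differentiable_def)+
  have v: "integrable lborel (\<lambda>s. indicator {0<..<t} s * ((t - s) * w s))"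
  proof (rule Bochner_Integration.integrable_bound)
    show "integrable lborel (\<lambda>s. t * (indicator {0<..<t} s * w s))"
      using int by (simp add: set_integrable_def w_def)
    have "(\<lambda>s. indicator {0<..<t} s * w s) \<in> borel_measurable lborel"
      using int by (simp add: set_integrable_def w_def)
    then have "(\<lambda>s. (t - s) * (indicator {0<..<t} s * w s)) \<in> borel_measurable lborel" by measurable
    then show "(\<lambda>s. indicator {0<..<t} s * ((t - s) * w s)) \<in> borel_measurable lborel"
      by (simp add: mult_ac)
  qed (auto simp: indicator_def abs_mult intro!: mult_right_mono)
  have eq: "(LINT s|lborel. indicator {\<xi> k<..<t} s * ((t - s) * w s)) = g t - g (\<xi> k) - (t - \<xi> k) * deriv g (\<xi> k)" for k
  proof (rule has_integral_interior_lborel)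
    have "((\<lambda>s. (t - s) * w s) has_integral
        ((t - t) * deriv g t + g t) - ((t - \<xi> k) * deriv g (\<xi> k) + g (\<xi> k))) {\<xi> k..t}"
    proof (rule fundamental_theorem_of_calculus)
      fix x assume "x \<in> {\<xi> k..t}"
      then have "0 < x" "x \<le> t" using \<xi>(1)[of k] by auto
      note D[OF this] D'[OF this]
      then have "DERIV (\<lambda>s. (t - s) * deriv g s + g s) x :> (t - x) * w x"
        by (auto intro!: derivative_eq_intros)
      then show "((\<lambda>s. (t - s) * deriv g s + g s) has_vector_derivative (t - x) * w x) (at x within {\<xi> k..t})"
        using has_real_derivative_iff_has_vector_derivative has_vector_derivative_at_within by blast
    qed (use \<xi>(2) less_imp_le in blast)
    then show "((\<lambda>s. (t - s) * w s) has_integral g t - g (\<xi> k) - (t - \<xi> k) * deriv g (\<xi> k)) {\<xi> k..t}"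
      by (simp add: algebra_simps)
    have "set_integrable lborel {0<..<t} (\<lambda>s. (t - s) * w s)"
      using v by (simp add: set_integrable_def)
    then show "set_integrable lborel {\<xi> k<..<t} (\<lambda>s. (t - s) * w s)"
      by (rule set_integrable_subset) (use \<xi>(1)[of k] in auto)
  qed
  have "(\<lambda>k. LINT s|lborel. indicator {\<xi> k<..<t} s * ((t - s) * w s)) \<longlonglongrightarrow> (LINT s|lborel. indicator {0<..<t} s * ((t - s) * w s))"
  proof (rule integral_dominated_convergence[where w="\<lambda>s. norm (indicator {0<..<t} s * ((t - s) * w s))"])
    show m: "(\<lambda>s. indicator {0<..<t} s * ((t - s) * w s)) \<in> borel_measurable lborel"
      using v by auto
    show "(\<lambda>s. indicator {\<xi> k<..<t} s * ((t - s) * w s)) \<in> borel_measurable lborel" for k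
    proof -
      have "(\<lambda>s. indicator {\<xi> k<..<t} s * (indicator {0<..<t} s * ((t - s) * w s))) \<in> borel_measurable lborel"
        using m by measurable
      also have "(\<lambda>s. indicator {\<xi> k<..<t} s * (indicator {0<..<t} s * ((t - s) * w s))) = (\<lambda>s. indicator {\<xi> k<..<t} s * ((t - s) * w s))"
        using \<xi>(1)[of k] by (auto simp: indicator_def)
      finally show ?thesis .
    qed
    show "integrable lborel (\<lambda>s. norm (indicator {0<..<t} s * ((t - s) * w s)))"
      using v by (rule integrable_norm)
    show "AE s in lborel. (\<lambda>k. indicator {\<xi> k<..<t} s * ((t - s) * w s)) \<longlonglongrightarrow> indicator {0<..<t} s * ((t - s) * w s)"
    proof (rule AE_I2)
      fix s :: real
      show "(\<lambda>k. indicator {\<xi> k<..<t} s * ((t - s) * w s)) \<longlonglongrightarrow> indicator {0<..<t} s * ((t - s) * w s)"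
      proof (cases "0 < s")
        case True
        then have "\<forall>\<^sub>F k in sequentially. \<xi> k < s" using \<xi>(3) order_tendstoD(2) by blast
        then have "\<forall>\<^sub>F k in sequentially. indicator {0<..<t} s * ((t - s) * w s) = indicator {\<xi> k<..<t} s * ((t - s) * w s)"
          by eventually_elim (use True in \<open>auto simp: indicator_def\<close>)
        then show ?thesis by (rule Lim_transform_eventually[OF tendsto_const])
      next
        case False
        then have "indicator {\<xi> k<..<t} s = (0::real)" for k using \<xi>(1)[of k] by (auto simp: indicator_def)
        then show ?thesis using False by simp
      qed
    qed
    show "AE s in lborel. norm (indicator {\<xi> k<..<t} s * ((t - s) * w s)) \<le> norm (indicator {0<..<t} s * ((t - s) * w s))" for k
      using \<xi>(1)[of k] by (auto simp: indicator_def)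
  qed
  moreover have "(\<lambda>k. g t - g (\<xi> k) - (t - \<xi> k) * deriv g (\<xi> k)) \<longlonglongrightarrow> g t - g 0 - (t - 0) * 0"
  proof -
    have "(\<lambda>k. g (\<xi> k)) \<longlonglongrightarrow> g 0"
      using cont t \<xi> unfolding continuous_on_sequentially comp_def by (auto simp: less_imp_le)
    then show ?thesis using \<xi>(3,4) by (intro tendsto_intros) auto
  qed
  ultimately have "(LINT s|lborel. indicator {0<..<t} s * ((t - s) * w s)) = g t - g 0 - (t - 0) * 0"
    unfolding eq by (rule LIMSEQ_unique)
  then show ?thesis unfolding rl_integral_2 w_def by simp
qed

text \<open>By definition D^\<nu> g = J^(n-\<nu>) g^(n), with J^a the Riemann-Liouville integral.
  Applying J^\<nu> gives J^n g^(n), which is g - g(0) by the fundamental theorem (n = 1) or by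
  Taylor's formula with g'(0) = 0 (n = 2).\<close>

theorem caputo_inversion:
  assumes \<nu>: "0 < \<nu>" "\<nu> \<le> 2" and t: "0 < t"
    and diff: "caputo_differentiable \<nu> g t"
    and bound: "\<And>s. 0 < s \<Longrightarrow> s < t \<Longrightarrow> \<bar>caputo \<nu> g s\<bar> \<le> C"
    and init: "1 < \<nu> \<Longrightarrow> (g has_real_derivative 0) (at 0 within {0..})"
  shows "g t = g 0 + rl_integral \<nu> (caputo \<nu> g) t"
proof -
  define n where "n = nat \<lceil>\<nu>\<rceil>"
  define w where "w = (deriv ^^ n) g"
  have n: "n = (if \<nu> \<le> 1 then 1 else 2)" using nat_ceiling_order_le_2[OF \<nu>] by (simp add: n_def)
  have n\<nu>: "\<nu> \<le> real n" "real n - 1 < \<nu>" using n \<nu> by (auto split: if_splits)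
  have cont: "continuous_on {0..t} g" and d: "\<And>k s. k < n \<Longrightarrow> 0 < s \<Longrightarrow> s \<le> t \<Longrightarrow> (deriv ^^ k) g differentiable (at s)"
    using diff by (auto simp: caputo_differentiable_def Let_def n_def)
  have wm: "(\<lambda>s. indicator {0<..<t} s * w s) \<in> borel_measurable borel"
  proof -
    have "w = deriv ((deriv ^^ (n - 1)) g)" using n by (auto simp: w_def numeral_2_eq_2)
    moreover have "(\<lambda>s. indicator {0<..<t} s * deriv ((deriv ^^ (n - 1)) g) s) \<in> borel_measurable borel"
    proof (rule borel_measurable_deriv_indicator)
      show "(deriv ^^ (n - 1)) g differentiable (at s)" if "s \<in> {0<..<t}" for s
        using that n by (intro d) (auto split: if_splits)
    qed simp
    ultimately show ?thesis by simp
  qed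
  \<comment> \<open>Composing fractional integrals needs g^(n) itself to be integrable. For integral
    \<nu> it equals the Caputo derivative, bounded by \<open>C\<close>; otherwise it is integrable
    against a weight that is bounded below.\<close>
  have int: "set_integrable lborel {0<..<t} w"
  proof (cases "\<nu> = real n")
    case True
    then have "w s = caputo \<nu> g s" for s
      unfolding w_def by (simp add: caputo_def n_def[symmetric])
    then have wb: "\<bar>w s\<bar> \<le> C" if "0 < s" "s < t" for s using bound that by simp
    show ?thesis unfolding set_integrable_def
    proof (rule Bochner_Integration.integrable_bound)
      show "integrable lborel (\<lambda>s. C * indicator {0<..<t} s)" using t by simp
      show "AE s in lborel. norm (indicator {0<..<t} s *\<^sub>R w s) \<le> norm (C * indicator {0<..<t} s)"
        using wb by (fastforce simp: indicator_def)
    qed (use wm in simp)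
  next
    case False
    then have "\<nu> < real n" using n\<nu> by simp
    then have i: "integrable lborel (\<lambda>s. indicator {0<..<t} s * (w s * (t - s) powr (real n - 1 - \<nu>)))"
      using diff by (simp add: caputo_differentiable_def Let_def n_def w_def set_integrable_def)
    show ?thesis unfolding set_integrable_def
    proof (rule Bochner_Integration.integrable_bound)
      show "integrable lborel (\<lambda>s. t powr (\<nu> + 1 - real n) * (indicator {0<..<t} s * (w s * (t - s) powr (real n - 1 - \<nu>))))"
        using i by simp
      show "AE s in lborel. norm (indicator {0<..<t} s *\<^sub>R w s)
          \<le> norm (t powr (\<nu> + 1 - real n) * (indicator {0<..<t} s * (w s * (t - s) powr (real n - 1 - \<nu>))))"
      proof (rule AE_I2)
        fix s :: real
        show "norm (indicator {0<..<t} s *\<^sub>R w s)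
          \<le> norm (t powr (\<nu> + 1 - real n) * (indicator {0<..<t} s * (w s * (t - s) powr (real n - 1 - \<nu>))))"
        proof (cases "0 < s \<and> s < t")
          case True
          \<comment> \<open>Since n - 1 < \<nu>, the weight (t - s)^(n-1-\<nu>) is at least
            t^(n-1-\<nu>), whose inverse is the constant in the majorant.\<close>
          have "1 = (t - s) powr (\<nu> + 1 - real n) * (t - s) powr (real n - 1 - \<nu>)"
            using True by (simp flip: powr_add)
          also have "\<dots> \<le> t powr (\<nu> + 1 - real n) * (t - s) powr (real n - 1 - \<nu>)"
            using True n\<nu> by (intro mult_right_mono powr_mono2) auto
          finally have "\<bar>w s\<bar> * 1 \<le> \<bar>w s\<bar> * (t powr (\<nu> + 1 - real n) * (t - s) powr (real n - 1 - \<nu>))"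
            by (intro mult_left_mono) auto
          then show ?thesis using True by (simp add: abs_mult mult_ac)
        qed auto
      qed
    qed (use wm in simp)
  qed
  have rl_n: "rl_integral (real n) w t = g t - g 0"
  proof (cases "\<nu> \<le> 1")
    case True
    then have n1: "n = 1" using n by simp
    have D: "DERIV g s :> w s" if "0 < s" "s \<le> t" for s
      using d[of 0 s] that unfolding w_def n1 by (auto simp: real_differentiable_def DERIV_imp_deriv)
    have "(w has_integral (g t - g 0)) {0..t}"
      by (rule fundamental_theorem_of_calculus_interior)
        (use t cont D in \<open>auto simp flip: has_real_derivative_iff_has_vector_derivative\<close>)
    then show ?thesis using has_integral_interior_lborel int by (simp add: rl_integral_1 n1)
  next
    case False
    then have n2: "n = 2" using n by simp
    show ?thesis
      using rl_integral_second_deriv[OF t cont] d[of 0] d[of 1] init False int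
      by (simp add: n2 w_def numeral_2_eq_2)
  qed
  show ?thesis
  proof (cases "\<nu> = real n")
    case True
    then have "caputo \<nu> g = w" unfolding w_def by (auto simp: caputo_def n_def[symmetric])
    then show ?thesis using rl_n True by simp
  next
    case False
    then have less: "\<nu> < real n" using n\<nu> by simp
    have "caputo \<nu> g = rl_integral (real n - \<nu>) w"
      using caputo_eq_rl_integral[OF n_def less] by (auto simp: w_def)
    moreover have "rl_integral \<nu> (rl_integral (real n - \<nu>) w) t = rl_integral (real n) w t"
      using rl_integral_rl_integral[OF \<nu>(1) _ _ int, of "real n - \<nu>"] less n by (auto split: if_splits)
    ultimately show ?thesis using rl_n by simp
  qed
qed

lemma borel_measurable_rl_integral:
  assumes [measurable]: "(\<lambda>s. indicator {0<..} s * w s) \<in> borel_measurable borel"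
  shows "rl_integral a w \<in> borel_measurable borel"
  unfolding rl_integral_def[abs_def] by measurable

lemma borel_measurable_caputo:
  assumes \<nu>: "0 < \<nu>" "\<nu> \<le> 1"
    and diff: "\<And>t. 0 < t \<Longrightarrow> caputo_differentiable \<nu> g t"
  shows "(\<lambda>t. indicator {0<..} t * caputo \<nu> g t) \<in> borel_measurable borel"
proof -
  have n: "nat \<lceil>\<nu>\<rceil> = 1" using nat_ceiling_order_le_2[of \<nu>] \<nu> by simp
  have "g differentiable (at s)" if "0 < s" for s
    using diff[OF that] that unfolding caputo_differentiable_def n by (auto simp: Let_def)
  then have w: "(\<lambda>s. indicator {0<..} s * deriv g s) \<in> borel_measurable borel"
    by (intro borel_measurable_deriv_indicator) auto
  show ?thesis
  proof (cases "\<nu> = 1")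
    case True
    then show ?thesis using w by (simp add: caputo_def)
  next
    case False
    then have "caputo \<nu> g = rl_integral (1 - \<nu>) (deriv g)"
      using caputo_eq_rl_integral[of 1 \<nu> g] n \<nu> by auto
    moreover note borel_measurable_rl_integral[OF w, measurable]
    ultimately show ?thesis by simp
  qed
qed

section \<open>Uniqueness for Laplace transforms and for the resolvent equation\<close>

lemma laplace_integrable_bounded:
  assumes m: "(\<lambda>t. indicator {0<..} t * f t) \<in> borel_measurable borel"
    and bound: "\<And>t. 0 < t \<Longrightarrow> \<bar>f t\<bar> \<le> C" and z: "0 < z"
  shows "laplace_integrable f z"
  unfolding laplace_integrable_def
proof (rule Bochner_Integration.integrable_bound)
  \<comment> \<open>\<open>rl_kernel 1\<close> is 1 on the positive half-line, so integrability of a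
    constant is already contained in the Gamma integral.\<close>
  show "integrable lborel (\<lambda>t. C * (indicator {0<..} t * (exp (- z * t) * rl_kernel 1 t)))"
    using laplace_integrable_rl_kernel[OF _ z, of 1] by (simp add: laplace_integrable_def)
  have "(\<lambda>t. exp (- z * t) * (indicator {0<..} t * f t)) \<in> borel_measurable lborel"
    using m by measurable
  then show "(\<lambda>t. indicator {0<..} t * (exp (- z * t) * f t)) \<in> borel_measurable lborel"
    by (simp add: mult_ac)
  show "AE t in lborel. norm (indicator {0<..} t * (exp (- z * t) * f t)) \<le>
      norm (C * (indicator {0<..} t * (exp (- z * t) * rl_kernel 1 t)))"
  proof (rule AE_I2)
    fix t :: real
    show "norm (indicator {0<..} t * (exp (- z * t) * f t)) \<le>
      norm (C * (indicator {0<..} t * (exp (- z * t) * rl_kernel 1 t)))"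
    proof (cases "0 < t")
      case True
      then have "\<bar>f t\<bar> \<le> \<bar>C\<bar>" using bound[OF True] by linarith
      then show ?thesis using True by (simp add: abs_mult rl_kernel_def mult.commute)
    qed simp
  qed
qed

lemma laplace_integrable_add:
  "laplace_integrable f z \<Longrightarrow> laplace_integrable g z \<Longrightarrow> laplace_integrable (\<lambda>t. f t + g t) z"
  unfolding laplace_integrable_def distrib_left by (rule Bochner_Integration.integrable_add)

lemma laplace_integrable_diff:
  "laplace_integrable f z \<Longrightarrow> laplace_integrable g z \<Longrightarrow> laplace_integrable (\<lambda>t. f t - g t) z"
  unfolding laplace_integrable_def right_diff_distrib by (rule Bochner_Integration.integrable_diff)

lemma laplace_integrable_cmult:
  assumes "laplace_integrable f z"
  shows "laplace_integrable (\<lambda>t. c * f t) z"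
proof -
  have "integrable lborel (\<lambda>t. c * (indicator {0<..} t * (exp (- z * t) * f t)))"
    using assms unfolding laplace_integrable_def by (rule integrable_mult_right)
  then show ?thesis by (simp add: laplace_integrable_def mult_ac)
qed

lemma laplace_add:
  "laplace_integrable f z \<Longrightarrow> laplace_integrable g z \<Longrightarrow> laplace (\<lambda>t. f t + g t) z = laplace f z + laplace g z"
  unfolding laplace_integrable_def laplace_def distrib_left by (rule Bochner_Integration.integral_add)

lemma laplace_diff:
  "laplace_integrable f z \<Longrightarrow> laplace_integrable g z \<Longrightarrow> laplace (\<lambda>t. f t - g t) z = laplace f z - laplace g z"
  unfolding laplace_integrable_def laplace_def right_diff_distrib by (rule Bochner_Integration.integral_diff)

lemma laplace_cmult: "laplace (\<lambda>t. c * f t) z = c * laplace f z"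
proof -
  have "(LINT t|lborel. indicator {0<..} t * (exp (- z * t) * (c * f t))) =
      (LINT t|lborel. c * (indicator {0<..} t * (exp (- z * t) * f t)))"
    by (intro Bochner_Integration.integral_cong) auto
  then show ?thesis by (simp add: laplace_def)
qed

lemma
  assumes "0 < z"
  shows laplace_const: "laplace (\<lambda>t. c) z = c / z"
    and laplace_integrable_const: "laplace_integrable (\<lambda>t. c) z"
proof -
  have "laplace (\<lambda>t. 1) z = 1 / z"
    using laplace_rl_kernel[of 1 z] assms laplace_cong[of "rl_kernel 1" "\<lambda>t. 1" z]
    by (simp add: rl_kernel_def powr_minus divide_inverse)
  then show "laplace (\<lambda>t. c) z = c / z" using laplace_cmult[of c "\<lambda>t. 1"] by simp
  show "laplace_integrable (\<lambda>t. c) z"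
    by (rule laplace_integrable_bounded[of _ "\<bar>c\<bar>"]) (use assms in auto)
qed

lemma borel_measurable_continuous_on_greaterThan:
  fixes f :: "real \<Rightarrow> real"
  assumes "continuous_on {0<..} f"
  shows "(\<lambda>t. indicator {0<..} t * f t) \<in> borel_measurable borel"
  using borel_measurable_continuous_on_indicator[OF _ assms] by simp

lemma laplace_tendsto:
  fixes f :: "nat \<Rightarrow> real \<Rightarrow> real"
  assumes z: "0 < z" and m: "\<And>k. (\<lambda>t. indicator {0<..} t * f k t) \<in> borel_measurable borel"
    and bound: "\<And>k t. 0 < t \<Longrightarrow> \<bar>f k t\<bar> \<le> C"
    and lim: "\<And>t. 0 < t \<Longrightarrow> (\<lambda>k. f k t) \<longlonglongrightarrow> g t"
  shows "(\<lambda>k. laplace (f k) z) \<longlonglongrightarrow> laplace g z"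
  unfolding laplace_def
proof (rule integral_dominated_convergence[where w="\<lambda>t. indicator {0<..} t * (exp (- z * t) * C)"])
  show fm: "(\<lambda>t. indicator {0<..} t * (exp (- z * t) * f k t)) \<in> borel_measurable lborel" for k
    using laplace_integrable_bounded[OF m bound z] by (auto simp: laplace_integrable_def)
  show lim': "AE t in lborel. (\<lambda>k. indicator {0<..} t * (exp (- z * t) * f k t)) \<longlonglongrightarrow> indicator {0<..} t * (exp (- z * t) * g t)"
  proof (rule AE_I2)
    fix t :: real
    show "(\<lambda>k. indicator {0<..} t * (exp (- z * t) * f k t)) \<longlonglongrightarrow> indicator {0<..} t * (exp (- z * t) * g t)"
      by (cases "0 < t") (auto intro!: tendsto_intros lim)
  qed
  show "(\<lambda>t. indicator {0<..} t * (exp (- z * t) * g t)) \<in> borel_measurable lborel"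
  proof (rule borel_measurable_LIMSEQ_real[OF _ fm])
    fix t :: real
    show "(\<lambda>k. indicator {0<..} t * (exp (- z * t) * f k t)) \<longlonglongrightarrow> indicator {0<..} t * (exp (- z * t) * g t)"
      by (cases "0 < t") (auto intro!: tendsto_intros lim)
  qed
  show "integrable lborel (\<lambda>t. indicator {0<..} t * (exp (- z * t) * C))"
    using laplace_integrable_const[OF z, of C] by (simp only: laplace_integrable_def)
  show "AE t in lborel. norm (indicator {0<..} t * (exp (- z * t) * f k t)) \<le> indicator {0<..} t * (exp (- z * t) * C)" for k
    using bound by (auto simp: indicator_def abs_mult)
qed

lemma abs_laplace_le:
  assumes z: "0 < z" and bound: "\<And>t. 0 < t \<Longrightarrow> \<bar>f t\<bar> \<le> C"
  shows "\<bar>laplace f z\<bar> \<le> C / z"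
proof -
  have C: "0 \<le> C" using bound[of 1] by linarith
  have "\<bar>laplace f z\<bar> \<le> (LINT t|lborel. \<bar>indicator {0<..} t * (exp (- z * t) * f t)\<bar>)"
    unfolding laplace_def by (rule integral_abs_bound)
  also have "\<dots> \<le> laplace (\<lambda>t. C) z"
    unfolding laplace_def
  proof (rule integral_mono_AE')
    show "integrable lborel (\<lambda>t. indicator {0<..} t * (exp (- z * t) * C))"
      using laplace_integrable_const[OF z, of C] by (simp only: laplace_integrable_def)
  qed (use bound C in \<open>auto simp: indicator_def abs_mult\<close>)
  finally show ?thesis by (simp add: laplace_const[OF z])
qed

text \<open>The values at z = 1, 2, 3, ... suffice: exp(-(i+1) t) = exp(-t) exp(-t)^i, so they are
  the moments of \<open>f\<close> in the variable x = exp(-t), and \<open>f\<close> becomes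
  orthogonal to every polynomial in x.\<close>

lemma laplace_eq_0_imp_polynomial:
  assumes f: "laplace_integrable f 1" and z: "\<And>n. laplace_integrable f (real (Suc n))"
    and zero: "\<And>n. laplace f (real (Suc n)) = 0"
  shows "laplace_integrable (\<lambda>t. (\<Sum>i\<le>n. a i * exp (- t) ^ i) * f t) 1"
    and "laplace (\<lambda>t. (\<Sum>i\<le>n. a i * exp (- t) ^ i) * f t) 1 = 0"
proof -
  have e: "indicator {0<..} t * (exp (- 1 * t) * ((\<Sum>i\<le>n. a i * exp (- t) ^ i) * f t)) =
      (\<Sum>i\<le>n. a i * (indicator {0<..} t * (exp (- real (Suc i) * t) * f t)))" for t
  proof -
    have *: "exp (- 1 * t) * exp (- t) ^ i = exp (- real (Suc i) * t)" for i
      using exp_of_nat_mult[of "Suc i" "- t"] by (simp add: algebra_simps)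
    have "indicator {0<..} t * (exp (- 1 * t) * ((\<Sum>i\<le>n. a i * exp (- t) ^ i) * f t)) =
        (\<Sum>i\<le>n. a i * exp (- t) ^ i) * (indicator {0<..} t * (exp (- 1 * t) * f t))"
      by simp
    also have "\<dots> = (\<Sum>i\<le>n. a i * (indicator {0<..} t * ((exp (- 1 * t) * exp (- t) ^ i) * f t)))"
      unfolding sum_distrib_right by (intro sum.cong refl) simp
    finally show ?thesis unfolding * .
  qed
  show "laplace_integrable (\<lambda>t. (\<Sum>i\<le>n. a i * exp (- t) ^ i) * f t) 1"
    unfolding laplace_integrable_def e using z
    by (auto simp: laplace_integrable_def intro!: Bochner_Integration.integrable_sum)
  show "laplace (\<lambda>t. (\<Sum>i\<le>n. a i * exp (- t) ^ i) * f t) 1 = 0"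
    unfolding laplace_def e using z zero
    by (subst Bochner_Integration.integral_sum) (auto simp: laplace_integrable_def laplace_def simp del: of_nat_Suc)
qed

text \<open>
  Weierstrass approximation applied to \<open>x (1 - x) f (- ln x)\<close>, which extends continuously to
  \<open>[0, 1]\<close> because \<open>f\<close> is bounded.
\<close>

theorem laplace_eq_0_imp_eq_0:
  fixes f :: "real \<Rightarrow> real"
  assumes cont: "continuous_on {0<..} f" and bound: "\<And>t. 0 < t \<Longrightarrow> \<bar>f t\<bar> \<le> C"
    and zero: "\<And>z. 0 < z \<Longrightarrow> laplace f z = 0" and t: "0 < t"
  shows "f t = 0"
proof -
  note fm = borel_measurable_continuous_on_greaterThan[OF cont]
  have C: "0 \<le> C" using bound[of 1] by linarith
  have int: "laplace_integrable f z" if "0 < z" for z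
    by (rule laplace_integrable_bounded[OF fm bound that])
  define \<phi> where "\<phi> x = (if x \<in> {0<..<1} then x * (1 - x) * f (- ln x) else 0)" for x
  have \<phi>_bound: "\<bar>\<phi> x\<bar> \<le> C * \<bar>x * (1 - x)\<bar>" for x
  proof (cases "x \<in> {0<..<1}")
    case True
    then have "\<bar>f (- ln x)\<bar> \<le> C" by (intro bound) auto
    then have "\<bar>x * (1 - x)\<bar> * \<bar>f (- ln x)\<bar> \<le> \<bar>x * (1 - x)\<bar> * C" by (intro mult_left_mono) auto
    then show ?thesis using True by (simp add: \<phi>_def abs_mult mult_ac)
  qed (use C in \<open>auto simp: \<phi>_def\<close>)
  have \<phi>_cont: "continuous_on {0..1} \<phi>"
    unfolding continuous_on_eq_continuous_within
  proof
    fix x :: real assume x: "x \<in> {0..1}"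
    show "continuous (at x within {0..1}) \<phi>"
    proof (cases "x \<in> {0<..<1}")
      case True
      have "continuous_on {0<..<1} (\<lambda>x. x * (1 - x) * f (- ln x))"
        by (intro continuous_intros continuous_on_compose2[OF cont]) auto
      then have "continuous_on {0<..<1} \<phi>"
        by (rule continuous_on_eq) (auto simp: \<phi>_def)
      then have "continuous (at x) \<phi>" using True by (simp add: continuous_on_eq_continuous_at)
      then show ?thesis by (rule continuous_at_imp_continuous_at_within)
    next
      case False
      then have x01: "x = 0 \<or> x = 1" using x by auto
      have "((\<lambda>y. C * \<bar>y * (1 - y)\<bar>) \<longlongrightarrow> C * \<bar>x * (1 - x)\<bar>) (at x within {0..1})"
        by (intro tendsto_intros)
      then have "((\<lambda>y. C * \<bar>y * (1 - y)\<bar>) \<longlongrightarrow> 0) (at x within {0..1})" using x01 by auto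
      then have "(\<phi> \<longlongrightarrow> 0) (at x within {0..1})"
        by (rule Lim_null_comparison[rotated]) (use \<phi>_bound in auto)
      then show ?thesis using x01 by (auto simp: continuous_within \<phi>_def)
    qed
  qed
  have \<phi>m: "(\<lambda>t. indicator {0<..} t * (\<phi> (exp (- t)) * f t)) \<in> borel_measurable borel"
  proof (rule borel_measurable_continuous_on_greaterThan)
    show "continuous_on {0<..} (\<lambda>t. \<phi> (exp (- t)) * f t)"
      by (intro continuous_on_mult continuous_on_compose2[OF \<phi>_cont] cont) (auto intro!: continuous_intros)
  qed
  have \<phi>_le: "\<bar>\<phi> x\<bar> \<le> C" if "0 < x" "x < 1" for x
  proof -
    have "\<bar>x * (1 - x)\<bar> \<le> 1" using that by (simp add: abs_mult mult_le_one)
    then have "C * \<bar>x * (1 - x)\<bar> \<le> C * 1" using C by (intro mult_left_mono)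
    then show ?thesis using \<phi>_bound[of x] by simp
  qed
  have \<phi>_int: "laplace_integrable (\<lambda>t. \<phi> (exp (- t)) * f t) 1"
  proof (rule laplace_integrable_bounded[OF \<phi>m])
    show "\<bar>\<phi> (exp (- t)) * f t\<bar> \<le> C * C" if "0 < t" for t
      unfolding abs_mult using that C by (intro mult_mono bound \<phi>_le) auto
  qed simp
  have "\<bar>laplace (\<lambda>t. \<phi> (exp (- t)) * f t) 1\<bar> \<le> e" if e: "0 < e" for e
  proof -
    \<comment> \<open>The approximation error gets multiplied by \<open>f\<close>, which is at most
      \<open>C\<close>; C + 1 instead of C keeps the tolerance positive when C = 0.\<close>
    have "0 < e / (C + 1)" using e C by simp
    then obtain P where P: "real_polynomial_function P" "\<And>x. x \<in> {0..1} \<Longrightarrow> \<bar>\<phi> x - P x\<bar> < e / (C + 1)"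
      using Stone_Weierstrass_real_polynomial_function[OF _ \<phi>_cont] by (metis compact_Icc)
    obtain a n where a: "P = (\<lambda>x. \<Sum>i\<le>n. a i * x ^ i)"
      using P(1) by (auto simp: real_polynomial_function_iff_sum)
    have P0: "laplace_integrable (\<lambda>t. P (exp (- t)) * f t) 1" "laplace (\<lambda>t. P (exp (- t)) * f t) 1 = 0"
      using laplace_eq_0_imp_polynomial[of f a n] int zero unfolding a by auto
    have "laplace (\<lambda>t. \<phi> (exp (- t)) * f t) 1 = laplace (\<lambda>t. \<phi> (exp (- t)) * f t - P (exp (- t)) * f t) 1"
      using laplace_diff[OF \<phi>_int P0(1)] P0(2) by simp
    also have "\<bar>\<dots>\<bar> \<le> laplace (\<lambda>t. e) 1"
      unfolding laplace_def
    proof (rule integral_abs_bound[THEN order_trans], rule integral_mono)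
      show "integrable lborel (\<lambda>t. \<bar>indicator {0<..} t * (exp (- 1 * t) * (\<phi> (exp (- t)) * f t - P (exp (- t)) * f t))\<bar>)"
        using laplace_integrable_diff[OF \<phi>_int P0(1)] unfolding laplace_integrable_def by (rule integrable_abs)
      show "integrable lborel (\<lambda>t. indicator {0<..} t * (exp (- 1 * t) * e))"
        using laplace_integrable_const[of 1 e] by (simp add: laplace_integrable_def)
      fix t :: real
      show "\<bar>indicator {0<..} t * (exp (- 1 * t) * (\<phi> (exp (- t)) * f t - P (exp (- t)) * f t))\<bar> \<le> indicator {0<..} t * (exp (- 1 * t) * e)"
      proof (cases "0 < t")
        case True
        have "\<bar>\<phi> (exp (- t)) - P (exp (- t))\<bar> * \<bar>f t\<bar> \<le> e / (C + 1) * C"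
          using P(2)[of "exp (- t)"] True bound C e by (intro mult_mono) auto
        also have "\<dots> \<le> e" using C e by (simp add: divide_simps)
        finally have "\<bar>\<phi> (exp (- t)) * f t - P (exp (- t)) * f t\<bar> \<le> e"
          by (simp flip: abs_mult left_diff_distrib)
        then show ?thesis using True by (simp add: abs_mult)
      qed simp
    qed
    finally show ?thesis by (simp add: laplace_const)
  qed
  then have "\<bar>laplace (\<lambda>t. \<phi> (exp (- t)) * f t) 1\<bar> \<le> 0"
    by (metis add_0 field_le_epsilon)
  then have I0: "laplace (\<lambda>t. \<phi> (exp (- t)) * f t) 1 = 0" by simp
  \<comment> \<open>The product with \<open>f\<close> is f^2 times a positive weight, so a vanishing
    integral forces f = 0 almost everywhere.\<close>
  have \<phi>f: "\<phi> (exp (- s)) * f s = exp (- s) * (1 - exp (- s)) * (f s)\<^sup>2" if "0 < s" for s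
    using that by (simp add: \<phi>_def power2_eq_square)
  have nn: "0 \<le> indicator {0<..} s * (exp (- 1 * s) * (\<phi> (exp (- s)) * f s))" for s
    by (cases "0 < s") (auto simp: \<phi>f)
  \<comment> \<open>By continuity the set where f differs from 0 is open, and a nonempty open set is
    not null.\<close>
  define S where "S = {s \<in> {0<..}. f s \<noteq> 0}"
  have "AE s in lborel. indicator {0<..} s * (exp (- 1 * s) * (\<phi> (exp (- s)) * f s)) = 0"
    by (rule integral_nonneg_eq_0_iff_AE[THEN iffD1, OF _ AE_I2[OF nn]])
      (use \<phi>_int I0 in \<open>simp_all only: laplace_integrable_def laplace_def\<close>)
  then have AE_S: "AE s in lborel. s \<notin> S"
  proof eventually_elim
    case (elim s)
    show ?case
    proof
      assume "s \<in> S"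
      then have "0 < s" "f s \<noteq> 0" by (auto simp: S_def)
      then show False using elim by (simp add: \<phi>f)
    qed
  qed
  have S: "open S"
  proof -
    have "open ({0<..} \<inter> f -` (- {0}))"
      using cont by (rule continuous_open_preimage) auto
    moreover have "S = {0<..} \<inter> f -` (- {0})" by (auto simp: S_def)
    ultimately show ?thesis by simp
  qed
  then have "S \<in> null_sets lborel"
    using AE_S AE_iff_null_sets[of S lborel] by simp
  then have "negligible S"
    by (auto simp: negligible_iff_null_sets intro: null_sets_completionI)
  then have "S = {}" using S open_not_negligible by blast
  then show ?thesis using t by (auto simp: S_def)
qed

text \<open>
  The recursion says that the flux \<open>n (v\<^sub>n - v\<^sub>n\<^sub>-\<^sub>1)\<close> increases by \<open>\<mu> v\<^sub>n\<close>, so \<open>v\<close> moves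
  monotonically away from \<open>0\<close> unless \<open>v\<^sub>0 = 0\<close>.
\<close>

lemma birth_death_resolvent_unique_aux:
  fixes v :: "nat \<Rightarrow> real"
  assumes \<mu>: "0 < \<mu>"
    and v: "\<And>n. \<mu> * v n = (real n + 1) * v (n + 1) - (2 * real n + 1) * v n + real n * v (n - 1)"
    and lim: "v \<longlonglongrightarrow> 0"
  shows "v 0 \<le> 0"
proof (rule ccontr)
  assume "\<not> v 0 \<le> 0"
  have "v 0 \<le> v n \<and> 0 \<le> real n * (v n - v (n - 1))" for n
  proof (induction n)
    case (Suc n)
    have e: "real (Suc n) * (v (Suc n) - v n) = real n * (v n - v (n - 1)) + \<mu> * v n"
      using v[of n] by (simp add: algebra_simps)
    have "0 \<le> real (Suc n) * (v (Suc n) - v n)"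
    proof -
      have "0 \<le> v n" using Suc \<open>\<not> v 0 \<le> 0\<close> by linarith
      then have "0 \<le> \<mu> * v n" using \<mu> by simp
      then show ?thesis unfolding e using Suc by linarith
    qed
    moreover from this have "v n \<le> v (Suc n)" by (simp add: zero_le_mult_iff)
    ultimately show ?case using Suc by simp
  qed simp
  then have "v 0 \<le> 0" by (intro LIMSEQ_le_const[OF lim]) auto
  then show False using \<open>\<not> v 0 \<le> 0\<close> by simp
qed

text \<open>The difference of two solutions and its negative both solve the homogeneous recursion
  and tend to 0, so the difference vanishes at 0. The recursion expresses the value at n + 1 through
  those at n and n - 1, so it vanishes everywhere.\<close>

lemma birth_death_resolvent_unique:
  fixes v w :: "nat \<Rightarrow> real"
  assumes \<mu>: "0 < \<mu>"
    and v: "\<And>n. \<mu> * v n - c n = (real n + 1) * v (n + 1) - (2 * real n + 1) * v n + real n * v (n - 1)"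
    and w: "\<And>n. \<mu> * w n - c n = (real n + 1) * w (n + 1) - (2 * real n + 1) * w n + real n * w (n - 1)"
    and lim: "v \<longlonglongrightarrow> 0" "w \<longlonglongrightarrow> 0"
  shows "v n = w n"
proof -
  define d where "d n = v n - w n" for n
  have d: "\<mu> * d n = (real n + 1) * d (n + 1) - (2 * real n + 1) * d n + real n * d (n - 1)" for n
    using v[of n] w[of n] by (simp add: d_def algebra_simps)
  have dl: "d \<longlonglongrightarrow> 0" using tendsto_diff[OF lim] by (simp add: d_def[abs_def])
  have "d 0 \<le> 0" by (rule birth_death_resolvent_unique_aux[OF \<mu> d dl])
  moreover have "- d 0 \<le> 0"
  proof (rule birth_death_resolvent_unique_aux[OF \<mu>, of "\<lambda>n. - d n"])
    show "\<mu> * - d n = (real n + 1) * - d (n + 1) - (2 * real n + 1) * - d n + real n * - d (n - 1)" for n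
      using d[of n] by (simp add: algebra_simps)
    show "(\<lambda>n. - d n) \<longlonglongrightarrow> 0" using tendsto_minus[OF dl] by simp
  qed
  ultimately have d0: "d 0 = 0" by simp
  have "d n = 0 \<and> d (n - 1) = 0" for n
  proof (induction n)
    case (Suc n)
    then have "(real n + 1) * d (n + 1) = 0" using d[of n] by simp
    then show ?case using Suc by (simp add: of_nat_Suc add_eq_0_iff)
  qed (simp add: d0)
  then show ?thesis by (simp add: d_def)
qed


section \<open>Poisson weights at exponential times\<close>

definition geometric_weight :: "real \<Rightarrow> nat \<Rightarrow> real \<Rightarrow> real" where
  "geometric_weight b n c = b / (c + b) * (c / (c + b)) ^ n"

text \<open>A Poisson count with mean c y, observed at an exponential time y of rate b, is
  geometric: each further count beats the exponential clock with probability c/(c+b). The integral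
  is the Gamma integral of order n + 1 at rate b + c.\<close>

lemma poisson_weight_laplace:
  assumes b: "0 < b" and c: "0 \<le> c"
  shows "b * laplace (\<lambda>y. exp (- (c * y)) * (c * y) ^ n / fact n) b = geometric_weight b n c"
proof -
  have bc: "0 < b + c" using assms by simp
  have "exp (- b * t) * (exp (- (c * t)) * (c * t) ^ n / fact n) = c ^ n * (exp (- (b + c) * t) * rl_kernel (real n + 1) t)"
    if "0 < t" for t
  proof -
    have "exp (- b * t) * exp (- (c * t)) = exp (- (b + c) * t)" by (simp add: algebra_simps flip: exp_add)
    moreover have "rl_kernel (real n + 1) t = t ^ n / fact n"
      using that Gamma_fact[of n, where ?'a=real] by (simp add: rl_kernel_def powr_realpow add.commute)
    ultimately show ?thesis by (simp add: power_mult_distrib mult_ac)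
  qed
  then have e: "indicator {0<..} t * (exp (- b * t) * (exp (- (c * t)) * (c * t) ^ n / fact n))
      = c ^ n * (indicator {0<..} t * (exp (- (b + c) * t) * rl_kernel (real n + 1) t))" for t
    by (cases "0 < t") auto
  have "laplace (\<lambda>y. exp (- (c * y)) * (c * y) ^ n / fact n) b = c ^ n * laplace (rl_kernel (real n + 1)) (b + c)"
    unfolding laplace_def[of _ b] e by (simp add: laplace_def)
  also have "\<dots> = c ^ n * (b + c) powr - (real n + 1)"
    using laplace_rl_kernel[OF _ bc] by simp
  also have "(b + c) powr - (real n + 1) = 1 / (b + c) ^ (n + 1)"
    using bc powr_realpow[OF bc, of "n + 1"] by (simp only: powr_minus divide_inverse of_nat_add of_nat_1 mult_1)
  finally show ?thesis
    by (simp add: geometric_weight_def power_divide add.commute)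
qed

lemma geometric_weight_bounds:
  assumes "0 < b" "0 \<le> c"
  shows "0 \<le> geometric_weight b n c" "geometric_weight b n c \<le> 1"
proof -
  have "b / (c + b) \<le> 1" "(c / (c + b)) ^ n \<le> 1" "0 \<le> (c / (c + b)) ^ n" "0 \<le> b / (c + b)"
    using assms by (auto intro!: power_le_one)
  then show "0 \<le> geometric_weight b n c" "geometric_weight b n c \<le> 1"
    unfolding geometric_weight_def by (metis mult_nonneg_nonneg, metis mult_le_one)
qed

lemma geometric_weight_tendsto_0:
  assumes "0 < b" "0 \<le> c"
  shows "(\<lambda>n. geometric_weight b n c) \<longlonglongrightarrow> 0"
proof -
  have "(\<lambda>n. b / (c + b) * (c / (c + b)) ^ n) \<longlonglongrightarrow> b / (c + b) * 0"
    using assms by (intro tendsto_mult tendsto_const LIMSEQ_realpow_zero) auto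
  then show ?thesis by (simp add: geometric_weight_def)
qed

text \<open>In the variable u = c/(c+b) the weight is (1-u) u^n, and du/dc = (1-u)^2/b. Expanding
  (1-u)^2 (-u^n + n u^(n-1) (1-u)) gives the three-term combination, so the operator on the right of
  the field equation, without its rate, acts on these weights as b d/dc.\<close>

lemma has_real_derivative_geometric_weight:
  assumes "0 < b" "0 \<le> c"
  shows "(geometric_weight b n has_real_derivative
    ((real n + 1) * geometric_weight b (n + 1) c - (2 * real n + 1) * geometric_weight b n c
      + real n * geometric_weight b (n - 1) c) / b) (at c)"
proof -
  have bc: "c + b \<noteq> 0" using assms by simp
  define u where "u = c / (c + b)"
  have u: "b / (c + b) = 1 - u" using bc by (simp add: u_def field_simps)
  have D1: "((\<lambda>c. b / (c + b)) has_real_derivative (- ((1 - u) ^ 2 / b))) (at c)"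
    unfolding u[symmetric] using bc assms
    by (auto intro!: derivative_eq_intros simp: power2_eq_square)
  have D2: "((\<lambda>c. c / (c + b)) has_real_derivative (1 - u) ^ 2 / b) (at c)"
    unfolding u[symmetric] using bc assms
    by (auto intro!: derivative_eq_intros simp: power2_eq_square)
  have "((\<lambda>c. b / (c + b) * (c / (c + b)) ^ n) has_real_derivative
      (- ((1 - u) ^ 2 / b)) * u ^ n + (real n * u ^ (n - 1) * ((1 - u) ^ 2 / b)) * (1 - u)) (at c)"
    using DERIV_mult[OF D1 DERIV_power[OF D2, of n]] by (simp add: u u_def[symmetric] mult_ac)
  also have "(- ((1 - u) ^ 2 / b)) * u ^ n + (real n * u ^ (n - 1) * ((1 - u) ^ 2 / b)) * (1 - u) =
     ((real n + 1) * ((1 - u) * u ^ (n + 1)) - (2 * real n + 1) * ((1 - u) * u ^ n)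
      + real n * ((1 - u) * u ^ (n - 1))) / b"
  \<comment> \<open>The exponent n - 1 is truncated at n = 0, where the term carries the factor n =
    0.\<close>
  proof (cases n)
    case (Suc m)
    have "- ((1 - u) ^ 2) * u ^ n + (real n * u ^ (n - 1) * ((1 - u) ^ 2)) * (1 - u) =
     ((real n + 1) * ((1 - u) * u ^ (n + 1)) - (2 * real n + 1) * ((1 - u) * u ^ n)
      + real n * ((1 - u) * u ^ (n - 1)))"
      unfolding Suc by (simp add: power2_eq_square algebra_simps)
    moreover have "(- ((1 - u) ^ 2 / b)) * u ^ n + (real n * u ^ (n - 1) * ((1 - u) ^ 2 / b)) * (1 - u) =
      (- ((1 - u) ^ 2) * u ^ n + (real n * u ^ (n - 1) * ((1 - u) ^ 2)) * (1 - u)) / b"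
      by (simp add: add_divide_distrib diff_divide_distrib)
    ultimately show ?thesis by simp
  qed (simp add: power2_eq_square algebra_simps add_divide_distrib diff_divide_distrib)
  finally show ?thesis
    unfolding geometric_weight_def[abs_def] u u_def[symmetric] .
qed

text \<open>The x-derivative of the weight with c = r x is \<open>r / b\<^sub>2\<close> times the
  three-term combination. Integrating it by parts against the exponential density of rate
  \<open>b\<^sub>1\<close> leaves the boundary value at x = 0, which is the unit mass at n =
  0.\<close>

lemma poisson_mixture_recursion:
  fixes x :: "nat \<Rightarrow> real"
  assumes r: "0 < r" and b\<^sub>1: "0 < b\<^sub>1" and b\<^sub>2: "0 < b\<^sub>2"
  defines "x \<equiv> \<lambda>n. b\<^sub>1 * laplace (\<lambda>x. geometric_weight b\<^sub>2 n (r * x)) b\<^sub>1"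
  shows "b\<^sub>1 * b\<^sub>2 / r * x n - b\<^sub>1 * b\<^sub>2 / r * of_bool (n = 0) =
    (real n + 1) * x (n + 1) - (2 * real n + 1) * x n + real n * x (n - 1)"
    and "x \<longlonglongrightarrow> 0"
proof -
  define g where "g n x = geometric_weight b\<^sub>2 n (r * x)" for n x
  have g01: "0 \<le> g n x" "g n x \<le> 1" if "0 \<le> x" for n x
    unfolding g_def using geometric_weight_bounds[OF b\<^sub>2, of "r * x"] r that by auto
  have gm: "(\<lambda>t. indicator {0<..} t * g n t) \<in> borel_measurable borel" for n
    unfolding g_def geometric_weight_def by measurable
  have gint: "laplace_integrable (g n) b\<^sub>1" for n
    by (rule laplace_integrable_bounded[OF gm _ b\<^sub>1, of _ 1]) (use g01 in auto)
  define h where "h x = r / b\<^sub>2 * ((real n + 1) * g (n + 1) x - (2 * real n + 1) * g n x + real n * g (n - 1) x)" for x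
  have D: "(g n has_real_derivative h x) (at x)" if "0 \<le> x" for x
  proof -
    have rx: "0 \<le> r * x" using r that by simp
    have "((\<lambda>x. geometric_weight b\<^sub>2 n (r * x)) has_real_derivative
      ((real n + 1) * geometric_weight b\<^sub>2 (n + 1) (r * x) - (2 * real n + 1) * geometric_weight b\<^sub>2 n (r * x)
      + real n * geometric_weight b\<^sub>2 (n - 1) (r * x)) / b\<^sub>2 * r) (at x)"
      by (rule DERIV_chain2[where g="\<lambda>x. r * x" and x=x, OF has_real_derivative_geometric_weight[OF b\<^sub>2 rx]])
        (auto intro!: derivative_eq_intros)
    then show ?thesis unfolding g_def[abs_def] h_def by (simp add: mult.commute)
  qed
  \<comment> \<open>The constant is (n+1) + (2n+1) + n = 4n + 2, as each weight lies in
    [0, 1].\<close>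
  have h_bound: "\<bar>h x\<bar> \<le> r / b\<^sub>2 * (4 * real n + 2)" if "0 < x" for x
  proof -
    have "\<bar>(real n + 1) * g (n + 1) x - (2 * real n + 1) * g n x + real n * g (n - 1) x\<bar>
        \<le> \<bar>(real n + 1) * g (n + 1) x\<bar> + \<bar>(2 * real n + 1) * g n x\<bar> + \<bar>real n * g (n - 1) x\<bar>"
      by linarith
    also have "\<dots> \<le> (real n + 1) * 1 + (2 * real n + 1) * 1 + real n * 1"
      using g01[of x] that unfolding abs_mult by (intro add_mono mult_mono) auto
    finally show ?thesis unfolding h_def abs_mult using r b\<^sub>2 by (intro mult_mono) auto
  qed
  \<comment> \<open>The case \<nu> = 1 of \<open>caputo_inversion\<close> is the fundamental theorem
    of calculus; in this form \<open>laplace_rl_integral\<close> carries out the integration by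
    parts.\<close>
  have "g n t = g n 0 + rl_integral 1 h t" if t: "0 < t" for t
  proof -
    have dg: "deriv (g n) s = h s" if "0 < s" for s using D[of s] that by (simp add: DERIV_imp_deriv)
    have c1: "caputo 1 (g n) s = h s" if "0 < s" for s using dg[OF that] by (simp add: caputo_def)
    have "continuous_on {0..t} (g n)"
      by (rule DERIV_continuous_on[where D=h]) (use D in \<open>auto intro: has_field_derivative_at_within\<close>)
    moreover have "g n differentiable (at s)" if "s \<in> {0<..t}" for s
      using D[of s] that real_differentiable_def by auto
    ultimately have "caputo_differentiable 1 (g n) t"
      by (simp add: caputo_differentiable_def)
    from caputo_inversion[OF _ _ t this] have "g n t = g n 0 + rl_integral 1 (caputo 1 (g n)) t"
      using c1 h_bound by auto
    also have "rl_integral 1 (caputo 1 (g n)) t = rl_integral 1 h t"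
      by (rule rl_integral_cong) (simp add: c1)
    finally show ?thesis .
  qed
  then have "laplace (g n) b\<^sub>1 = laplace (\<lambda>t. g n 0 + rl_integral 1 h t) b\<^sub>1"
    by (intro laplace_cong)
  moreover have hint: "laplace_integrable h b\<^sub>1"
    unfolding h_def[abs_def]
    by (intro laplace_integrable_cmult laplace_integrable_add laplace_integrable_diff gint)
  ultimately have L: "laplace (g n) b\<^sub>1 = g n 0 / b\<^sub>1 + laplace h b\<^sub>1 / b\<^sub>1"
    using b\<^sub>1 laplace_add[OF laplace_integrable_const laplace_integrable_rl_integral]
    by (simp add: laplace_const laplace_rl_integral powr_minus divide_inverse mult.commute)
  define S where "S = (real n + 1) * laplace (g (n + 1)) b\<^sub>1
      - (2 * real n + 1) * laplace (g n) b\<^sub>1 + real n * laplace (g (n - 1)) b\<^sub>1"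
  have Lh: "laplace h b\<^sub>1 = r / b\<^sub>2 * S"
  proof -
    have "laplace h b\<^sub>1 = r / b\<^sub>2 * laplace (\<lambda>x. (real n + 1) * g (n + 1) x - (2 * real n + 1) * g n x + real n * g (n - 1) x) b\<^sub>1"
      unfolding h_def[abs_def] by (rule laplace_cmult)
    then show ?thesis
      by (simp only: S_def laplace_cmult laplace_add laplace_diff gint laplace_integrable_cmult laplace_integrable_diff)
  qed
  have x: "x n = b\<^sub>1 * laplace (g n) b\<^sub>1" for n
    by (simp add: x_def g_def[abs_def])
  have "g n 0 = of_bool (n = 0)"
    using b\<^sub>2 by (auto simp: g_def geometric_weight_def)
  then have "x n - of_bool (n = 0) = r / b\<^sub>2 * S"
    using b\<^sub>1 unfolding x L Lh by (simp add: field_simps)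
  then have "b\<^sub>1 * b\<^sub>2 / r * (x n - of_bool (n = 0)) = b\<^sub>1 * S"
    using r b\<^sub>2 by simp
  then show "b\<^sub>1 * b\<^sub>2 / r * x n - b\<^sub>1 * b\<^sub>2 / r * of_bool (n = 0) =
    (real n + 1) * x (n + 1) - (2 * real n + 1) * x n + real n * x (n - 1)"
    by (simp only: right_diff_distrib) (simp add: S_def x algebra_simps)
  have "(\<lambda>n. laplace (g n) b\<^sub>1) \<longlonglongrightarrow> laplace (\<lambda>_. 0) b\<^sub>1"
  proof (rule laplace_tendsto[OF b\<^sub>1 gm, where C=1])
    show "(\<lambda>n. g n t) \<longlonglongrightarrow> 0" if "0 < t" for t
      unfolding g_def using r that by (intro geometric_weight_tendsto_0[OF b\<^sub>2]) simp
  qed (use g01 in auto)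
  then have "(\<lambda>n. laplace (g n) b\<^sub>1) \<longlonglongrightarrow> 0" by (simp add: laplace_const[OF b\<^sub>1])
  then show "x \<longlonglongrightarrow> 0" unfolding x by (auto intro!: tendsto_eq_intros)
qed

section \<open>Oscillating test functions\<close>

text \<open>Two amplitudes make the family closed under differentiation, and one family covers
  cosine, sine and, for y = 0, constants. The value at x = 0 is \<open>a\<close>.\<close>

definition trig :: "real \<Rightarrow> real \<Rightarrow> real \<Rightarrow> real \<Rightarrow> real" where
  "trig a b y x = a * cos (y * x) + b * sin (y * x)"

lemma DERIV_trig: "(trig a b y has_real_derivative trig (b * y) (- a * y) y x) (at x)"
  unfolding trig_def[abs_def] by (auto intro!: derivative_eq_intros simp: algebra_simps)

lemma deriv_trig: "deriv (trig a b y) = trig (b * y) (- a * y) y"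
  using DERIV_imp_deriv[OF DERIV_trig] by blast

lemma trig_bound: "\<bar>trig a b y x\<bar> \<le> \<bar>a\<bar> + \<bar>b\<bar>"
proof -
  have "\<bar>trig a b y x\<bar> \<le> \<bar>a\<bar> * \<bar>cos (y * x)\<bar> + \<bar>b\<bar> * \<bar>sin (y * x)\<bar>"
    unfolding trig_def by (metis abs_mult abs_triangle_ineq)
  also have "\<dots> \<le> \<bar>a\<bar> * 1 + \<bar>b\<bar> * 1"
    by (intro add_mono mult_left_mono) auto
  finally show ?thesis by simp
qed

lemma measurable_trig [measurable]: "trig a b y \<in> borel_measurable borel"
  unfolding trig_def[abs_def] by measurable

lemma iterated_deriv_trig: "\<exists>a' b'. (deriv ^^ k) (trig a b y) = trig a' b' y"
proof (induction k)
  case (Suc k)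
  then obtain a' b' where "(deriv ^^ k) (trig a b y) = trig a' b' y" by blast
  then have "(deriv ^^ Suc k) (trig a b y) = trig (b' * y) (- a' * y) y" by (simp add: deriv_trig)
  then show ?case by blast
qed auto

lemma bounded_smooth_trig: "bounded_smooth (trig a b y)"
  unfolding bounded_smooth_def
proof (intro allI conjI)
  fix k
  obtain a' b' where e: "(deriv ^^ k) (trig a b y) = trig a' b' y"
    using iterated_deriv_trig by blast
  show "(deriv ^^ k) (trig a b y) differentiable (at x)" for x
    unfolding e using DERIV_trig real_differentiable_def by blast
  show "bounded (range ((deriv ^^ k) (trig a b y)))"
    unfolding e bounded_iff using trig_bound[of a' b' y] by (auto intro!: exI[of _ "\<bar>a'\<bar> + \<bar>b'\<bar>"])
qed

text \<open>Eigenfunction relation: tested against this family, the spatial operator of the Cauchy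
  problem is multiplication by a number.\<close>

lemma second_deriv_trig: "(deriv ^^ 2) (trig a b y) x = - (y\<^sup>2) * trig a b y x"
  by (simp add: numeral_2_eq_2 deriv_trig) (simp add: trig_def algebra_simps)

lemma rl_integral_cmult: "rl_integral \<nu> (\<lambda>s. c * f s) t = c * rl_integral \<nu> f t"
proof -
  have "(LINT s|lborel. rl_kernel \<nu> (t - s) * (indicator {0<..} s * (c * f s)))
    = (LINT s|lborel. c * (rl_kernel \<nu> (t - s) * (indicator {0<..} s * f s)))"
    by (simp add: mult_ac)
  then show ?thesis by (simp add: rl_integral_def)
qed

text \<open>The Volterra equation becomes the linear equation L = a/z - y^2 z^(-\<nu>) L for the
  transform L, which exists because G is bounded.\<close>

lemma laplace_relaxation:
  assumes \<nu>: "0 < \<nu>" and z: "0 < z"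
    and cont: "continuous_on {0<..} G" and bound: "\<And>t. 0 < t \<Longrightarrow> \<bar>G t\<bar> \<le> C"
    and eq: "\<And>t. 0 < t \<Longrightarrow> G t = a - y\<^sup>2 * rl_integral \<nu> G t"
  shows "z * laplace G z = a * (z powr \<nu> / (z powr \<nu> + y\<^sup>2))"
proof -
  have int: "laplace_integrable G z"
    by (rule laplace_integrable_bounded[OF borel_measurable_continuous_on_greaterThan[OF cont] bound z])
  have "laplace G z = laplace (\<lambda>t. a - y\<^sup>2 * rl_integral \<nu> G t) z"
    using eq by (intro laplace_cong)
  also have "\<dots> = a / z - y\<^sup>2 * (z powr - \<nu> * laplace G z)"
    using laplace_diff[OF laplace_integrable_const[OF z] laplace_integrable_cmult[OF laplace_integrable_rl_integral[OF \<nu> z int]]]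
    by (simp add: laplace_const[OF z] laplace_cmult laplace_rl_integral[OF \<nu> z int])
  finally have "laplace G z = a / z - y\<^sup>2 * (z powr - \<nu> * laplace G z)" .
  moreover have "0 < z powr \<nu>" "0 < z powr \<nu> + y\<^sup>2" using z by (auto simp: add_pos_nonneg)
  ultimately show ?thesis using z
    by (simp add: powr_minus field_simps)
qed

text \<open>\<open>caputo_inversion\<close> asks for a bound on the Caputo derivative. Here that
  derivative is -y^2 G, and G is bounded on [0, t] by compactness, so the equation supplies the
  bound itself.\<close>

lemma caputo_oscillation:
  assumes \<nu>: "0 < \<nu>" "\<nu> \<le> 2" and t: "0 < t"
    and diff: "caputo_differentiable \<nu> G t"
    and eq: "\<And>s. 0 < s \<Longrightarrow> caputo \<nu> G s = - (y\<^sup>2) * G s"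
    and init: "1 < \<nu> \<Longrightarrow> (G has_real_derivative 0) (at 0 within {0..})"
  shows "G t = G 0 - y\<^sup>2 * rl_integral \<nu> G t"
proof -
  have "continuous_on {0..t} G"
    using diff by (simp add: caputo_differentiable_def Let_def)
  then have "bounded (G ` {0..t})" by (intro compact_imp_bounded compact_continuous_image) auto
  then obtain C where "\<forall>x\<in>G ` {0..t}. norm x \<le> C" unfolding bounded_iff by blast
  then have C: "\<bar>G s\<bar> \<le> C" if "s \<in> {0..t}" for s using that by simp
  have "\<bar>caputo \<nu> G s\<bar> \<le> y\<^sup>2 * C" if "0 < s" "s < t" for s
    using eq[OF that(1)] C[of s] that by (simp add: abs_mult mult_left_mono)
  then have "G t = G 0 + rl_integral \<nu> (caputo \<nu> G) t"
    using init by (intro caputo_inversion[OF \<nu> t diff])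
  also have "rl_integral \<nu> (caputo \<nu> G) t = rl_integral \<nu> (\<lambda>s. - (y\<^sup>2) * G s) t"
    by (intro rl_integral_cong eq)
  finally show ?thesis by (simp only: rl_integral_cmult)
qed

text \<open>The cosine solves the equation of order 2 with G(0) = 1 and G'(0) = 0, so this is the
  case \<nu> = 2 of \<open>laplace_relaxation\<close>. At rate z^\<alpha> it matches the case \<nu>
  = 2\<alpha> at rate z.\<close>

lemma laplace_cos:
  assumes z: "0 < z"
  shows "z * laplace (\<lambda>x. cos (y * x)) z = z\<^sup>2 / (z\<^sup>2 + y\<^sup>2)"
proof -
  define G where "G = trig 1 0 y"
  have diff: "(deriv ^^ k) G differentiable (at x)" for k x
    using bounded_smooth_trig unfolding bounded_smooth_def G_def by blast
  have "G t = G 0 - y\<^sup>2 * rl_integral 2 G t" if t: "0 < t" for t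
  proof (rule caputo_oscillation[OF _ _ t])
    have "continuous_on {0..t} G"
      unfolding G_def trig_def[abs_def] by (intro continuous_intros)
    then show "caputo_differentiable 2 G t"
      using diff by (simp add: caputo_differentiable_def)
    show "caputo 2 G s = - (y\<^sup>2) * G s" for s
      using second_deriv_trig[of 1 0 y s] by (simp add: caputo_def G_def)
    have "(G has_real_derivative trig 0 (- y) y 0) (at 0)"
      unfolding G_def trig_def[abs_def] by (auto intro!: derivative_eq_intros)
    then show "(G has_real_derivative 0) (at 0 within {0..})"
      by (simp add: trig_def has_field_derivative_at_within)
  qed auto
  then have "z * laplace G z = 1 * (z powr 2 / (z powr 2 + y\<^sup>2))"
  proof (intro laplace_relaxation[where C="\<bar>1\<bar> + \<bar>0\<bar>"])
    show "continuous_on {0<..} G"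
      unfolding G_def trig_def[abs_def] by (intro continuous_intros)
    show "\<bar>G t\<bar> \<le> \<bar>1\<bar> + \<bar>0\<bar>" for t unfolding G_def by (rule trig_bound)
    show "G t = 1 - y\<^sup>2 * rl_integral 2 G t" if "\<And>t. 0 < t \<Longrightarrow> G t = G 0 - y\<^sup>2 * rl_integral 2 G t" "0 < t" for t
      using that(1)[OF that(2)] by (simp add: G_def trig_def)
  qed (use z in auto)
  then show ?thesis using z by (simp add: G_def trig_def[abs_def])
qed

lemma char_eq_trig:
  assumes "real_distribution \<mu>"
  shows "char \<mu> y = Complex (LINT x|\<mu>. trig 1 0 y x) (LINT x|\<mu>. trig 0 1 y x)"
proof -
  interpret real_distribution \<mu> by fact
  have "integrable \<mu> (\<lambda>x. iexp (y * x))"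
    by (rule integrable_const_bound[of _ 1]) auto
  from integral_Re[OF this] integral_Im[OF this]
  have "Re (char \<mu> y) = (LINT x|\<mu>. cos (y * x))" "Im (char \<mu> y) = (LINT x|\<mu>. sin (y * x))"
    by (simp_all add: char_def Re_exp Im_exp)
  then show ?thesis by (simp add: trig_def complex_eq_iff)
qed

lemma real_distribution_eqI:
  assumes "real_distribution \<mu>" "real_distribution \<mu>'"
    and "\<And>a b y. (LINT x|\<mu>. trig a b y x) = (LINT x|\<mu>'. trig a b y x)"
  shows "\<mu> = \<mu>'"
proof (rule Levy_uniqueness)
  show "char \<mu> = char \<mu>'"
    using assms by (simp add: fun_eq_iff char_eq_trig)
qed fact+

section \<open>Laplace and exponential distributions\<close>

definition laplace_distribution :: "real \<Rightarrow> real measure" where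
  "laplace_distribution b = density lborel (\<lambda>x. ennreal (b / 2 * exp (- b * \<bar>x\<bar>)))"

text \<open>Each half-line contributes one transform, the negative one after reflection; the point 0
  lies in neither and is discarded as a null set.\<close>

lemma integral_laplace_distribution:
  assumes b: "0 < b" and [measurable]: "f \<in> borel_measurable borel" and bound: "\<And>x. \<bar>f x\<bar> \<le> C"
  shows "integrable (laplace_distribution b) f"
    and "(LINT x|laplace_distribution b. f x) = b / 2 * laplace f b + b / 2 * laplace (\<lambda>x. f (- x)) b"
proof -
  let ?h = "\<lambda>f x. indicator {0<..} x * (exp (- b * x) * f x) :: real"
  have int1: "integrable lborel (?h f)"
    using laplace_integrable_bounded[OF _ bound b] unfolding laplace_integrable_def by simp
  have int2: "integrable lborel (?h (\<lambda>x. f (- x)))"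
    using laplace_integrable_bounded[of "\<lambda>x. f (- x)" C, OF _ bound b] unfolding laplace_integrable_def by simp
  have int3: "integrable lborel (\<lambda>x. ?h (\<lambda>x. f (- x)) (- x))"
    using lborel_integrable_real_affine[OF int2, of "-1" 0] by simp
  have int3': "(LINT x|lborel. ?h (\<lambda>x. f (- x)) (- x)) = laplace (\<lambda>x. f (- x)) b"
    using lborel_integral_real_affine[of "-1" "?h (\<lambda>x. f (- x))" 0] by (simp add: laplace_def)
  have AE: "AE x in lborel. b / 2 * ?h f x + b / 2 * ?h (\<lambda>x. f (- x)) (- x) = b / 2 * exp (- b * \<bar>x\<bar>) * f x"
  proof -
    have "AE x in lborel. x \<noteq> (0::real)" by (rule AE_lborel_singleton)
    then show ?thesis
    proof eventually_elim
      case (elim x)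
      then consider "0 < x" | "x < 0" by linarith
      then show ?case by cases (auto simp: indicator_def)
    qed
  qed
  have int: "integrable lborel (\<lambda>x. b / 2 * ?h f x + b / 2 * ?h (\<lambda>x. f (- x)) (- x))"
    using int1 int3 by auto
  have "integrable lborel (\<lambda>x. b / 2 * exp (- b * \<bar>x\<bar>) * f x)"
    using int AE by (subst integrable_cong_AE[symmetric]) (auto simp del: mult_minus_left mult_minus_right)
  then show "integrable (laplace_distribution b) f"
    unfolding laplace_distribution_def using b by (subst integrable_density) auto
  have "(LINT x|laplace_distribution b. f x) = (LINT x|lborel. b / 2 * exp (- b * \<bar>x\<bar>) * f x)"
    unfolding laplace_distribution_def using b by (subst integral_density) auto
  also have "\<dots> = (LINT x|lborel. b / 2 * ?h f x + b / 2 * ?h (\<lambda>x. f (- x)) (- x))"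
    using AE by (intro integral_cong_AE) auto
  also have "\<dots> = b / 2 * laplace f b + b / 2 * laplace (\<lambda>x. f (- x)) b"
    using int1 int3 int3' by (subst Bochner_Integration.integral_add) (auto simp: laplace_def)
  finally show "(LINT x|laplace_distribution b. f x) = b / 2 * laplace f b + b / 2 * laplace (\<lambda>x. f (- x)) b" .
qed

lemma real_distribution_laplace_distribution:
  assumes b: "0 < b"
  shows "real_distribution (laplace_distribution b)"
proof -
  have int: "integrable (laplace_distribution b) (\<lambda>_. 1::real)"
    using b by (intro integral_laplace_distribution(1)[where C=1]) auto
  have "(LINT x|laplace_distribution b. 1) = b / 2 * laplace (\<lambda>_. 1) b + b / 2 * laplace (\<lambda>_. 1) b"
    using b by (intro integral_laplace_distribution(2)[where C=1]) auto
  also have "\<dots> = 1" using b by (simp only: laplace_const) simp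
  finally have 1: "(LINT x|laplace_distribution b. 1::real) = 1" .
  have "emeasure (laplace_distribution b) (space (laplace_distribution b)) = (\<integral>\<^sup>+x. ennreal 1 \<partial>laplace_distribution b)"
    by simp
  also have "\<dots> = ennreal (LINT x|laplace_distribution b. 1)"
    by (rule nn_integral_eq_integral[OF int]) simp
  finally have "emeasure (laplace_distribution b) (space (laplace_distribution b)) = 1"
    unfolding 1 by simp
  then have "prob_space (laplace_distribution b)" by (rule prob_spaceI)
  moreover have "sets (laplace_distribution b) = sets borel" by (simp add: laplace_distribution_def)
  ultimately show ?thesis by (simp add: real_distribution_def real_distribution_axioms_def)
qed

definition exponential_distribution :: "real \<Rightarrow> real measure" where
  "exponential_distribution z = density lborel (\<lambda>t. ennreal (z * (indicator {0<..} t * exp (- z * t))))"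

lemma integral_exponential_distribution:
  assumes z: "0 < z" and [measurable]: "(\<lambda>t. indicator {0<..} t * f t) \<in> borel_measurable borel"
    and f: "\<And>t. t \<le> 0 \<Longrightarrow> f t = 0"
  shows "(LINT t|exponential_distribution z. f t) = z * laplace f z"
proof -
  have "(\<lambda>t. indicator {0<..} t * f t) = f" using f by (auto simp: indicator_def fun_eq_iff)
  then have [measurable]: "f \<in> borel_measurable borel" using assms(2) by simp
  show ?thesis
    unfolding exponential_distribution_def laplace_def using z
    by (subst integral_density) (auto simp: mult_ac)
qed

lemma prob_space_exponential_distribution:
  assumes z: "0 < z"
  shows "prob_space (exponential_distribution z)"
proof (rule prob_spaceI)
  have "integrable lborel (\<lambda>t. z * (indicator {0<..} t * exp (- z * t)))"
    using laplace_integrable_const[OF z, of 1] by (simp add: laplace_integrable_def)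
  from nn_integral_eq_integral[OF this] z have "emeasure (exponential_distribution z) (space (exponential_distribution z)) =
      ennreal (LINT t|lborel. z * (indicator {0<..} t * exp (- z * t)))"
    unfolding exponential_distribution_def using z
    by (subst emeasure_density) auto
  then show "emeasure (exponential_distribution z) (space (exponential_distribution z)) = 1"
    using laplace_const[OF z, of 1] z by (simp add: laplace_def)
qed

section \<open>Fractional Cauchy problems\<close>

locale fractional_cauchy =
  fixes \<alpha> :: real and U :: "real \<Rightarrow> real measure"
  assumes \<alpha>: "0 < \<alpha>" "\<alpha> \<le> 1" and solution: "fractional_cauchy_solution (2 * \<alpha>) U"
begin

lemma sets_U: "0 \<le> t \<Longrightarrow> sets (U t) = sets borel"
  using solution by (simp add: fractional_cauchy_solution_def)

text \<open>The weak form of the Cauchy problem with a trigonometric test function is the equation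
  of \<open>caputo_oscillation\<close>; the initial value is \<open>a\<close> because the initial
  measure is the unit mass at 0.\<close>

lemma trig_integral_eq:
  fixes a b y :: real
  assumes t: "0 < t"
  defines "G \<equiv> \<lambda>t. LINT x|U t. trig a b y x"
  shows "G t = a - y\<^sup>2 * rl_integral (2 * \<alpha>) G t"
proof -
  have sol: "caputo_differentiable (2 * \<alpha>) G t"
    "caputo (2 * \<alpha>) G t = (LINT x|U t. (deriv ^^ 2) (trig a b y) x)" if "0 < t" for t
    using solution bounded_smooth_trig[of a b y] that
    unfolding fractional_cauchy_solution_def G_def by blast+
  have "G t = G 0 - y\<^sup>2 * rl_integral (2 * \<alpha>) G t"
  proof (rule caputo_oscillation[OF _ _ t sol(1)[OF t]])
    show "caputo (2 * \<alpha>) G s = - (y\<^sup>2) * G s" if "0 < s" for s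
      unfolding sol(2)[OF that] unfolding second_deriv_trig G_def by simp
    show "(G has_real_derivative 0) (at 0 within {0..})" if "1 < 2 * \<alpha>"
      using solution bounded_smooth_trig[of a b y] that
      unfolding fractional_cauchy_solution_def G_def by blast
  qed (use \<alpha> in auto)
  moreover have "U 0 = return borel 0"
    using solution by (simp add: fractional_cauchy_solution_def)
  then have "G 0 = a"
    by (simp add: G_def integral_return trig_def)
  ultimately show ?thesis by simp
qed

text \<open>The frequency y = 0 tests against the constant 1, for which the integral equation says
  that the mass keeps its initial value.\<close>

lemma prob_space_U:
  assumes t: "0 < t"
  shows "prob_space (U t)"
proof -
  interpret finite_measure "U t"
    using solution t by (simp add: fractional_cauchy_solution_def)
  have "measure (U t) (space (U t)) = 1"
    using trig_integral_eq[OF t, of 1 0 0] by (simp add: trig_def)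
  then show ?thesis by (intro prob_spaceI) (simp add: emeasure_eq_measure)
qed

lemma real_distribution_U: "0 < t \<Longrightarrow> real_distribution (U t)"
  using prob_space_U sets_U[of t] by (simp add: real_distribution_def real_distribution_axioms_def)

lemma continuous_on_trig_integral: "continuous_on {0<..} (\<lambda>t. LINT x|U t. trig a b y x)"
proof (rule continuous_at_imp_continuous_on, rule ballI)
  fix t :: real assume t: "t \<in> {0<..}"
  have "caputo_differentiable (2 * \<alpha>) (\<lambda>t. LINT x|U t. trig a b y x) (t + 1)"
    using solution bounded_smooth_trig[of a b y] t
    unfolding fractional_cauchy_solution_def by auto
  then have "continuous_on {0..t + 1} (\<lambda>t. LINT x|U t. trig a b y x)"
    by (simp add: caputo_differentiable_def Let_def)
  then have "continuous_on {0<..<t + 1} (\<lambda>t. LINT x|U t. trig a b y x)"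
    by (rule continuous_on_subset) auto
  then show "isCont (\<lambda>t. LINT x|U t. trig a b y x) t"
    using t by (simp add: continuous_on_eq_continuous_at)
qed

lemma trig_integral_bound: 
  assumes "0 < t"
  shows "\<bar>LINT x|U t. trig a b y x\<bar> \<le> \<bar>a\<bar> + \<bar>b\<bar>"
proof -
  interpret real_distribution "U t" by (rule real_distribution_U[OF assms])
  have "integrable (U t) (trig a b y)"
    by (rule integrable_const_bound[of _ "\<bar>a\<bar> + \<bar>b\<bar>"]) (auto simp: trig_bound)
  then have "(LINT x|U t. \<bar>trig a b y x\<bar>) \<le> (LINT x|U t. \<bar>a\<bar> + \<bar>b\<bar>)"
    by (intro integral_mono) (auto simp: trig_bound)
  moreover have "\<bar>LINT x|U t. trig a b y x\<bar> \<le> (LINT x|U t. \<bar>trig a b y x\<bar>)"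
    by (rule integral_abs_bound)
  moreover have "(LINT x|U t. \<bar>a\<bar> + \<bar>b\<bar>) = \<bar>a\<bar> + \<bar>b\<bar>" using prob_space by simp
  ultimately show ?thesis by linarith
qed

lemma laplace_trig_integral:
  assumes z: "0 < z"
  shows "z * laplace (\<lambda>t. LINT x|U t. trig a b y x) z = a * ((z powr \<alpha>)\<^sup>2 / ((z powr \<alpha>)\<^sup>2 + y\<^sup>2))"
proof -
  have "(z powr \<alpha>)\<^sup>2 = z powr (2 * \<alpha>)" using z by (simp add: powr_power mult.commute)
  then show ?thesis
    using laplace_relaxation[OF _ z continuous_on_trig_integral trig_integral_bound trig_integral_eq] \<alpha>
    by simp
qed

text \<open>Continuity of the trigonometric integrals in t is pointwise convergence of
  characteristic functions; Levy's theorem upgrades it to weak convergence, hence to all bounded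
  continuous test functions.\<close>

lemma weak_conv_U:
  assumes s: "\<And>n. 0 < s n" and t: "0 < t" and lim: "s \<longlonglongrightarrow> t"
  shows "weak_conv_m (\<lambda>n. U (s n)) (U t)"
proof (rule levy_continuity)
  fix y
  have "(\<lambda>n. LINT x|U (s n). trig a b y x) \<longlonglongrightarrow> (LINT x|U t. trig a b y x)" for a b
    using continuous_on_tendsto_compose[OF continuous_on_trig_integral lim] s t by simp
  then show "(\<lambda>n. char (U (s n)) y) \<longlonglongrightarrow> char (U t) y"
    unfolding char_eq_trig[OF real_distribution_U[OF s]] char_eq_trig[OF real_distribution_U[OF t]]
    by (intro tendsto_Complex)
qed (use s t real_distribution_U in auto)

lemma continuous_on_integral_U:
  assumes g: "\<And>x. isCont g x" and bound: "\<And>x. \<bar>g x\<bar> \<le> C"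
  shows "continuous_on {0<..} (\<lambda>t. LINT x|U t. g x :: real)"
  unfolding continuous_on_sequentially comp_def
proof (intro allI impI ballI)
  fix s :: "nat \<Rightarrow> real" and t assume *: "t \<in> {0<..}" "(\<forall>n. s n \<in> {0<..}) \<and> s \<longlonglongrightarrow> t"
  show "(\<lambda>n. LINT x|U (s n). g x) \<longlonglongrightarrow> (LINT x|U t. g x)"
    by (rule weak_conv_imp_integral_bdd_continuous_conv[where B=C])
      (use * g bound in \<open>auto intro!: real_distribution_U weak_conv_U\<close>)
qed

text \<open>The value for t \<le> 0 is a placeholder that makes the family a Markov kernel on all
  reals; the exponential law of t gives these times no mass.\<close>

definition kernel :: "real \<Rightarrow> real measure" where
  "kernel t = (if 0 < t then U t else return borel 0)"

text \<open>It is enough to test on the generating half-lines x < c. There the measure is a limit of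
  integrals of continuous functions, each continuous in t by weak convergence.\<close>

lemma measurable_kernel: "kernel \<in> borel \<rightarrow>\<^sub>M prob_algebra borel"
proof (rule measurable_prob_algebra_generated[where \<Omega>=UNIV and G="range lessThan"])
  show "sets borel = sigma_sets UNIV (range (lessThan :: real \<Rightarrow> real set))"
    by (subst borel_Iio) simp
  show "Int_stable (range (lessThan :: real \<Rightarrow> real set))"
  proof -
    have "{..<a} \<inter> {..<b} = {..<min a b}" for a b :: real by auto
    then show ?thesis by (auto simp: Int_stable_def)
  qed
  show "prob_space (kernel t)" for t
    by (auto simp: kernel_def prob_space_U intro!: prob_space_return)
  show "sets (kernel t) = sets borel" for t
    by (auto simp: kernel_def sets_U)
  show "(\<lambda>t. emeasure (kernel t) A) \<in> borel_measurable borel" if "A \<in> range lessThan" for A :: "real set"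
  proof -
    obtain c where A: "A = {..<c}" using \<open>A \<in> range lessThan\<close> by auto
    \<comment> \<open>For k > 0 these are ramps equal to 1 up to c - 1/k and to 0 from c on; they
      converge pointwise to the indicator of x < c.\<close>
    define g where "g k x = max 0 (min 1 (real k * (c - x)))" for k :: nat and x
    have g: "isCont (g k) x" "\<bar>g k x\<bar> \<le> 1" for k x
      unfolding g_def by (auto intro!: continuous_intros)
    have gm: "g k \<in> borel_measurable borel" for k
      unfolding g_def by measurable
    have g_lim: "(\<lambda>k. g k x) \<longlonglongrightarrow> indicator A x" for x
    proof (cases "x < c")
      case True
      then have "filterlim (\<lambda>k. real k * (c - x)) at_top sequentially"
        by (intro filterlim_at_top_mult_tendsto_pos[OF tendsto_const _ filterlim_real_sequentially]) auto
      then have "\<forall>\<^sub>F k in sequentially. 1 \<le> real k * (c - x)"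
        by (simp add: filterlim_at_top)
      then have "\<forall>\<^sub>F k in sequentially. indicator A x = g k x"
        by eventually_elim (use True in \<open>auto simp: g_def A\<close>)
      then show ?thesis by (rule Lim_transform_eventually[OF tendsto_const])
    next
      case False
      then have "real k * (c - x) \<le> 0" for k by (intro mult_nonneg_nonpos) auto
      then have "g k x = 0" for k unfolding g_def by (smt (verit))
      then show ?thesis using False by (simp add: A)
    qed
    have "(\<lambda>k. indicator {0<..} t * (LINT x|U t. g k x)) \<longlonglongrightarrow> indicator {0<..} t * measure (U t) A" for t
    proof (cases "0 < t")
      case True
      interpret real_distribution "U t" by (rule real_distribution_U[OF True])
      have "(\<lambda>k. LINT x|U t. g k x) \<longlonglongrightarrow> (LINT x|U t. indicator A x)"
        by (rule integral_dominated_convergence[where w="\<lambda>_. 1"])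
          (use g g_lim gm in \<open>auto simp: A\<close>)
      then show ?thesis using True A by (auto intro!: tendsto_eq_intros)
    qed simp
    then have [measurable]: "(\<lambda>t. indicator {0<..} t * measure (U t) A) \<in> borel_measurable borel"
      by (rule borel_measurable_LIMSEQ_real)
        (intro borel_measurable_continuous_on_greaterThan continuous_on_integral_U[where C=1] g)
    have "emeasure (kernel t) A =
        ennreal (indicator {0<..} t * measure (U t) A) + indicator {..0} t * indicator A (0::real)" for t
    proof (cases "0 < t")
      case True
      interpret prob_space "U t" by (rule prob_space_U[OF True])
      show ?thesis using True by (simp add: kernel_def emeasure_eq_measure)
    next
      case False
      then show ?thesis by (simp add: kernel_def A)
    qed
    then show ?thesis by simp
  qed
qed auto

lemma measurable_integral_kernel:
  assumes "g \<in> borel_measurable borel"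
  shows "(\<lambda>t. LINT x|kernel t. g x :: real) \<in> borel_measurable borel"
  by (rule measurable_compose[OF measurable_prob_algebraD[OF measurable_kernel] integral_measurable_subprob_algebra])
    (use assms in simp)

lemma borel_measurable_integral_U:
  assumes "g \<in> borel_measurable borel"
  shows "(\<lambda>t. indicator {0<..} t * (LINT x|U t. g x :: real)) \<in> borel_measurable borel"
proof -
  note measurable_integral_kernel[OF assms, measurable]
  have "(\<lambda>t. indicator {0<..} t * (LINT x|kernel t. g x :: real)) \<in> borel_measurable borel"
    by measurable
  also have "(\<lambda>t. indicator {0<..} t * (LINT x|kernel t. g x :: real)) = (\<lambda>t. indicator {0<..} t * (LINT x|U t. g x))"
    by (auto simp: kernel_def indicator_def)
  finally show ?thesis .
qed

text \<open>z times a Laplace transform in t is an average over an exponential time. Forming the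
  averaged measure, rather than transforming one integral at a time, lets uniqueness of
  characteristic functions extend the computation from trigonometric to all bounded measurable test
  functions.\<close>

definition averaged :: "real \<Rightarrow> real measure" where
  "averaged z = exponential_distribution z \<bind> kernel"

lemma integral_averaged:
  assumes z: "0 < z" and g: "g \<in> borel_measurable borel" and bound: "\<And>x. \<bar>g x\<bar> \<le> C"
  shows "(LINT x|averaged z. g x) = z * laplace (\<lambda>t. LINT x|U t. g x) z"
proof -
  interpret prob_space "exponential_distribution z" by (rule prob_space_exponential_distribution[OF z])
  have m: "kernel \<in> exponential_distribution z \<rightarrow>\<^sub>M prob_algebra borel"
    using measurable_kernel by (simp add: exponential_distribution_def)
  have "(LINT x|averaged z. g x) = (LINT t|exponential_distribution z. LINT x|kernel t. g x)"
    unfolding averaged_def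
  proof (rule integral_bind[where K=borel and B=C and B'=1])
    show "finite_measure (exponential_distribution z)" by (rule finite_measure_axioms)
    show "AE t in exponential_distribution z. emeasure (kernel t) (space (kernel t)) \<le> ennreal 1"
      by (auto simp: kernel_def prob_space.emeasure_space_1 prob_space_U prob_space_return)
  qed (use g bound measurable_prob_algebraD[OF m] in auto)
  also have "\<dots> = (LINT t|exponential_distribution z. indicator {0<..} t * (LINT x|U t. g x))"
  proof (rule integral_cong_AE)
    show "(\<lambda>t. LINT x|kernel t. g x) \<in> borel_measurable (exponential_distribution z)"
      using measurable_integral_kernel[OF g] by (simp add: exponential_distribution_def)
    show "(\<lambda>t. indicator {0<..} t * (LINT x|U t. g x)) \<in> borel_measurable (exponential_distribution z)"
      using borel_measurable_integral_U[OF g] by (simp add: exponential_distribution_def)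
    show "AE t in exponential_distribution z. (LINT x|kernel t. g x) = indicator {0<..} t * (LINT x|U t. g x)"
      unfolding exponential_distribution_def using z
      by (subst AE_density) (auto simp: kernel_def indicator_def)
  qed
  also have "\<dots> = z * laplace (\<lambda>t. indicator {0<..} t * (LINT x|U t. g x)) z"
    by (rule integral_exponential_distribution[OF z]) (use borel_measurable_integral_U[OF g] in auto)
  also have "laplace (\<lambda>t. indicator {0<..} t * (LINT x|U t. g x)) z = laplace (\<lambda>t. LINT x|U t. g x) z"
    by (rule laplace_cong) simp
  finally show ?thesis .
qed

text \<open>With b = z^\<alpha>, both measures give a trigonometric test function the integral a
  b^2/(b^2 + y^2): the average because the order 2\<alpha> produces z^(2\<alpha>) = b^2, the Laplace
  law by the cosine transform at rate b.\<close>

lemma averaged_eq: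
  assumes z: "0 < z"
  shows "averaged z = laplace_distribution (z powr \<alpha>)"
proof (rule real_distribution_eqI)
  interpret prob_space "exponential_distribution z" by (rule prob_space_exponential_distribution[OF z])
  have m: "kernel \<in> exponential_distribution z \<rightarrow>\<^sub>M prob_algebra borel"
    using measurable_kernel by (simp add: exponential_distribution_def)
  have "prob_space (averaged z)"
    unfolding averaged_def
    by (rule prob_space_bind[OF _ measurable_prob_algebraD[OF m]])
      (auto simp: kernel_def prob_space_U prob_space_return)
  moreover have "sets (averaged z) = sets borel"
    unfolding averaged_def using not_empty
    by (intro sets_bind) (auto simp: kernel_def sets_U)
  ultimately show "real_distribution (averaged z)"
    by (simp add: real_distribution_def real_distribution_axioms_def)
  have b: "0 < z powr \<alpha>" using z by simp
  show "real_distribution (laplace_distribution (z powr \<alpha>))"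
    by (rule real_distribution_laplace_distribution[OF b])
  fix a b' y
  have "(LINT x|laplace_distribution (z powr \<alpha>). trig a b' y x)
      = z powr \<alpha> / 2 * (laplace (trig a b' y) (z powr \<alpha>) + laplace (\<lambda>x. trig a b' y (- x)) (z powr \<alpha>))"
    using integral_laplace_distribution(2)[OF b measurable_trig trig_bound] by (simp add: algebra_simps)
  \<comment> \<open>Adding the two half-lines will cancel the sine part.\<close>
  also have "laplace (trig a b' y) (z powr \<alpha>) + laplace (\<lambda>x. trig a b' y (- x)) (z powr \<alpha>)
      = laplace (\<lambda>x. trig a b' y x + trig a b' y (- x)) (z powr \<alpha>)"
    by (rule laplace_add[symmetric]; rule laplace_integrable_bounded[OF _ trig_bound b]) auto
  also have "\<dots> = laplace (\<lambda>x. 2 * a * cos (y * x)) (z powr \<alpha>)"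
    by (rule laplace_cong) (simp add: trig_def)
  also have "z powr \<alpha> / 2 * \<dots> = a * (z powr \<alpha> * laplace (\<lambda>x. cos (y * x)) (z powr \<alpha>))"
    by (simp only: laplace_cmult) simp
  also have "\<dots> = a * ((z powr \<alpha>)\<^sup>2 / ((z powr \<alpha>)\<^sup>2 + y\<^sup>2))"
    by (simp only: laplace_cos[OF b])
  also have "\<dots> = (LINT x|averaged z. trig a b' y x)"
    using integral_averaged[OF z measurable_trig trig_bound] laplace_trig_integral[OF z] by simp
  finally show "(LINT x|averaged z. trig a b' y x) = (LINT x|laplace_distribution (z powr \<alpha>). trig a b' y x)" ..
qed

text \<open>Under the Laplace law |x| is exponential with rate z^\<alpha>. Up to the factor z, this
  is the transform z^(\<alpha>-1) exp(-z^\<alpha> x) of the folded density, integrated against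
  g.\<close>

lemma laplace_integral_U:
  assumes z: "0 < z" and g: "g \<in> borel_measurable borel" and bound: "\<And>x. \<bar>g x\<bar> \<le> C"
  shows "z * laplace (\<lambda>t. LINT x|U t. g \<bar>x\<bar>) z = z powr \<alpha> * laplace g (z powr \<alpha>)"
proof -
  have b: "0 < z powr \<alpha>" using z by simp
  have g': "(\<lambda>x. g \<bar>x\<bar>) \<in> borel_measurable borel" using g by measurable
  have "z * laplace (\<lambda>t. LINT x|U t. g \<bar>x\<bar>) z = (LINT x|laplace_distribution (z powr \<alpha>). g \<bar>x\<bar>)"
    using integral_averaged[OF z g' bound] by (simp add: averaged_eq[OF z])
  also have "\<dots> = z powr \<alpha> * laplace (\<lambda>x. g \<bar>x\<bar>) (z powr \<alpha>)"
    using integral_laplace_distribution(2)[OF b g' bound] by simp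
  also have "laplace (\<lambda>x. g \<bar>x\<bar>) (z powr \<alpha>) = laplace g (z powr \<alpha>)"
    by (rule laplace_cong) simp
  finally show ?thesis .
qed

text \<open>The sine integrals have initial amplitude 0, so their Laplace transforms vanish, and by
  continuity they vanish for every t > 0. A law without sine part has the same characteristic
  function as its reflection.\<close>

lemma U_symmetric:
  assumes t: "0 < t"
  shows "distr (U t) borel uminus = U t"
proof (rule real_distribution_eqI)
  interpret real_distribution "U t" by (rule real_distribution_U[OF t])
  show "real_distribution (distr (U t) borel uminus)"
    by (rule real_distribution_distr) simp
  show "real_distribution (U t)" ..
  fix a b y
  have sin0: "(LINT x|U t. trig 0 1 y x) = 0"
  proof (rule laplace_eq_0_imp_eq_0[OF continuous_on_trig_integral trig_integral_bound _ t])
    show "laplace (\<lambda>t. LINT x|U t. trig 0 1 y x) z = 0" if "0 < z" for z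
      using laplace_trig_integral[OF that, of 0 1 y] that by simp
  qed
  have int: "integrable (U t) (trig a b y)" for a b
    by (rule integrable_const_bound[of _ "\<bar>a\<bar> + \<bar>b\<bar>"]) (auto simp: trig_bound)
  have e: "trig a b y (- x) = trig a b y x - 2 * b * trig 0 1 y x" for x
    by (simp add: trig_def)
  have "(LINT x|distr (U t) borel uminus. trig a b y x) = (LINT x|U t. trig a b y (- x))"
    by (rule integral_distr) simp_all
  also have "\<dots> = (LINT x|U t. trig a b y x)"
    unfolding e using int sin0 by (subst Bochner_Integration.integral_diff) auto
  finally show "(LINT x|distr (U t) borel uminus. trig a b y x) = (LINT x|U t. trig a b y x)" .
qed

text \<open>For a symmetric measure, doubling on [0, \<infinity>) agrees with folding by |x| except
  that an atom at 0 is counted twice. Since the doubled measure is a probability measure, there is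
  no such atom.\<close>

lemma integral_folded_U:
  fixes g :: "real \<Rightarrow> real"
  assumes t: "0 < t" and mass: "prob_space (density (U t) (\<lambda>x. if 0 \<le> x then 2 else 0))"
    and g [measurable]: "g \<in> borel_measurable borel" and bound: "\<And>x. \<bar>g x\<bar> \<le> C"
  shows "(LINT x|density (U t) (\<lambda>x. if 0 \<le> x then 2 else 0). g x) = (LINT x|U t. g \<bar>x\<bar>)"
proof -
  interpret real_distribution "U t" by (rule real_distribution_U[OF t])
  have dens: "density (U t) (\<lambda>x. if 0 \<le> x then 2 else 0) = density (U t) (\<lambda>x. ennreal (if 0 \<le> x then 2 else 0))"
    by (intro arg_cong[where f="density (U t)"]) (auto simp: fun_eq_iff)
  have fold: "(LINT x|U t. (if 0 \<le> x then 2 else 0) * g x) = (LINT x|U t. g \<bar>x\<bar>) + measure (U t) {0} * g 0"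
    if g [measurable]: "g \<in> borel_measurable borel" and bound: "\<And>x. \<bar>g x\<bar> \<le> C" for g :: "real \<Rightarrow> real" and C
  proof -
    \<comment> \<open>\<open>p\<close> is g on the open positive half-line; by symmetry its
      reflection has the same integral, and the point 0 is accounted for separately.\<close>
    define p where "p x = (if 0 < x then g x else 0)" for x
    have p: "p \<in> borel_measurable borel" unfolding p_def by measurable
    have C: "0 \<le> C" using bound[of 0] by linarith
    have int: "integrable (U t) p"
      by (rule integrable_const_bound[of _ C]) (use p bound C in \<open>auto simp: p_def\<close>)
    have int': "integrable (U t) (\<lambda>x. p (- x))"
      by (rule integrable_const_bound[of _ C]) (use p bound C in \<open>auto simp: p_def\<close>)
    have sym: "(LINT x|U t. p (- x)) = (LINT x|U t. p x)"
      using integral_distr[of uminus "U t" borel p] p by (simp add: U_symmetric[OF t])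
    have i0: "integrable (U t) (\<lambda>x. g 0 * indicator {0} x)"
      by (rule integrable_const_bound[of _ C]) (use bound C in \<open>auto simp: indicator_def\<close>)
    have "(LINT x|U t. g \<bar>x\<bar>) = (LINT x|U t. p x + p (- x) + g 0 * indicator {0} x)"
      by (intro Bochner_Integration.integral_cong) (auto simp: p_def indicator_def)
    also have "\<dots> = 2 * (LINT x|U t. p x) + g 0 * measure (U t) {0}"
      using int int' i0 by (simp add: sym)
    finally have 1: "(LINT x|U t. g \<bar>x\<bar>) = 2 * (LINT x|U t. p x) + g 0 * measure (U t) {0}" .
    have "(LINT x|U t. (if 0 \<le> x then 2 else 0) * g x) = (LINT x|U t. 2 * p x + 2 * (g 0 * indicator {0} x))"
      by (intro Bochner_Integration.integral_cong) (auto simp: p_def indicator_def)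
    also have "\<dots> = 2 * (LINT x|U t. p x) + 2 * (g 0 * measure (U t) {0})"
      using int i0 by simp
    finally show ?thesis using 1 by simp
  qed
  have dens_int: "(LINT x|density (U t) (\<lambda>x. if 0 \<le> x then 2 else 0). g x) = (LINT x|U t. (if 0 \<le> x then 2 else 0) * g x)"
    if "g \<in> borel_measurable borel" for g :: "real \<Rightarrow> real"
    unfolding dens using that by (subst integral_density) auto
  \<comment> \<open>For g = 1 the identity \<open>fold\<close> reads 1 = 1 +
    \<open>measure (U t) {0}\<close>, both total masses being 1.\<close>
  have "measure (U t) {0} = 0"
    using fold[of "\<lambda>_. 1" 1] dens_int[of "\<lambda>_. 1"] prob_space.prob_space[OF mass]
    prob_space by simp
  then show ?thesis using fold[of g C, OF g bound] dens_int[OF g] by simp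
qed

end

section \<open>Folded processes\<close>

locale folded_process = prob_space M for M :: "'a measure" +
  fixes \<alpha> :: real and T :: "real \<Rightarrow> 'a \<Rightarrow> real"
  assumes \<alpha>: "0 < \<alpha>" "\<alpha> \<le> 1" and folded: "folded_solution_process (2 * \<alpha>) M T"
begin

lemma measurable_T: "0 \<le> t \<Longrightarrow> T t \<in> borel_measurable M"
  and T_nonneg: "0 \<le> t \<Longrightarrow> \<omega> \<in> space M \<Longrightarrow> 0 \<le> T t \<omega>"
  using folded by (auto simp: folded_solution_process_def)

lemma T_0: "AE \<omega> in M. T 0 \<omega> = 0"
proof -
  obtain U where U: "fractional_cauchy_solution (2 * \<alpha>) U" "distr M borel (T 0) = U 0"
    using folded by (auto simp: folded_solution_process_def)
  have U0: "U 0 = return borel 0" using U(1) by (simp add: fractional_cauchy_solution_def)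
  have "AE x in distr M borel (T 0). x = 0"
    unfolding U(2) U0 by (subst AE_return) auto
  then show ?thesis
    using measurable_T[of 0] by (subst (asm) AE_distr_iff) auto
qed

text \<open>The solution hides behind an existential quantifier; it is extracted together with what
  is needed of the law of \<open>T t\<close>, namely that expectations are integrals of
  g(|x|).\<close>

lemma obtain_cauchy_solution:
  obtains U where "fractional_cauchy \<alpha> U"
    and "\<And>g t C. 0 < t \<Longrightarrow> g \<in> borel_measurable borel \<Longrightarrow> (\<And>x. \<bar>g x\<bar> \<le> C) \<Longrightarrow>
      (LINT \<omega>|M. g (T t \<omega>)) = (LINT x|U t. g \<bar>x\<bar> :: real)"
proof -
  obtain U where U: "fractional_cauchy_solution (2 * \<alpha>) U"
    and law: "\<And>t. 0 < t \<Longrightarrow> distr M borel (T t) = density (U t) (\<lambda>x. if 0 \<le> x then 2 else 0)"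
    using folded by (auto simp: folded_solution_process_def)
  interpret fractional_cauchy \<alpha> U by unfold_locales (use \<alpha> U in auto)
  have "(LINT \<omega>|M. g (T t \<omega>)) = (LINT x|U t. g \<bar>x\<bar>)"
    if t: "0 < t" and g: "g \<in> borel_measurable borel" "\<And>x. \<bar>g x\<bar> \<le> C" for g :: "real \<Rightarrow> real" and t C
  proof -
    have "(LINT \<omega>|M. g (T t \<omega>)) = (LINT x|distr M borel (T t). g x)"
      using measurable_T[of t] g t by (intro integral_distr[symmetric]) auto
    moreover have "prob_space (distr M borel (T t))"
      using measurable_T[of t] t by (intro prob_space_distr) auto
    ultimately show ?thesis
      using integral_folded_U[OF t _ g] unfolding law[OF t] by simp
  qed
  then show ?thesis using that[of U] fractional_cauchy_axioms by blast
qed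

lemma
  fixes g :: "real \<Rightarrow> real"
  assumes g: "g \<in> borel_measurable borel" and bound: "\<And>x. \<bar>g x\<bar> \<le> C"
  shows laplace_expectation: "0 < z \<Longrightarrow>
      z * laplace (\<lambda>t. LINT \<omega>|M. g (T t \<omega>)) z = z powr \<alpha> * laplace g (z powr \<alpha>)"
    and continuous_on_expectation: "(\<And>x. isCont g x) \<Longrightarrow> continuous_on {0<..} (\<lambda>t. LINT \<omega>|M. g (T t \<omega>))"
proof -
  obtain U where U: "fractional_cauchy \<alpha> U"
    and law: "\<And>t. 0 < t \<Longrightarrow> (LINT \<omega>|M. g (T t \<omega>)) = (LINT x|U t. g \<bar>x\<bar>)"
    using obtain_cauchy_solution g bound by metis
  interpret fractional_cauchy \<alpha> U by fact
  show "z * laplace (\<lambda>t. LINT \<omega>|M. g (T t \<omega>)) z = z powr \<alpha> * laplace g (z powr \<alpha>)" if z: "0 < z"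
    using laplace_integral_U[OF z g bound] laplace_cong[OF law] by simp
  show "continuous_on {0<..} (\<lambda>t. LINT \<omega>|M. g (T t \<omega>))" if "\<And>x. isCont g x"
  proof -
    have "continuous_on {0<..} (\<lambda>t. LINT x|U t. g \<bar>x\<bar>)"
      by (rule continuous_on_integral_U[where C=C])
        (use bound that in \<open>auto intro!: continuous_at_compose[of _ abs g, unfolded comp_def] continuous_intros\<close>)
    then show ?thesis by (rule continuous_on_eq) (simp add: law)
  qed
qed

end

section \<open>Poisson weights mixed over two folded times\<close>

definition poisson_weight :: "nat \<Rightarrow> real \<Rightarrow> real" where
  "poisson_weight n s = exp (- s) * s ^ n / fact n"

lemma pmf_poisson_weight: "0 < s \<Longrightarrow> pmf (poisson_pmf s) n = poisson_weight n s"
  by (simp add: poisson_weight_def)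

text \<open>The formula extends the Poisson mass function from positive parameters to 0, with
  \<open>0 ^ 0 = 1\<close>. The value is needed because the random time may vanish.\<close>

lemma poisson_weight_0: "poisson_weight n 0 = of_bool (n = 0)"
  by (simp add: poisson_weight_def)

lemma poisson_weight_bounds:
  assumes "0 \<le> s"
  shows "0 \<le> poisson_weight n s" "poisson_weight n s \<le> 1" "\<bar>poisson_weight n s\<bar> \<le> 1"
proof -
  show "0 \<le> poisson_weight n s" using assms by (simp add: poisson_weight_def)
  moreover show "poisson_weight n s \<le> 1"
    using pmf_le_1[of "poisson_pmf s" n] pmf_poisson_weight[of s n] assms
    by (cases "s = 0") (simp_all add: poisson_weight_0 del: pmf_poisson)
  ultimately show "\<bar>poisson_weight n s\<bar> \<le> 1" by simp
qed

lemma isCont_poisson_weight [continuous_intros]: "isCont (poisson_weight n) s"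
  unfolding poisson_weight_def[abs_def] by (intro continuous_intros) auto

lemma measurable_poisson_weight [measurable]: "poisson_weight n \<in> borel_measurable borel"
  unfolding poisson_weight_def[abs_def] by measurable

locale two_folded_processes = T1: folded_process M \<alpha>\<^sub>1 T\<^sub>1 + T2: folded_process M \<alpha>\<^sub>2 T\<^sub>2
  for M :: "'a measure" and \<alpha>\<^sub>1 \<alpha>\<^sub>2 T\<^sub>1 T\<^sub>2 +
  fixes r :: real
  assumes r: "0 < r"
begin

text \<open>Two separate integrations stand for two independent copies of \<omega>. The iterated
  integral thus builds in the independence of the times, and the locale needs only their individual
  laws.\<close>

definition mixture :: "nat \<Rightarrow> real \<Rightarrow> real \<Rightarrow> real" where
  "mixture n t\<^sub>1 t\<^sub>2 = (LINT \<omega>'|M. LINT \<omega>|M. poisson_weight n (r * (T\<^sub>1 t\<^sub>1 \<omega> * T\<^sub>2 t\<^sub>2 \<omega>')))"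

text \<open>The absolute value extends the function of the second time to the whole line, where it
  stays bounded and continuous, as a test function for \<open>laplace_expectation\<close> and
  \<open>continuous_on_expectation\<close> must be.\<close>

definition partial_mixture :: "nat \<Rightarrow> real \<Rightarrow> real \<Rightarrow> real" where
  "partial_mixture n t\<^sub>1 y = (LINT \<omega>|M. poisson_weight n (r * (T\<^sub>1 t\<^sub>1 \<omega> * \<bar>y\<bar>)))"

lemma mixture_eq_partial_mixture:
  assumes "0 \<le> t\<^sub>2"
  shows "mixture n t\<^sub>1 t\<^sub>2 = (LINT \<omega>'|M. partial_mixture n t\<^sub>1 (T\<^sub>2 t\<^sub>2 \<omega>'))"
  unfolding mixture_def partial_mixture_def
  by (intro Bochner_Integration.integral_cong) (use T2.T_nonneg[OF assms] in auto)

context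
  fixes t\<^sub>1 :: real
  assumes t\<^sub>1: "0 \<le> t\<^sub>1"
begin

lemma partial_weight_bound: "\<omega> \<in> space M \<Longrightarrow> \<bar>poisson_weight n (r * (T\<^sub>1 t\<^sub>1 \<omega> * \<bar>y\<bar>))\<bar> \<le> 1"
  using r T1.T_nonneg[OF t\<^sub>1] by (intro poisson_weight_bounds) auto

lemma measurable_partial_weight:
  "(\<lambda>(y, \<omega>). poisson_weight n (r * (T\<^sub>1 t\<^sub>1 \<omega> * \<bar>y\<bar>))) \<in> borel_measurable (borel \<Otimes>\<^sub>M M)"
  using T1.measurable_T[OF t\<^sub>1] by measurable

lemma integrable_partial_weight: "integrable M (\<lambda>\<omega>. poisson_weight n (r * (T\<^sub>1 t\<^sub>1 \<omega> * \<bar>y\<bar>)))"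
proof (rule T1.integrable_const_bound[of _ 1])
  note T1.measurable_T[OF t\<^sub>1, measurable]
  show "(\<lambda>\<omega>. poisson_weight n (r * (T\<^sub>1 t\<^sub>1 \<omega> * \<bar>y\<bar>))) \<in> borel_measurable M"
    by measurable
qed (use partial_weight_bound in auto)

lemma partial_mixture_bound: "\<bar>partial_mixture n t\<^sub>1 y\<bar> \<le> 1"
proof -
  have "\<bar>partial_mixture n t\<^sub>1 y\<bar> \<le> (LINT \<omega>|M. \<bar>poisson_weight n (r * (T\<^sub>1 t\<^sub>1 \<omega> * \<bar>y\<bar>))\<bar>)"
    unfolding partial_mixture_def by (rule integral_abs_bound)
  also have "\<dots> \<le> (LINT \<omega>|M. 1)"
    by (rule integral_mono_AE) (use integrable_partial_weight partial_weight_bound in auto)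
  finally show ?thesis by (simp add: T1.prob_space)
qed

lemma measurable_partial_mixture: "partial_mixture n t\<^sub>1 \<in> borel_measurable borel"
  unfolding partial_mixture_def[abs_def]
  using measurable_partial_weight by (rule T1.borel_measurable_lebesgue_integral)

lemma isCont_partial_mixture: "isCont (partial_mixture n t\<^sub>1) y"
proof (rule continuous_at_sequentiallyI)
  fix u assume u: "u \<longlonglongrightarrow> y"
  show "(\<lambda>k. partial_mixture n t\<^sub>1 (u k)) \<longlonglongrightarrow> partial_mixture n t\<^sub>1 y"
    unfolding partial_mixture_def
  proof (rule integral_dominated_convergence[where w="\<lambda>_. 1"])
    show "AE \<omega> in M. (\<lambda>k. poisson_weight n (r * (T\<^sub>1 t\<^sub>1 \<omega> * \<bar>u k\<bar>))) \<longlonglongrightarrow> poisson_weight n (r * (T\<^sub>1 t\<^sub>1 \<omega> * \<bar>y\<bar>))"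
      by (intro AE_I2 isCont_tendsto_compose[OF isCont_poisson_weight] tendsto_intros u)
  qed (use integrable_partial_weight partial_weight_bound in auto)
qed

lemma mixture_bound: 
  assumes t\<^sub>2: "0 \<le> t\<^sub>2"
  shows "\<bar>mixture n t\<^sub>1 t\<^sub>2\<bar> \<le> 1"
proof -
  note T2.measurable_T[OF t\<^sub>2, measurable] measurable_partial_mixture[measurable]
  have i: "integrable M (\<lambda>\<omega>'. partial_mixture n t\<^sub>1 (T\<^sub>2 t\<^sub>2 \<omega>'))"
    by (rule T1.integrable_const_bound[of _ 1]) (use partial_mixture_bound in auto)
  have "\<bar>mixture n t\<^sub>1 t\<^sub>2\<bar> \<le> (LINT \<omega>'|M. \<bar>partial_mixture n t\<^sub>1 (T\<^sub>2 t\<^sub>2 \<omega>')\<bar>)"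
    unfolding mixture_eq_partial_mixture[OF t\<^sub>2] by (rule integral_abs_bound)
  also have "\<dots> \<le> (LINT \<omega>'|M. 1)"
    by (rule integral_mono_AE) (use i partial_mixture_bound in auto)
  finally show ?thesis by (simp add: T1.prob_space)
qed

lemma continuous_on_mixture: "continuous_on {0<..} (mixture n t\<^sub>1)"
proof -
  have "continuous_on {0<..} (\<lambda>t\<^sub>2. LINT \<omega>'|M. partial_mixture n t\<^sub>1 (T\<^sub>2 t\<^sub>2 \<omega>'))"
    using T2.continuous_on_expectation[OF measurable_partial_mixture partial_mixture_bound isCont_partial_mixture] .
  then show ?thesis by (rule continuous_on_eq) (simp add: mixture_eq_partial_mixture)
qed

text \<open>After Fubini the inner integral, for fixed \<omega>, concerns a Poisson count whose mean
  is proportional to an exponential time, hence a geometric weight with c =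
  \<open>r * T\<^sub>1 t\<^sub>1 \<omega>\<close>.\<close>

lemma laplace_partial_mixture:
  assumes b: "0 < b"
  shows "b * laplace (partial_mixture n t\<^sub>1) b = (LINT \<omega>|M. geometric_weight b n (r * T\<^sub>1 t\<^sub>1 \<omega>))"
proof -
  interpret P: pair_sigma_finite lborel M by unfold_locales
  define h where "h y \<omega> = indicator {0<..} y * (exp (- b * y) * poisson_weight n (r * (T\<^sub>1 t\<^sub>1 \<omega> * \<bar>y\<bar>)))" for y \<omega>
  note measurable_partial_weight[measurable]
  have hm: "(\<lambda>(y, \<omega>). h y \<omega>) \<in> borel_measurable (lborel \<Otimes>\<^sub>M M)"
  proof -
    have "(\<lambda>p. indicator {0<..} (fst p) * (exp (- b * fst p) * (case p of (y, \<omega>) \<Rightarrow> poisson_weight n (r * (T\<^sub>1 t\<^sub>1 \<omega> * \<bar>y\<bar>))))) \<in> borel_measurable (lborel \<Otimes>\<^sub>M M)"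
      using measurable_partial_weight by (simp add: measurable_cong_sets[OF sets_pair_measure_cong[OF sets_lborel refl] refl])
    then show ?thesis by (simp add: h_def case_prod_beta)
  qed
  have h_norm: "norm (h y \<omega>) \<le> indicator {0<..} y * (exp (- b * y) * 1)" if "\<omega> \<in> space M" for y \<omega>
    using partial_weight_bound[OF that, of n y] by (auto simp: h_def abs_mult indicator_def)
  have i1: "integrable lborel (\<lambda>y. indicator {0<..} y * (exp (- b * y) * 1))"
    using laplace_integrable_const[OF b, of 1] by (simp only: laplace_integrable_def)
  have hi: "integrable M (h y)" for y
    unfolding h_def[abs_def] using integrable_partial_weight by (intro integrable_mult_right)
  have int: "integrable (lborel \<Otimes>\<^sub>M M) (\<lambda>(y, \<omega>). h y \<omega>)"
  proof (rule P.Fubini_integrable[OF hm])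
    show "AE y in lborel. integrable M (\<lambda>\<omega>. case (y, \<omega>) of (y, \<omega>) \<Rightarrow> h y \<omega>)" using hi by simp
    show "integrable lborel (\<lambda>y. LINT \<omega>|M. norm (case (y, \<omega>) of (y, \<omega>) \<Rightarrow> h y \<omega>))"
    proof (rule Bochner_Integration.integrable_bound[OF i1])
      show "(\<lambda>y. LINT \<omega>|M. norm (case (y, \<omega>) of (y, \<omega>) \<Rightarrow> h y \<omega>)) \<in> borel_measurable lborel"
        using hm by measurable
      have "(LINT \<omega>|M. norm (h y \<omega>)) \<le> (LINT \<omega>|M. indicator {0<..} y * (exp (- b * y) * 1))" for y
        by (rule integral_mono_AE) (use hi h_norm in auto)
      then show "AE y in lborel. norm (LINT \<omega>|M. norm (case (y, \<omega>) of (y, \<omega>) \<Rightarrow> h y \<omega>))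
          \<le> norm (indicator {0<..} y * (exp (- b * y) * 1))"
        by (auto simp: T1.prob_space abs_mult)
    qed
  qed
  have "laplace (partial_mixture n t\<^sub>1) b = (LINT y|lborel. LINT \<omega>|M. h y \<omega>)"
    unfolding laplace_def partial_mixture_def h_def using integrable_partial_weight by simp
  also have "\<dots> = (LINT \<omega>|M. LINT y|lborel. h y \<omega>)"
    using P.Fubini_integral[OF int] by simp
  finally have "b * laplace (partial_mixture n t\<^sub>1) b = (LINT \<omega>|M. b * (LINT y|lborel. h y \<omega>))"
    by simp
  also have "\<dots> = (LINT \<omega>|M. geometric_weight b n (r * T\<^sub>1 t\<^sub>1 \<omega>))"
  proof (intro Bochner_Integration.integral_cong refl)
    fix \<omega> assume "\<omega> \<in> space M"
    then have c: "0 \<le> r * T\<^sub>1 t\<^sub>1 \<omega>" using r T1.T_nonneg[OF t\<^sub>1] by simp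
    have "(LINT y|lborel. h y \<omega>) = laplace (\<lambda>y. exp (- (r * T\<^sub>1 t\<^sub>1 \<omega> * y)) * (r * T\<^sub>1 t\<^sub>1 \<omega> * y) ^ n / fact n) b"
      unfolding laplace_def h_def poisson_weight_def
      by (intro Bochner_Integration.integral_cong) (auto simp: indicator_def mult.assoc)
    then show "b * (LINT y|lborel. h y \<omega>) = geometric_weight b n (r * T\<^sub>1 t\<^sub>1 \<omega>)"
      using poisson_weight_laplace[OF b c] by simp
  qed
  finally show ?thesis .
qed

text \<open>At an exponential time of rate z the second folded time is exponential with rate
  \<open>z powr \<alpha>\<^sub>2\<close>, which reduces the claim to
  \<open>laplace_partial_mixture\<close>.\<close>

lemma laplace_mixture_2:
  assumes z: "0 < z"
  shows "z * laplace (mixture n t\<^sub>1) z = (LINT \<omega>|M. geometric_weight (z powr \<alpha>\<^sub>2) n (r * \<bar>T\<^sub>1 t\<^sub>1 \<omega>\<bar>))"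
proof -
  have "laplace (mixture n t\<^sub>1) z = laplace (\<lambda>t\<^sub>2. LINT \<omega>'|M. partial_mixture n t\<^sub>1 (T\<^sub>2 t\<^sub>2 \<omega>')) z"
    by (rule laplace_cong) (simp add: mixture_eq_partial_mixture)
  then have "z * laplace (mixture n t\<^sub>1) z = z powr \<alpha>\<^sub>2 * laplace (partial_mixture n t\<^sub>1) (z powr \<alpha>\<^sub>2)"
    using T2.laplace_expectation[OF measurable_partial_mixture partial_mixture_bound z] by simp
  also have "\<dots> = (LINT \<omega>|M. geometric_weight (z powr \<alpha>\<^sub>2) n (r * T\<^sub>1 t\<^sub>1 \<omega>))"
    using z by (intro laplace_partial_mixture) simp
  also have "\<dots> = (LINT \<omega>|M. geometric_weight (z powr \<alpha>\<^sub>2) n (r * \<bar>T\<^sub>1 t\<^sub>1 \<omega>\<bar>))"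
    by (intro Bochner_Integration.integral_cong) (use T1.T_nonneg[OF t\<^sub>1] in auto)
  finally show ?thesis .
qed

end

lemma geometric_weight_abs:
  assumes b: "0 < b"
  shows "(\<lambda>x. geometric_weight b n (r * \<bar>x\<bar>)) \<in> borel_measurable borel"
    and "\<bar>geometric_weight b n (r * \<bar>x\<bar>)\<bar> \<le> 1"
    and "isCont (\<lambda>x. geometric_weight b n (r * \<bar>x\<bar>)) x"
proof -
  have nz: "r * \<bar>x\<bar> + b \<noteq> 0" for x using r b by (smt (verit) mult_nonneg_nonneg)
  show "(\<lambda>x. geometric_weight b n (r * \<bar>x\<bar>)) \<in> borel_measurable borel"
    unfolding geometric_weight_def by measurable
  show "\<bar>geometric_weight b n (r * \<bar>x\<bar>)\<bar> \<le> 1"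
    using geometric_weight_bounds[OF b, of "r * \<bar>x\<bar>" n] r by auto
  show "isCont (\<lambda>x. geometric_weight b n (r * \<bar>x\<bar>)) x"
    unfolding geometric_weight_def using nz by (intro continuous_intros) auto
qed

text \<open>The same exchange for the first folded time, applied to the geometric weight, turns the
  double transform into the sequence treated by \<open>poisson_mixture_recursion\<close>.\<close>

lemma
  assumes z: "0 < z\<^sub>2"
  shows laplace_laplace_mixture: "0 < z\<^sub>1 \<Longrightarrow> z\<^sub>1 * laplace (\<lambda>t\<^sub>1. z\<^sub>2 * laplace (mixture n t\<^sub>1) z\<^sub>2) z\<^sub>1 =
      z\<^sub>1 powr \<alpha>\<^sub>1 * laplace (\<lambda>x. geometric_weight (z\<^sub>2 powr \<alpha>\<^sub>2) n (r * x)) (z\<^sub>1 powr \<alpha>\<^sub>1)"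
    and continuous_on_laplace_mixture: "continuous_on {0<..} (\<lambda>t\<^sub>1. laplace (mixture n t\<^sub>1) z\<^sub>2)"
proof -
  have b: "0 < z\<^sub>2 powr \<alpha>\<^sub>2" using z by simp
  note gw = geometric_weight_abs[OF b, where n=n]
  show "z\<^sub>1 * laplace (\<lambda>t\<^sub>1. z\<^sub>2 * laplace (mixture n t\<^sub>1) z\<^sub>2) z\<^sub>1 =
      z\<^sub>1 powr \<alpha>\<^sub>1 * laplace (\<lambda>x. geometric_weight (z\<^sub>2 powr \<alpha>\<^sub>2) n (r * x)) (z\<^sub>1 powr \<alpha>\<^sub>1)" if z1: "0 < z\<^sub>1"
  proof -
    have "laplace (\<lambda>t\<^sub>1. z\<^sub>2 * laplace (mixture n t\<^sub>1) z\<^sub>2) z\<^sub>1 =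
        laplace (\<lambda>t\<^sub>1. LINT \<omega>|M. geometric_weight (z\<^sub>2 powr \<alpha>\<^sub>2) n (r * \<bar>T\<^sub>1 t\<^sub>1 \<omega>\<bar>)) z\<^sub>1"
      by (rule laplace_cong) (simp add: laplace_mixture_2 z)
    then have "z\<^sub>1 * laplace (\<lambda>t\<^sub>1. z\<^sub>2 * laplace (mixture n t\<^sub>1) z\<^sub>2) z\<^sub>1 =
        z\<^sub>1 powr \<alpha>\<^sub>1 * laplace (\<lambda>x. geometric_weight (z\<^sub>2 powr \<alpha>\<^sub>2) n (r * \<bar>x\<bar>)) (z\<^sub>1 powr \<alpha>\<^sub>1)"
      using T1.laplace_expectation[OF gw(1,2) z1] by simp
    also have "laplace (\<lambda>x. geometric_weight (z\<^sub>2 powr \<alpha>\<^sub>2) n (r * \<bar>x\<bar>)) (z\<^sub>1 powr \<alpha>\<^sub>1)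
        = laplace (\<lambda>x. geometric_weight (z\<^sub>2 powr \<alpha>\<^sub>2) n (r * x)) (z\<^sub>1 powr \<alpha>\<^sub>1)"
      by (rule laplace_cong) simp
    finally show ?thesis .
  qed
  have "continuous_on {0<..} (\<lambda>t\<^sub>1. (LINT \<omega>|M. geometric_weight (z\<^sub>2 powr \<alpha>\<^sub>2) n (r * \<bar>T\<^sub>1 t\<^sub>1 \<omega>\<bar>)) / z\<^sub>2)"
    using T1.continuous_on_expectation[OF gw] z by (intro continuous_intros) auto
  then show "continuous_on {0<..} (\<lambda>t\<^sub>1. laplace (mixture n t\<^sub>1) z\<^sub>2)"
  proof (rule continuous_on_eq)
    fix t\<^sub>1 :: real assume "t\<^sub>1 \<in> {0<..}"
    then show "(LINT \<omega>|M. geometric_weight (z\<^sub>2 powr \<alpha>\<^sub>2) n (r * \<bar>T\<^sub>1 t\<^sub>1 \<omega>\<bar>)) / z\<^sub>2 = laplace (mixture n t\<^sub>1) z\<^sub>2"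
      using laplace_mixture_2[OF _ z, of t\<^sub>1 n] z by (auto simp: field_simps)
  qed
qed

end

section \<open>Poisson processes at a product of independent times\<close>

text \<open>The partial sums integrate \<open>f\<close> over the event J < m, and dominated
  convergence removes the restriction. This is the device for conditioning on a discretised
  time.\<close>

lemma integral_partition_sums:
  fixes f :: "'a \<Rightarrow> real" and J :: "'a \<Rightarrow> nat"
  assumes J [measurable]: "J \<in> M \<rightarrow>\<^sub>M count_space UNIV" and f: "integrable M f"
  shows "(\<lambda>j. LINT \<omega>|M. indicator {j} (J \<omega>) * f \<omega>) sums (LINT \<omega>|M. f \<omega>)"
proof -
  have [measurable]: "f \<in> borel_measurable M" using f by simp
  have int: "integrable M (\<lambda>\<omega>. indicator A (J \<omega>) * f \<omega>)" for A
    by (rule Bochner_Integration.integrable_bound[OF f]) (auto simp: indicator_def)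
  have "(\<Sum>j<m. LINT \<omega>|M. indicator {j} (J \<omega>) * f \<omega>) = (LINT \<omega>|M. indicator {..<m} (J \<omega>) * f \<omega>)" for m
  proof -
    have "(\<Sum>j<m. LINT \<omega>|M. indicator {j} (J \<omega>) * f \<omega>) = (LINT \<omega>|M. (\<Sum>j<m. indicator {j} (J \<omega>) * f \<omega>))"
      by (rule Bochner_Integration.integral_sum[symmetric]) (rule int)
    also have "\<dots> = (LINT \<omega>|M. indicator {..<m} (J \<omega>) * f \<omega>)"
      by (intro Bochner_Integration.integral_cong) (auto simp: indicator_def simp flip: sum_distrib_right)
    finally show ?thesis .
  qed
  moreover have "(\<lambda>m. LINT \<omega>|M. indicator {..<m} (J \<omega>) * f \<omega>) \<longlonglongrightarrow> (LINT \<omega>|M. f \<omega>)"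
  proof (rule integral_dominated_convergence[where w="\<lambda>\<omega>. norm (f \<omega>)"])
    show "AE \<omega> in M. (\<lambda>m. indicator {..<m} (J \<omega>) * f \<omega>) \<longlonglongrightarrow> f \<omega>"
    proof (rule AE_I2)
      fix \<omega>
      have "\<forall>\<^sub>F m in sequentially. f \<omega> = indicator {..<m} (J \<omega>) * f \<omega>"
        using eventually_gt_at_top[of "J \<omega>"] by eventually_elim auto
      then show "(\<lambda>m. indicator {..<m} (J \<omega>) * f \<omega>) \<longlonglongrightarrow> f \<omega>"
        by (rule Lim_transform_eventually[OF tendsto_const])
    qed
  qed (use f in \<open>auto simp: indicator_def\<close>)
  ultimately show ?thesis by (simp add: sums_def)
qed

definition grid_index :: "nat \<Rightarrow> real \<Rightarrow> nat" where
  "grid_index k x = nat \<lfloor>real (Suc k) * x\<rfloor>"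

text \<open>Upper end of the cell [i/(k+1), (i+1)/(k+1)). Taking the upper end keeps the
  approximation strictly above x, as right continuity requires, and positive even at x = 0.\<close>

definition grid_point :: "nat \<Rightarrow> nat \<Rightarrow> real" where
  "grid_point k i = (real i + 1) / real (Suc k)"

lemma grid_point_pos: "0 < grid_point k i"
  by (simp add: grid_point_def)

lemma grid_point_index:
  assumes "0 \<le> x"
  shows "x < grid_point k (grid_index k x)" "grid_point k (grid_index k x) \<le> x + 1 / real (Suc k)"
proof -
  have "0 \<le> real (Suc k) * x" using assms by simp
  then have "0 \<le> \<lfloor>real (Suc k) * x\<rfloor>" unfolding zero_le_floor .
  then have e: "real (grid_index k x) = of_int \<lfloor>real (Suc k) * x\<rfloor>" by (simp add: grid_index_def)
  have "real (Suc k) * x < real (grid_index k x) + 1" "real (grid_index k x) \<le> real (Suc k) * x"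
    unfolding e by linarith+
  then show "x < grid_point k (grid_index k x)" "grid_point k (grid_index k x) \<le> x + 1 / real (Suc k)"
    unfolding grid_point_def by (simp_all add: divide_simps mult.commute)
qed

lemma grid_point_tendsto:
  assumes "0 \<le> x"
  shows "(\<lambda>k. grid_point k (grid_index k x)) \<longlonglongrightarrow> x"
proof (rule tendsto_sandwich[where f="\<lambda>_. x" and h="\<lambda>k. x + 1 / real (Suc k)"])
  have "(\<lambda>k. x + 1 / real (Suc k)) \<longlonglongrightarrow> x + 0"
    using LIMSEQ_inverse_real_of_nat by (intro tendsto_add tendsto_const) (simp add: inverse_eq_divide)
  then show "(\<lambda>k. x + 1 / real (Suc k)) \<longlonglongrightarrow> x" by simp
qed (use grid_point_index[OF assms] less_imp_le in \<open>auto intro!: always_eventually\<close>)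

lemma measurable_grid_index [measurable]: "grid_index k \<in> borel \<rightarrow>\<^sub>M count_space UNIV"
  unfolding grid_index_def[abs_def] by measurable

text \<open>
  Both sides are approximated by replacing the two factors of the random time with grid points
  strictly to their right, where independence is an identity between countable sums.
\<close>

lemma (in prob_space) poisson_subordination:
  fixes N :: "real \<Rightarrow> 'a \<Rightarrow> nat" and A B :: "'a \<Rightarrow> real"
  assumes N: "\<And>c. 0 \<le> c \<Longrightarrow> N c \<in> M \<rightarrow>\<^sub>M count_space UNIV"
    and right_cont: "\<And>\<omega> c. \<omega> \<in> space M \<Longrightarrow> 0 \<le> c \<Longrightarrow> ((\<lambda>s. N s \<omega>) \<longlongrightarrow> N c \<omega>) (at_right c)"
    and law: "\<And>c. 0 < c \<Longrightarrow> prob {\<omega> \<in> space M. N c \<omega> = n} = poisson_weight n (r * c)"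
    and A [measurable]: "A \<in> borel_measurable M" and A0: "\<And>\<omega>. \<omega> \<in> space M \<Longrightarrow> 0 \<le> A \<omega>"
    and B [measurable]: "B \<in> borel_measurable M" and B0: "\<And>\<omega>. \<omega> \<in> space M \<Longrightarrow> 0 \<le> B \<omega>"
    and indep: "\<And>c S S'. 0 < c \<Longrightarrow> S \<in> sets borel \<Longrightarrow> S' \<in> sets borel \<Longrightarrow>
      prob {\<omega> \<in> space M. N c \<omega> = n \<and> A \<omega> \<in> S \<and> B \<omega> \<in> S'} =
      prob {\<omega> \<in> space M. N c \<omega> = n} * prob {\<omega> \<in> space M. A \<omega> \<in> S} * prob {\<omega> \<in> space M. B \<omega> \<in> S'}"
    and r: "0 < r"
  shows "(\<lambda>\<omega>. N (A \<omega> * B \<omega>) \<omega>) \<in> M \<rightarrow>\<^sub>M count_space UNIV"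
    and "prob {\<omega> \<in> space M. N (A \<omega> * B \<omega>) \<omega> = n} = (LINT \<omega>'|M. LINT \<omega>|M. poisson_weight n (r * (A \<omega> * B \<omega>')))"
proof -
  define c where "c k i j = grid_point k i * grid_point k j" for k i j
  have c_pos: "0 < c k i j" for k i j by (simp add: c_def grid_point_pos)
  define I where "I k \<omega> = grid_index k (A \<omega>)" for k \<omega>
  define J where "J k \<omega> = grid_index k (B \<omega>)" for k \<omega>
  have I [measurable]: "I k \<in> M \<rightarrow>\<^sub>M count_space UNIV" for k unfolding I_def by measurable
  have J [measurable]: "J k \<in> M \<rightarrow>\<^sub>M count_space UNIV" for k unfolding J_def by measurable
  have Nc [measurable]: "N (c k i j) \<in> M \<rightarrow>\<^sub>M count_space UNIV" for k i j
    using c_pos less_imp_le by (intro N) blast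
  have Nij [measurable]: "(\<lambda>\<omega>. N (c k (I k \<omega>) (J k \<omega>)) \<omega>) \<in> M \<rightarrow>\<^sub>M count_space UNIV" for k
  proof (rule measurable_compose_countable[OF _ J])
    show "(\<lambda>\<omega>. N (c k (I k \<omega>) j) \<omega>) \<in> M \<rightarrow>\<^sub>M count_space UNIV" for j
      by (rule measurable_compose_countable[OF Nc I])
  qed
  have c_lim: "(\<lambda>k. c k (I k \<omega>) (J k \<omega>')) \<longlonglongrightarrow> A \<omega> * B \<omega>'" if "\<omega> \<in> space M" "\<omega>' \<in> space M" for \<omega> \<omega>'
    unfolding c_def I_def J_def using that by (intro tendsto_mult grid_point_tendsto A0 B0)
  have N_ev: "\<forall>\<^sub>F k in sequentially. N (c k (I k \<omega>) (J k \<omega>)) \<omega> = N (A \<omega> * B \<omega>) \<omega>" if \<omega>: "\<omega> \<in> space M" for \<omega>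
  proof -
    \<comment> \<open>Both factors lie strictly below their grid points, so the grid times approach
      the product strictly from the right, where \<open>N\<close> converges; being integer-valued,
      \<open>N\<close> is eventually constant along them.\<close>
    have "A \<omega> * B \<omega> < c k (I k \<omega>) (J k \<omega>)" for k
      unfolding c_def I_def J_def using grid_point_index(1) A0[OF \<omega>] B0[OF \<omega>]
      by (intro mult_strict_mono') auto
    then have "filterlim (\<lambda>k. c k (I k \<omega>) (J k \<omega>)) (at_right (A \<omega> * B \<omega>)) sequentially"
      unfolding filterlim_at using c_lim[OF \<omega> \<omega>] by (auto intro!: always_eventually simp: less_imp_neq[symmetric])
    with right_cont[OF \<omega>, of "A \<omega> * B \<omega>"] A0[OF \<omega>] B0[OF \<omega>]
    have "(\<lambda>k. N (c k (I k \<omega>) (J k \<omega>)) \<omega>) \<longlonglongrightarrow> N (A \<omega> * B \<omega>) \<omega>"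
      by (auto intro: filterlim_compose)
    then show ?thesis by (simp add: tendsto_discrete)
  qed
  \<comment> \<open>Measurability of the limit is obtained for real values, and \<open>floor\<close>
    then brings it back to the natural numbers.\<close>
  have "(\<lambda>\<omega>. real (N (A \<omega> * B \<omega>) \<omega>)) \<in> borel_measurable M"
  proof (rule borel_measurable_LIMSEQ_real)
    show "(\<lambda>k. real (N (c k (I k \<omega>) (J k \<omega>)) \<omega>)) \<longlonglongrightarrow> real (N (A \<omega> * B \<omega>) \<omega>)" if "\<omega> \<in> space M" for \<omega>
    proof (rule Lim_transform_eventually[OF tendsto_const])
      show "\<forall>\<^sub>F k in sequentially. real (N (A \<omega> * B \<omega>) \<omega>) = real (N (c k (I k \<omega>) (J k \<omega>)) \<omega>)"
        using N_ev[OF that] by eventually_elim simp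
    qed
  qed measurable
  then have "(\<lambda>\<omega>. nat \<lfloor>real (N (A \<omega> * B \<omega>) \<omega>)\<rfloor>) \<in> M \<rightarrow>\<^sub>M count_space UNIV"
    by measurable
  then show NAB [measurable]: "(\<lambda>\<omega>. N (A \<omega> * B \<omega>) \<omega>) \<in> M \<rightarrow>\<^sub>M count_space UNIV" by simp
  have w_bound: "\<bar>poisson_weight n (r * c k i j)\<bar> \<le> 1" for k i j
    using r c_pos[of k i j] by (intro poisson_weight_bounds) simp
  have int_ind: "integrable M (\<lambda>\<omega>. indicator {n} (F \<omega>) :: real)" if "F \<in> M \<rightarrow>\<^sub>M count_space UNIV" for F :: "'a \<Rightarrow> nat"
    by (rule integrable_const_bound[of _ 1]) (use that in \<open>auto simp: indicator_def\<close>)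
  \<comment> \<open>On a cell I = i, J = j the random time is the constant \<open>c k i j\<close>,
    so independence factorises the probability; summing over i and then over j gives the iterated
    integral.\<close>
  have grid: "(LINT \<omega>|M. indicator {n} (N (c k (I k \<omega>) (J k \<omega>)) \<omega>)) =
      (LINT \<omega>'|M. LINT \<omega>|M. poisson_weight n (r * c k (I k \<omega>) (J k \<omega>')))" for k
  proof -
    define a where "a i = prob {\<omega> \<in> space M. I k \<omega> = i}" for i
    define b where "b j = prob {\<omega> \<in> space M. J k \<omega> = j}" for j
    define w where "w i j = poisson_weight n (r * c k i j)" for i j
    have w_int: "integrable M (\<lambda>\<omega>. w (I k \<omega>) j)" for j
      by (rule integrable_const_bound[of _ 1]) (use w_bound in \<open>auto simp: w_def\<close>)
    \<comment> \<open>\<open>G j\<close> is the inner integral over the first time, with the second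
      grid index frozen at j.\<close>
    define G where "G j = (LINT \<omega>|M. w (I k \<omega>) j)" for j
    have G_bound: "\<bar>G j\<bar> \<le> 1" for j
    proof -
      have "\<bar>G j\<bar> \<le> (LINT \<omega>|M. \<bar>w (I k \<omega>) j\<bar>)" unfolding G_def by (rule integral_abs_bound)
      also have "\<dots> \<le> (LINT \<omega>|M. 1)"
        by (rule integral_mono_AE) (use w_int w_bound in \<open>auto simp: w_def\<close>)
      finally show ?thesis by (simp add: prob_space)
    qed
    have a_int: "(LINT \<omega>|M. indicator {i} (I k \<omega>) * x) = a i * x" for i and x :: real
    proof -
      have "(LINT \<omega>|M. indicator {i} (I k \<omega>) * x) = (LINT \<omega>|M. indicator {\<omega> \<in> space M. I k \<omega> = i} \<omega> * x)"
        by (intro Bochner_Integration.integral_cong) (auto simp: indicator_def)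
      then show ?thesis by (simp add: a_def)
    qed
    have b_int: "(LINT \<omega>|M. indicator {j} (J k \<omega>) * x) = b j * x" for j and x :: real
    proof -
      have "(LINT \<omega>|M. indicator {j} (J k \<omega>) * x) = (LINT \<omega>|M. indicator {\<omega> \<in> space M. J k \<omega> = j} \<omega> * x)"
        by (intro Bochner_Integration.integral_cong) (auto simp: indicator_def)
      then show ?thesis by (simp add: b_def)
    qed
    have G_sums: "(\<lambda>i. a i * w i j) sums G j" for j
    proof -
      have "(LINT \<omega>|M. indicator {i} (I k \<omega>) * w (I k \<omega>) j) = a i * w i j" for i
        unfolding a_int[symmetric] by (intro Bochner_Integration.integral_cong) (auto simp: indicator_def)
      then show ?thesis using integral_partition_sums[OF I[of k] w_int[of j]] by (simp add: G_def)
    qed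
    have "(\<lambda>j. LINT \<omega>|M. indicator {j} (J k \<omega>) * G (J k \<omega>)) sums (LINT \<omega>|M. G (J k \<omega>))"
      by (rule integral_partition_sums[OF J])
        (rule integrable_const_bound[of _ 1], use G_bound in auto)
    moreover have "(LINT \<omega>|M. indicator {j} (J k \<omega>) * G (J k \<omega>)) = b j * G j" for j
      unfolding b_int[symmetric] by (intro Bochner_Integration.integral_cong) (auto simp: indicator_def)
    ultimately have R: "(\<lambda>j. b j * G j) sums (LINT \<omega>|M. G (J k \<omega>))" by simp
    define h where "h \<omega> = (indicator {n} (N (c k (I k \<omega>) (J k \<omega>)) \<omega>) :: real)" for \<omega>
    have h_int: "integrable M h" unfolding h_def by (rule int_ind) measurable
    have "(LINT \<omega>|M. indicator {j} (J k \<omega>) * h \<omega>) = b j * G j" for j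
    proof -
      have hj_int: "integrable M (\<lambda>\<omega>. indicator {j} (J k \<omega>) * h \<omega>)"
        by (rule integrable_const_bound[of _ 1]) (use h_int in \<open>auto simp: indicator_def h_def\<close>)
      have "(LINT \<omega>|M. indicator {i} (I k \<omega>) * (indicator {j} (J k \<omega>) * h \<omega>)) = b j * (a i * w i j)" for i
      proof -
        define S where "S = {x. grid_index k x = i}"
        define S' where "S' = {x. grid_index k x = j}"
        have S: "S \<in> sets borel" "S' \<in> sets borel"
          using measurable_sets[OF measurable_grid_index[of k], of "{i}"] measurable_sets[OF measurable_grid_index[of k], of "{j}"]
          by (simp_all add: S_def S'_def vimage_def)
        have "(LINT \<omega>|M. indicator {i} (I k \<omega>) * (indicator {j} (J k \<omega>) * h \<omega>))
            = (LINT \<omega>|M. indicator {\<omega> \<in> space M. N (c k i j) \<omega> = n \<and> A \<omega> \<in> S \<and> B \<omega> \<in> S'} \<omega>)"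
          by (intro Bochner_Integration.integral_cong)
            (auto simp: indicator_def h_def I_def J_def S_def S'_def)
        also have "\<dots> = prob {\<omega> \<in> space M. N (c k i j) \<omega> = n \<and> A \<omega> \<in> S \<and> B \<omega> \<in> S'}"
          by simp (rule arg_cong[where f=prob], auto)
        also have "\<dots> = w i j * a i * b j"
          unfolding indep[OF c_pos S] law[OF c_pos] by (simp add: w_def a_def b_def S_def S'_def I_def J_def)
        finally show ?thesis by (simp add: mult_ac)
      qed
      then have "(\<lambda>i. b j * (a i * w i j)) sums (LINT \<omega>|M. indicator {j} (J k \<omega>) * h \<omega>)"
        using integral_partition_sums[OF I[of k] hj_int] by simp
      moreover have "(\<lambda>i. b j * (a i * w i j)) sums (b j * G j)"
        by (rule sums_mult[OF G_sums])
      ultimately show ?thesis by (rule sums_unique2)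
    qed
    then have "(\<lambda>j. b j * G j) sums (LINT \<omega>|M. h \<omega>)"
      using integral_partition_sums[OF J[of k] h_int] by simp
    then have "(LINT \<omega>|M. h \<omega>) = (LINT \<omega>|M. G (J k \<omega>))" using R by (rule sums_unique2)
    then show ?thesis by (simp add: h_def G_def w_def)
  qed
  have L: "(\<lambda>k. LINT \<omega>|M. indicator {n} (N (c k (I k \<omega>) (J k \<omega>)) \<omega>) :: real) \<longlonglongrightarrow> (LINT \<omega>|M. indicator {n} (N (A \<omega> * B \<omega>) \<omega>))"
  proof (rule integral_dominated_convergence[where w="\<lambda>_. 1"])
    show "AE \<omega> in M. (\<lambda>k. indicator {n} (N (c k (I k \<omega>) (J k \<omega>)) \<omega>) :: real) \<longlonglongrightarrow> indicator {n} (N (A \<omega> * B \<omega>) \<omega>)"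
    proof (rule AE_I2)
      fix \<omega> assume "\<omega> \<in> space M"
      from N_ev[OF this] have "\<forall>\<^sub>F k in sequentially. indicator {n} (N (A \<omega> * B \<omega>) \<omega>) = (indicator {n} (N (c k (I k \<omega>) (J k \<omega>)) \<omega>) :: real)"
        by eventually_elim simp
      then show "(\<lambda>k. indicator {n} (N (c k (I k \<omega>) (J k \<omega>)) \<omega>) :: real) \<longlonglongrightarrow> indicator {n} (N (A \<omega> * B \<omega>) \<omega>)"
        by (rule Lim_transform_eventually[OF tendsto_const])
    qed
  qed (auto simp: indicator_def)
  have wI_int: "integrable M (\<lambda>\<omega>. poisson_weight n (r * c k (I k \<omega>) j))" for k j
    by (rule integrable_const_bound[of _ 1]) (use w_bound in auto)
  have inner_bound: "\<bar>LINT \<omega>|M. poisson_weight n (r * c k (I k \<omega>) j)\<bar> \<le> 1" for k j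
  proof -
    have "\<bar>LINT \<omega>|M. poisson_weight n (r * c k (I k \<omega>) j)\<bar> \<le> (LINT \<omega>|M. \<bar>poisson_weight n (r * c k (I k \<omega>) j)\<bar>)"
      by (rule integral_abs_bound)
    also have "\<dots> \<le> (LINT \<omega>|M. 1)"
      by (rule integral_mono_AE) (use wI_int w_bound in auto)
    finally show ?thesis by (simp add: prob_space)
  qed
  \<comment> \<open>One dominated convergence for each of the two integrals; the majorant is 1
    because the weights are probabilities.\<close>
  have "(\<lambda>k. LINT \<omega>'|M. LINT \<omega>|M. poisson_weight n (r * c k (I k \<omega>) (J k \<omega>'))) \<longlonglongrightarrow>
      (LINT \<omega>'|M. LINT \<omega>|M. poisson_weight n (r * (A \<omega> * B \<omega>')))"
  proof (rule integral_dominated_convergence[where w="\<lambda>_. 1"])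
    show "AE \<omega>' in M. (\<lambda>k. LINT \<omega>|M. poisson_weight n (r * c k (I k \<omega>) (J k \<omega>'))) \<longlonglongrightarrow> (LINT \<omega>|M. poisson_weight n (r * (A \<omega> * B \<omega>')))"
    proof (rule AE_I2)
      fix \<omega>' assume \<omega>': "\<omega>' \<in> space M"
      show "(\<lambda>k. LINT \<omega>|M. poisson_weight n (r * c k (I k \<omega>) (J k \<omega>'))) \<longlonglongrightarrow> (LINT \<omega>|M. poisson_weight n (r * (A \<omega> * B \<omega>')))"
      proof (rule integral_dominated_convergence[where w="\<lambda>_. 1"])
        show "AE \<omega> in M. (\<lambda>k. poisson_weight n (r * c k (I k \<omega>) (J k \<omega>'))) \<longlonglongrightarrow> poisson_weight n (r * (A \<omega> * B \<omega>'))"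
          by (intro AE_I2 isCont_tendsto_compose[OF isCont_poisson_weight] tendsto_mult tendsto_const c_lim \<omega>')
      qed (use w_bound wI_int in auto)
    qed
    show "(\<lambda>\<omega>'. LINT \<omega>|M. poisson_weight n (r * (A \<omega> * B \<omega>'))) \<in> borel_measurable M" by measurable
    show "(\<lambda>\<omega>'. LINT \<omega>|M. poisson_weight n (r * c k (I k \<omega>) (J k \<omega>'))) \<in> borel_measurable M" for k
      by (rule measurable_compose[OF J, where g="\<lambda>j. LINT \<omega>|M. poisson_weight n (r * c k (I k \<omega>) j)"]) simp
  qed (use inner_bound in auto)
  with L have "(LINT \<omega>|M. indicator {n} (N (A \<omega> * B \<omega>) \<omega>)) = (LINT \<omega>'|M. LINT \<omega>|M. poisson_weight n (r * (A \<omega> * B \<omega>')))"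
    unfolding grid by (rule LIMSEQ_unique)
  moreover have "(LINT \<omega>|M. indicator {n} (N (A \<omega> * B \<omega>) \<omega>)) = (LINT \<omega>|M. indicator {\<omega> \<in> space M. N (A \<omega> * B \<omega>) \<omega> = n} \<omega> :: real)"
    by (intro Bochner_Integration.integral_cong) (auto simp: indicator_def)
  ultimately show "prob {\<omega> \<in> space M. N (A \<omega> * B \<omega>) \<omega> = n} = (LINT \<omega>'|M. LINT \<omega>|M. poisson_weight n (r * (A \<omega> * B \<omega>')))"
    by simp
qed

section \<open>The fractional Poisson field\<close>

text \<open>The bound is the fractional integral of the constant C: as \<open>rl_kernel 1\<close> is
  1 on the positive half-line, the semigroup law evaluates it to C t^a / Gamma(a+1).\<close>

lemma abs_rl_integral_le:
  assumes a: "0 < a" and bound: "\<And>s. 0 < s \<Longrightarrow> s < t \<Longrightarrow> \<bar>f s\<bar> \<le> C" and C: "0 \<le> C"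
  shows "\<bar>rl_integral a f t\<bar> \<le> C * rl_kernel (a + 1) t"
proof -
  have "has_bochner_integral lborel (\<lambda>s. C * (rl_kernel a (t - s) * rl_kernel 1 s)) (C * rl_kernel (a + 1) t)"
    by (intro has_bochner_integral_mult_right has_bochner_integral_rl_kernel_conv a) simp
  then have i: "integrable lborel (\<lambda>s. C * (rl_kernel a (t - s) * rl_kernel 1 s))"
      "(LINT s|lborel. C * (rl_kernel a (t - s) * rl_kernel 1 s)) = C * rl_kernel (a + 1) t"
    by (simp_all only: has_bochner_integral_iff)
  have "\<bar>rl_integral a f t\<bar> \<le> (LINT s|lborel. \<bar>rl_kernel a (t - s) * (indicator {0<..} s * f s)\<bar>)"
    unfolding rl_integral_def by (rule integral_abs_bound)
  also have "\<dots> \<le> (LINT s|lborel. C * (rl_kernel a (t - s) * rl_kernel 1 s))"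
  proof (rule integral_mono_AE'[OF i(1)]; rule AE_I2)
    fix s
    show "\<bar>rl_kernel a (t - s) * (indicator {0<..} s * f s)\<bar> \<le> C * (rl_kernel a (t - s) * rl_kernel 1 s)"
    proof (cases "0 < s \<and> s < t")
      case True
      then have "rl_kernel a (t - s) * \<bar>f s\<bar> \<le> rl_kernel a (t - s) * C"
        by (intro mult_left_mono bound rl_kernel_nonneg a) auto
      then show ?thesis using True rl_kernel_nonneg[OF a, of "t - s"]
        by (simp add: abs_mult rl_kernel_def[of 1] mult.commute)
    next
      case False
      then show ?thesis by (auto simp: rl_kernel_def)
    qed
    show "0 \<le> C * (rl_kernel a (t - s) * rl_kernel 1 s)"
      using C rl_kernel_nonneg[OF a] rl_kernel_nonneg[of 1] by simp
  qed
  finally show ?thesis unfolding i(2) .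
qed

text \<open>Replacing y by a grid point leaves countably many sections in x, each measurable, and
  continuity in y gives the limit. The grid points are positive, hence inside the domain of
  continuity.\<close>

lemma borel_measurable_caratheodory:
  fixes f :: "real \<Rightarrow> real \<Rightarrow> real"
  assumes m: "\<And>y. 0 < y \<Longrightarrow> (\<lambda>x. indicator {0<..} x * f x y) \<in> borel_measurable borel"
    and cont: "\<And>x. 0 < x \<Longrightarrow> continuous_on {0<..} (f x)"
  shows "(\<lambda>(x, y). indicator {0<..} x * (indicator {0<..} y * f x y)) \<in> borel_measurable (borel \<Otimes>\<^sub>M borel)"
  unfolding case_prod_beta
proof (rule borel_measurable_LIMSEQ_real)
  let ?u = "\<lambda>k y. grid_point k (grid_index k y)"
  show "(\<lambda>k. indicator {0<..} (snd p) * (indicator {0<..} (fst p) * f (fst p) (?u k (snd p))))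
      \<longlonglongrightarrow> indicator {0<..} (fst p) * (indicator {0<..} (snd p) * f (fst p) (snd p))" for p
  proof (cases "0 < fst p \<and> 0 < snd p")
    case True
    then have "(\<lambda>k. f (fst p) (?u k (snd p))) \<longlonglongrightarrow> f (fst p) (snd p)"
      by (intro continuous_on_tendsto_compose[OF cont grid_point_tendsto]) (auto simp: grid_point_pos)
    then show ?thesis using True by simp
  qed auto
  show "(\<lambda>p. indicator {0<..} (snd p) * (indicator {0<..} (fst p) * f (fst p) (?u k (snd p))))
      \<in> borel_measurable (borel \<Otimes>\<^sub>M borel)" for k
  proof (rule borel_measurable_times)
    show "(\<lambda>p. indicator {0<..} (fst p) * f (fst p) (?u k (snd p))) \<in> borel_measurable (borel \<Otimes>\<^sub>M borel)"
    proof (rule measurable_compose_countable[where g="\<lambda>p. grid_index k (snd p)"])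
      show "(\<lambda>p. indicator {0<..} (fst p) * f (fst p) (grid_point k i)) \<in> borel_measurable (borel \<Otimes>\<^sub>M borel)" for i
        using measurable_compose[OF measurable_fst m[OF grid_point_pos]] .
    qed measurable
  qed measurable
qed

text \<open>Fubini with the majorant C exp(-\<open>z\<^sub>1\<close> x)
  exp(-\<open>z\<^sub>2\<close> y) y^(a-1)/Gamma(a). The kernel in the bound lets one statement
  serve the probabilities (a = 1) and their inner Caputo derivative (a =
  \<open>\<alpha>\<^sub>2 + 1\<close>).\<close>

lemma
  fixes f :: "real \<Rightarrow> real \<Rightarrow> real"
  assumes m: "(\<lambda>(x, y). indicator {0<..} x * (indicator {0<..} y * f x y)) \<in> borel_measurable (borel \<Otimes>\<^sub>M borel)"
    and bound: "\<And>x y. 0 < x \<Longrightarrow> 0 < y \<Longrightarrow> \<bar>f x y\<bar> \<le> C * rl_kernel a y"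
    and a: "0 < a" and z: "0 < z\<^sub>1" "0 < z\<^sub>2"
  shows laplace_laplace_swap: "laplace (\<lambda>x. laplace (f x) z\<^sub>2) z\<^sub>1 = laplace (\<lambda>y. laplace (\<lambda>x. f x y) z\<^sub>1) z\<^sub>2"
    and laplace_integrable_laplace: "laplace_integrable (\<lambda>x. laplace (f x) z\<^sub>2) z\<^sub>1"
      "laplace_integrable (\<lambda>y. laplace (\<lambda>x. f x y) z\<^sub>1) z\<^sub>2"
proof -
  define h where "h x y = indicator {0<..} x * (exp (- z\<^sub>1 * x) * (indicator {0<..} y * (exp (- z\<^sub>2 * y) * f x y)))" for x y
  have h: "(\<lambda>(x, y). h x y) = (\<lambda>p. exp (- z\<^sub>1 * fst p) * (exp (- z\<^sub>2 * snd p) * (case p of (x, y) \<Rightarrow> indicator {0<..} x * (indicator {0<..} y * f x y))))"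
    by (auto simp: h_def fun_eq_iff)
  have hm [measurable]: "(\<lambda>(x, y). h x y) \<in> borel_measurable (lborel \<Otimes>\<^sub>M lborel)"
    unfolding h using m by (simp add: measurable_cong_sets[OF sets_pair_measure_cong[OF sets_lborel sets_lborel] refl])
  define g\<^sub>1 where "g\<^sub>1 x = indicator {0<..} x * (exp (- z\<^sub>1 * x) * 1)" for x :: real
  define g\<^sub>2 where "g\<^sub>2 y = indicator {0<..} y * (exp (- z\<^sub>2 * y) * rl_kernel a y)" for y :: real
  have g1: "integrable lborel g\<^sub>1"
    using laplace_integrable_const[OF z(1), of 1] unfolding laplace_integrable_def g\<^sub>1_def .
  have g2: "integrable lborel g\<^sub>2"
    using laplace_integrable_rl_kernel[OF a z(2)] unfolding laplace_integrable_def g\<^sub>2_def .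
  have h_le: "\<bar>h x y\<bar> \<le> g\<^sub>1 x * (C * g\<^sub>2 y)" for x y
  proof (cases "0 < x \<and> 0 < y")
    case True
    have "exp (- z\<^sub>1 * x) * (exp (- z\<^sub>2 * y) * \<bar>f x y\<bar>) \<le> exp (- z\<^sub>1 * x) * (exp (- z\<^sub>2 * y) * (C * rl_kernel a y))"
      using bound True by (intro mult_left_mono) auto
    then show ?thesis using True by (simp add: h_def g\<^sub>1_def g\<^sub>2_def abs_mult mult_ac)
  qed (auto simp: h_def g\<^sub>1_def g\<^sub>2_def)
  have gg: "integrable (lborel \<Otimes>\<^sub>M lborel) (\<lambda>(x, y). g\<^sub>1 x * (C * g\<^sub>2 y))"
  proof (rule lborel_pair.Fubini_integrable)
    have [measurable]: "g\<^sub>1 \<in> borel_measurable borel" "g\<^sub>2 \<in> borel_measurable borel"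
      using g1 g2 by auto
    show "(\<lambda>(x, y). g\<^sub>1 x * (C * g\<^sub>2 y)) \<in> borel_measurable (lborel \<Otimes>\<^sub>M lborel)"
      by measurable
    show "integrable lborel (\<lambda>x. LINT y|lborel. norm (case (x, y) of (x, y) \<Rightarrow> g\<^sub>1 x * (C * g\<^sub>2 y)))"
      using g1 by (simp add: abs_mult)
    show "AE x in lborel. integrable lborel (\<lambda>y. case (x, y) of (x, y) \<Rightarrow> g\<^sub>1 x * (C * g\<^sub>2 y))"
      using g2 by simp
  qed
  have int: "integrable (lborel \<Otimes>\<^sub>M lborel) (\<lambda>(x, y). h x y)"
  proof (rule Bochner_Integration.integrable_bound[OF gg hm])
    have "\<bar>h x y\<bar> \<le> \<bar>g\<^sub>1 x * (C * g\<^sub>2 y)\<bar>" for x y using h_le[of x y] by linarith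
    then show "AE p in lborel \<Otimes>\<^sub>M lborel. norm (case p of (x, y) \<Rightarrow> h x y) \<le> norm (case p of (x, y) \<Rightarrow> g\<^sub>1 x * (C * g\<^sub>2 y))"
      by (intro AE_I2) (simp add: case_prod_beta)
  qed
  have 1: "(LINT y|lborel. h x y) = indicator {0<..} x * (exp (- z\<^sub>1 * x) * laplace (f x) z\<^sub>2)" for x
    by (simp add: h_def laplace_def)
  have 2: "(LINT x|lborel. h x y) = indicator {0<..} y * (exp (- z\<^sub>2 * y) * laplace (\<lambda>x. f x y) z\<^sub>1)" for y
  proof -
    have "h x y = indicator {0<..} y * (exp (- z\<^sub>2 * y) * (indicator {0<..} x * (exp (- z\<^sub>1 * x) * f x y)))" for x
      by (simp add: h_def)
    then show ?thesis by (simp add: laplace_def)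
  qed
  show "laplace (\<lambda>x. laplace (f x) z\<^sub>2) z\<^sub>1 = laplace (\<lambda>y. laplace (\<lambda>x. f x y) z\<^sub>1) z\<^sub>2"
    using lborel_pair.Fubini_integral[OF int] unfolding 1 2 by (simp add: laplace_def)
  show "laplace_integrable (\<lambda>x. laplace (f x) z\<^sub>2) z\<^sub>1"
    using lborel_pair.integrable_fst[OF int] unfolding 1 laplace_integrable_def .
  show "laplace_integrable (\<lambda>y. laplace (\<lambda>x. f x y) z\<^sub>1) z\<^sub>2"
    using lborel_pair.integrable_snd[OF int] unfolding 2 laplace_integrable_def .
qed

section \<open>Integral equations for the one-point law of the field\<close>

locale fractional_poisson_field = prob_space M for M :: "'b measure" +
  fixes r \<alpha>\<^sub>1 \<alpha>\<^sub>2 :: real and X :: "real \<Rightarrow> real \<Rightarrow> 'b \<Rightarrow> nat"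
  assumes r: "0 < r" and \<alpha>\<^sub>1: "0 < \<alpha>\<^sub>1" "\<alpha>\<^sub>1 \<le> 1" and \<alpha>\<^sub>2: "0 < \<alpha>\<^sub>2" "\<alpha>\<^sub>2 \<le> 1"
    and field: "time_fractional_poisson_field r \<alpha>\<^sub>1 \<alpha>\<^sub>2 M X"
begin

definition p :: "nat \<Rightarrow> real \<Rightarrow> real \<Rightarrow> real" where
  "p n t\<^sub>1 t\<^sub>2 = prob {\<omega> \<in> space M. X t\<^sub>1 t\<^sub>2 \<omega> = n}"

definition D :: "nat \<Rightarrow> real \<Rightarrow> real \<Rightarrow> real" where
  "D n t\<^sub>1 t\<^sub>2 = caputo \<alpha>\<^sub>1 (\<lambda>s. p n s t\<^sub>2) t\<^sub>1"

definition Q :: "nat \<Rightarrow> real \<Rightarrow> real \<Rightarrow> real" where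
  "Q n t\<^sub>1 t\<^sub>2 = r * ((real n + 1) * p (n + 1) t\<^sub>1 t\<^sub>2 - (2 * real n + 1) * p n t\<^sub>1 t\<^sub>2 + real n * p (n - 1) t\<^sub>1 t\<^sub>2)"

lemma measurable_X: "0 \<le> t\<^sub>1 \<Longrightarrow> 0 \<le> t\<^sub>2 \<Longrightarrow> X t\<^sub>1 t\<^sub>2 \<in> M \<rightarrow>\<^sub>M count_space UNIV"
  using field by (simp add: time_fractional_poisson_field_def)

lemma
  assumes "0 < t\<^sub>1" "0 < t\<^sub>2"
  shows caputo_differentiable_p: "caputo_differentiable \<alpha>\<^sub>1 (\<lambda>s. p n s t\<^sub>2) t\<^sub>1"
    and caputo_differentiable_D: "caputo_differentiable \<alpha>\<^sub>2 (D n t\<^sub>1) t\<^sub>2"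
    and caputo_D: "caputo \<alpha>\<^sub>2 (D n t\<^sub>1) t\<^sub>2 = Q n t\<^sub>1 t\<^sub>2"
proof -
  have *: "\<forall>n. \<forall>t\<^sub>1>0. \<forall>t\<^sub>2>0. caputo_differentiable \<alpha>\<^sub>1 (\<lambda>s. p n s t\<^sub>2) t\<^sub>1 \<and>
      caputo_differentiable \<alpha>\<^sub>2 (\<lambda>s. D n t\<^sub>1 s) t\<^sub>2 \<and>
      caputo \<alpha>\<^sub>2 (\<lambda>s. D n t\<^sub>1 s) t\<^sub>2 =
        (real n + 1) * r * p (n + 1) t\<^sub>1 t\<^sub>2 - (2 * real n + 1) * r * p n t\<^sub>1 t\<^sub>2 + real n * r * p (n - 1) t\<^sub>1 t\<^sub>2"
    using field unfolding time_fractional_poisson_field_def Let_def p_def[symmetric] D_def[symmetric] by blast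
  show "caputo_differentiable \<alpha>\<^sub>1 (\<lambda>s. p n s t\<^sub>2) t\<^sub>1" "caputo_differentiable \<alpha>\<^sub>2 (D n t\<^sub>1) t\<^sub>2"
    using * assms by blast+
  have "caputo \<alpha>\<^sub>2 (D n t\<^sub>1) t\<^sub>2 =
        (real n + 1) * r * p (n + 1) t\<^sub>1 t\<^sub>2 - (2 * real n + 1) * r * p n t\<^sub>1 t\<^sub>2 + real n * r * p (n - 1) t\<^sub>1 t\<^sub>2"
    using * assms by blast
  then show "caputo \<alpha>\<^sub>2 (D n t\<^sub>1) t\<^sub>2 = Q n t\<^sub>1 t\<^sub>2"
    by (simp add: Q_def algebra_simps)
qed

lemma p_bounds: "0 \<le> p n t\<^sub>1 t\<^sub>2" "\<bar>p n t\<^sub>1 t\<^sub>2\<bar> \<le> 1"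
  by (simp_all add: p_def)

lemma p_axes:
  assumes "0 \<le> t\<^sub>1" "0 \<le> t\<^sub>2" "t\<^sub>1 = 0 \<or> t\<^sub>2 = 0"
  shows "p n t\<^sub>1 t\<^sub>2 = of_bool (n = 0)"
proof -
  note [measurable] = measurable_X[OF assms(1,2)]
  have p0: "p 0 t\<^sub>1 t\<^sub>2 = 1"
    using field assms by (auto simp: time_fractional_poisson_field_def p_def)
  show ?thesis
  proof (cases "n = 0")
    case False
    have "p 0 t\<^sub>1 t\<^sub>2 + p n t\<^sub>1 t\<^sub>2 = prob ({\<omega> \<in> space M. X t\<^sub>1 t\<^sub>2 \<omega> = 0} \<union> {\<omega> \<in> space M. X t\<^sub>1 t\<^sub>2 \<omega> = n})"
      unfolding p_def using False by (intro finite_measure_Union[symmetric]) auto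
    also have "\<dots> \<le> 1" by simp
    finally show ?thesis using p0 p_bounds(1)[of n t\<^sub>1 t\<^sub>2] False by simp
  qed (use p0 in simp)
qed

lemma p_tendsto_0:
  assumes "0 \<le> t\<^sub>1" "0 \<le> t\<^sub>2"
  shows "(\<lambda>n. p n t\<^sub>1 t\<^sub>2) \<longlonglongrightarrow> 0"
proof -
  note [measurable] = measurable_X[OF assms]
  have "(\<lambda>n. p n t\<^sub>1 t\<^sub>2) sums prob (\<Union>n. {\<omega> \<in> space M. X t\<^sub>1 t\<^sub>2 \<omega> = n})"
    unfolding p_def by (rule finite_measure_UNION) (auto simp: disjoint_family_on_def)
  then show ?thesis by (intro summable_LIMSEQ_zero) (rule sums_summable)
qed

lemma continuous_on_p: "0 < t\<^sub>2 \<Longrightarrow> continuous_on {0<..} (\<lambda>s. p n s t\<^sub>2)"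
proof (rule continuous_at_imp_continuous_on, rule ballI)
  fix t :: real assume t: "t \<in> {0<..}" and t2: "0 < t\<^sub>2"
  have "continuous_on {0..t + 1} (\<lambda>s. p n s t\<^sub>2)"
    using caputo_differentiable_p[of "t + 1" t\<^sub>2 n] t t2 by (simp add: caputo_differentiable_def Let_def)
  then have "continuous_on {0<..<t + 1} (\<lambda>s. p n s t\<^sub>2)"
    by (rule continuous_on_subset) auto
  then show "isCont (\<lambda>s. p n s t\<^sub>2) t" using t by (simp add: continuous_on_eq_continuous_at)
qed

lemma continuous_on_D: "0 < t\<^sub>1 \<Longrightarrow> continuous_on {0<..} (D n t\<^sub>1)"
proof (rule continuous_at_imp_continuous_on, rule ballI)
  fix t :: real assume t: "t \<in> {0<..}" and t1: "0 < t\<^sub>1"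
  have "continuous_on {0..t + 1} (D n t\<^sub>1)"
    using caputo_differentiable_D[of t\<^sub>1 "t + 1" n] t t1 by (simp add: caputo_differentiable_def Let_def)
  then have "continuous_on {0<..<t + 1} (D n t\<^sub>1)"
    by (rule continuous_on_subset) auto
  then show "isCont (D n t\<^sub>1) t" using t by (simp add: continuous_on_eq_continuous_at)
qed

lemma Q_bound: "\<bar>Q n t\<^sub>1 t\<^sub>2\<bar> \<le> r * (4 * real n + 2)"
proof -
  have "\<bar>(real n + 1) * p (n + 1) t\<^sub>1 t\<^sub>2 - (2 * real n + 1) * p n t\<^sub>1 t\<^sub>2 + real n * p (n - 1) t\<^sub>1 t\<^sub>2\<bar>
      \<le> \<bar>(real n + 1) * p (n + 1) t\<^sub>1 t\<^sub>2\<bar> + \<bar>(2 * real n + 1) * p n t\<^sub>1 t\<^sub>2\<bar> + \<bar>real n * p (n - 1) t\<^sub>1 t\<^sub>2\<bar>"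
    by linarith
  also have "\<dots> \<le> (real n + 1) * 1 + (2 * real n + 1) * 1 + real n * 1"
    unfolding abs_mult by (intro add_mono mult_mono p_bounds) auto
  finally show ?thesis unfolding Q_def abs_mult using r by (intro mult_mono) auto
qed

text \<open>On the axis \<open>t\<^sub>2 = 0\<close> the law does not depend on the first time, so
  its Caputo derivative is zero. This is the initial value for inverting the outer
  derivative.\<close>

lemma D_axis: "0 < t \<Longrightarrow> D n t 0 = 0"
proof -
  assume t: "0 < t"
  have d: "deriv (\<lambda>s. p n s 0) s = 0" if s: "0 < s" for s
  proof -
    have "\<forall>\<^sub>F s in nhds s. p n s 0 = of_bool (n = 0)"
    proof (rule eventually_mono)
      show "\<forall>\<^sub>F s in nhds s. s \<in> {0<..}" using s by (intro eventually_nhds_in_open) auto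
      show "p n s 0 = of_bool (n = 0)" if "s \<in> {0<..}" for s
        using that by (intro p_axes) auto
    qed
    then have "deriv (\<lambda>s. p n s 0) s = deriv (\<lambda>s. of_bool (n = 0)) s"
      by (rule deriv_cong_ev) simp
    then show ?thesis by simp
  qed
  have n: "nat \<lceil>\<alpha>\<^sub>1\<rceil> = 1" using nat_ceiling_order_le_2[of \<alpha>\<^sub>1] \<alpha>\<^sub>1 by simp
  show ?thesis
  proof (cases "\<alpha>\<^sub>1 = 1")
    case True
    then show ?thesis using d[OF t] unfolding D_def caputo_def by simp
  next
    case False
    then have "D n t 0 = rl_integral (1 - \<alpha>\<^sub>1) (deriv (\<lambda>s. p n s 0)) t"
      using caputo_eq_rl_integral[of 1 \<alpha>\<^sub>1 "\<lambda>s. p n s 0" t] n \<alpha>\<^sub>1 by (simp add: D_def)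
    also have "\<dots> = rl_integral (1 - \<alpha>\<^sub>1) (\<lambda>s. 0) t" by (rule rl_integral_cong) (rule d)
    finally show ?thesis by (simp add: rl_integral_def)
  qed
qed

lemma D_eq: 
  assumes "0 < t\<^sub>1" "0 < t\<^sub>2"
  shows "D n t\<^sub>1 t\<^sub>2 = rl_integral \<alpha>\<^sub>2 (Q n t\<^sub>1) t\<^sub>2"
proof -
  have "D n t\<^sub>1 t\<^sub>2 = D n t\<^sub>1 0 + rl_integral \<alpha>\<^sub>2 (caputo \<alpha>\<^sub>2 (D n t\<^sub>1)) t\<^sub>2"
    by (rule caputo_inversion[OF _ _ _ caputo_differentiable_D])
      (use \<alpha>\<^sub>2 assms Q_bound in \<open>auto simp: caputo_D\<close>)
  also have "rl_integral \<alpha>\<^sub>2 (caputo \<alpha>\<^sub>2 (D n t\<^sub>1)) t\<^sub>2 = rl_integral \<alpha>\<^sub>2 (Q n t\<^sub>1) t\<^sub>2"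
    by (rule rl_integral_cong) (use caputo_D assms in auto)
  finally show ?thesis using D_axis[OF assms(1)] by simp
qed

lemma D_bound:
  assumes "0 < t\<^sub>1" "0 < t\<^sub>2"
  shows "\<bar>D n t\<^sub>1 t\<^sub>2\<bar> \<le> r * (4 * real n + 2) * rl_kernel (\<alpha>\<^sub>2 + 1) t\<^sub>2"
  unfolding D_eq[OF assms] using Q_bound \<alpha>\<^sub>2 r by (intro abs_rl_integral_le) auto

text \<open>The inner inversion needs a bound on D as a function of the first time; it is
  \<open>D_bound\<close>, obtained by inverting the outer derivative beforehand. The initial value
  comes from the axis \<open>t\<^sub>1 = 0\<close>.\<close>

lemma p_eq:
  assumes "0 < t\<^sub>1" "0 < t\<^sub>2"
  shows "p n t\<^sub>1 t\<^sub>2 = of_bool (n = 0) + rl_integral \<alpha>\<^sub>1 (\<lambda>s. D n s t\<^sub>2) t\<^sub>1"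
proof -
  have "p n t\<^sub>1 t\<^sub>2 = p n 0 t\<^sub>2 + rl_integral \<alpha>\<^sub>1 (caputo \<alpha>\<^sub>1 (\<lambda>s. p n s t\<^sub>2)) t\<^sub>1"
  proof (rule caputo_inversion[OF _ _ _ caputo_differentiable_p])
    show "\<bar>caputo \<alpha>\<^sub>1 (\<lambda>s. p n s t\<^sub>2) s\<bar> \<le> r * (4 * real n + 2) * rl_kernel (\<alpha>\<^sub>2 + 1) t\<^sub>2" if "0 < s" for s
      using D_bound[OF that assms(2)] by (simp add: D_def)
  qed (use \<alpha>\<^sub>1 assms in auto)
  moreover have "caputo \<alpha>\<^sub>1 (\<lambda>s. p n s t\<^sub>2) = (\<lambda>s. D n s t\<^sub>2)" by (simp add: D_def fun_eq_iff)
  ultimately show ?thesis using assms p_axes by simp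
qed

lemma measurable_D1: "0 < t\<^sub>2 \<Longrightarrow> (\<lambda>s. indicator {0<..} s * D n s t\<^sub>2) \<in> borel_measurable borel"
  unfolding D_def using caputo_differentiable_p by (intro borel_measurable_caputo \<alpha>\<^sub>1) auto

text \<open>D is measurable in the first variable as a Caputo derivative, and continuous in the
  second because its own Caputo derivative exists there.\<close>

lemma measurable_D: "(\<lambda>(x, y). indicator {0<..} x * (indicator {0<..} y * D n x y)) \<in> borel_measurable (borel \<Otimes>\<^sub>M borel)"
  by (rule borel_measurable_caratheodory) (auto intro: measurable_D1 continuous_on_D)

text \<open>The field equation says nothing directly about regularity of p in the second time. Joint
  measurability is read off \<open>p_eq\<close>, a parameter integral of the jointly measurable
  D.\<close>

lemma measurable_p: "(\<lambda>(x, y). indicator {0<..} x * (indicator {0<..} y * p n x y)) \<in> borel_measurable (borel \<Otimes>\<^sub>M borel)"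
proof -
  define DD where "DD x y = indicator {0<..} x * (indicator {0<..} y * D n x y)" for x y
  have [measurable]: "(\<lambda>q. DD (fst q) (snd q)) \<in> borel_measurable (borel \<Otimes>\<^sub>M borel)"
    using measurable_D by (simp add: DD_def case_prod_beta)
  have eq: "indicator {0<..} x * (indicator {0<..} y * p n x y) =
      indicator {0<..} x * (indicator {0<..} y * (of_bool (n = 0) + (LINT s|lborel. rl_kernel \<alpha>\<^sub>1 (x - s) * DD s y)))" for x y
  proof (cases "0 < x \<and> 0 < y")
    case True
    then have "p n x y = of_bool (n = 0) + (LINT s|lborel. rl_kernel \<alpha>\<^sub>1 (x - s) * DD s y)"
      using p_eq[of x y n] by (simp add: rl_integral_def DD_def)
    then show ?thesis by simp
  qed auto
  have "(\<lambda>q. LINT s|lborel. rl_kernel \<alpha>\<^sub>1 (fst q - s) * DD s (snd q)) \<in> borel_measurable (borel \<Otimes>\<^sub>M borel)"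
  proof (rule lborel.borel_measurable_lebesgue_integral)
    have "(\<lambda>w. DD (snd w) (snd (fst w))) \<in> borel_measurable ((borel \<Otimes>\<^sub>M borel) \<Otimes>\<^sub>M lborel)"
      by (rule measurable_compose[where g="\<lambda>q. DD (fst q) (snd q)" and f="\<lambda>w. (snd w, snd (fst w))", simplified]) measurable
    then show "(\<lambda>(q, s). rl_kernel \<alpha>\<^sub>1 (fst q - s) * DD s (snd q)) \<in> borel_measurable ((borel \<Otimes>\<^sub>M borel) \<Otimes>\<^sub>M lborel)"
      unfolding case_prod_beta by measurable
  qed
  then show ?thesis unfolding case_prod_beta eq by measurable
qed

lemma measurable_p2:
  assumes "0 < t\<^sub>1"
  shows "(\<lambda>y. indicator {0<..} y * p n t\<^sub>1 y) \<in> borel_measurable borel"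
  using measurable_compose[OF measurable_Pair1'[of t\<^sub>1] measurable_p[of n]] assms by simp

lemma laplace_integrable_p: "0 < t\<^sub>1 \<Longrightarrow> 0 < z \<Longrightarrow> laplace_integrable (p n t\<^sub>1) z"
  by (rule laplace_integrable_bounded[OF measurable_p2 p_bounds(2)])

section \<open>Double Laplace transform of the field\<close>

context
  fixes z\<^sub>1 z\<^sub>2 :: real
  assumes z: "0 < z\<^sub>1" "0 < z\<^sub>2"
begin

definition V :: "nat \<Rightarrow> real" where
  "V n = laplace (\<lambda>t\<^sub>1. laplace (p n t\<^sub>1) z\<^sub>2) z\<^sub>1"

lemma p_bound_kernel: "0 < t\<^sub>2 \<Longrightarrow> \<bar>p n t\<^sub>1 t\<^sub>2\<bar> \<le> 1 * rl_kernel 1 t\<^sub>2"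
  using p_bounds(2) by (simp add: rl_kernel_def)

lemmas p_swap = laplace_laplace_swap[OF measurable_p p_bound_kernel zero_less_one z]
  laplace_integrable_laplace[OF measurable_p p_bound_kernel zero_less_one z]

lemma D_swap:
  "laplace (\<lambda>x. laplace (D n x) z\<^sub>2) z\<^sub>1 = laplace (\<lambda>y. laplace (\<lambda>x. D n x y) z\<^sub>1) z\<^sub>2"
  "laplace_integrable (\<lambda>y. laplace (\<lambda>x. D n x y) z\<^sub>1) z\<^sub>2"
  by (rule laplace_laplace_swap[OF measurable_D D_bound _ z] laplace_integrable_laplace(2)[OF measurable_D D_bound _ z];
      use \<alpha>\<^sub>2 in simp)+

lemma laplace_D: 
  assumes t\<^sub>1: "0 < t\<^sub>1"
  shows "laplace (D n t\<^sub>1) z\<^sub>2 = z\<^sub>2 powr - \<alpha>\<^sub>2 * (r * ((real n + 1) * laplace (p (n + 1) t\<^sub>1) z\<^sub>2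
    - (2 * real n + 1) * laplace (p n t\<^sub>1) z\<^sub>2 + real n * laplace (p (n - 1) t\<^sub>1) z\<^sub>2))"
proof -
  note i = laplace_integrable_p[OF t\<^sub>1 z(2)]
  have Q: "laplace_integrable (Q n t\<^sub>1) z\<^sub>2"
    unfolding Q_def[abs_def]
    by (intro laplace_integrable_cmult laplace_integrable_add laplace_integrable_diff i)
  have "laplace (D n t\<^sub>1) z\<^sub>2 = laplace (rl_integral \<alpha>\<^sub>2 (Q n t\<^sub>1)) z\<^sub>2"
    by (rule laplace_cong) (rule D_eq[OF t\<^sub>1])
  also have "\<dots> = z\<^sub>2 powr - \<alpha>\<^sub>2 * laplace (Q n t\<^sub>1) z\<^sub>2"
    by (rule laplace_rl_integral[OF \<alpha>\<^sub>2(1) z(2) Q])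
  also have "laplace (Q n t\<^sub>1) z\<^sub>2 = r * laplace (\<lambda>t\<^sub>2. (real n + 1) * p (n + 1) t\<^sub>1 t\<^sub>2
      - (2 * real n + 1) * p n t\<^sub>1 t\<^sub>2 + real n * p (n - 1) t\<^sub>1 t\<^sub>2) z\<^sub>2"
    unfolding Q_def[abs_def] by (rule laplace_cmult)
  finally show ?thesis
    by (simp only: laplace_cmult laplace_add laplace_diff i laplace_integrable_cmult laplace_integrable_diff)
qed

text \<open>\<open>p_eq\<close> is transformed in the first variable and \<open>D_eq\<close> in the
  second; in between, the order of the two transforms of D is exchanged.\<close>

lemma V_recursion: "V n = of_bool (n = 0) / (z\<^sub>1 * z\<^sub>2) + z\<^sub>1 powr - \<alpha>\<^sub>1 * (z\<^sub>2 powr - \<alpha>\<^sub>2 *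
    (r * ((real n + 1) * V (n + 1) - (2 * real n + 1) * V n + real n * V (n - 1))))"
proof -
  have "laplace (\<lambda>x. p n x y) z\<^sub>1 = of_bool (n = 0) / z\<^sub>1 + z\<^sub>1 powr - \<alpha>\<^sub>1 * laplace (\<lambda>x. D n x y) z\<^sub>1" if y: "0 < y" for y
  proof -
    have i: "laplace_integrable (\<lambda>x. D n x y) z\<^sub>1"
      by (rule laplace_integrable_bounded[OF measurable_D1[OF y] D_bound[OF _ y] z(1)])
    have "laplace (\<lambda>x. p n x y) z\<^sub>1 = laplace (\<lambda>x. of_bool (n = 0) + rl_integral \<alpha>\<^sub>1 (\<lambda>s. D n s y) x) z\<^sub>1"
      by (rule laplace_cong) (rule p_eq[OF _ y])
    also have "\<dots> = of_bool (n = 0) / z\<^sub>1 + z\<^sub>1 powr - \<alpha>\<^sub>1 * laplace (\<lambda>x. D n x y) z\<^sub>1"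
      using laplace_add[OF laplace_integrable_const[OF z(1)] laplace_integrable_rl_integral[OF \<alpha>\<^sub>1(1) z(1) i]]
      by (simp add: laplace_const[OF z(1)] laplace_rl_integral[OF \<alpha>\<^sub>1(1) z(1) i])
    finally show ?thesis .
  qed
  then have "laplace (\<lambda>y. laplace (\<lambda>x. p n x y) z\<^sub>1) z\<^sub>2
      = laplace (\<lambda>y. of_bool (n = 0) / z\<^sub>1 + z\<^sub>1 powr - \<alpha>\<^sub>1 * laplace (\<lambda>x. D n x y) z\<^sub>1) z\<^sub>2"
    by (rule laplace_cong)
  also have "\<dots> = of_bool (n = 0) / z\<^sub>1 / z\<^sub>2 + z\<^sub>1 powr - \<alpha>\<^sub>1 * laplace (\<lambda>y. laplace (\<lambda>x. D n x y) z\<^sub>1) z\<^sub>2"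
    using laplace_add[OF laplace_integrable_const[OF z(2)] laplace_integrable_cmult[OF D_swap(2)]]
    by (simp only: laplace_const[OF z(2)] laplace_cmult)
  also have "laplace (\<lambda>y. laplace (\<lambda>x. D n x y) z\<^sub>1) z\<^sub>2 = laplace (\<lambda>x. laplace (D n x) z\<^sub>2) z\<^sub>1"
    by (rule D_swap(1)[symmetric])
  also have "\<dots> = laplace (\<lambda>t\<^sub>1. z\<^sub>2 powr - \<alpha>\<^sub>2 * (r * ((real n + 1) * laplace (p (n + 1) t\<^sub>1) z\<^sub>2
      - (2 * real n + 1) * laplace (p n t\<^sub>1) z\<^sub>2 + real n * laplace (p (n - 1) t\<^sub>1) z\<^sub>2))) z\<^sub>1"
    by (rule laplace_cong) (rule laplace_D)
  also have "\<dots> = z\<^sub>2 powr - \<alpha>\<^sub>2 * (r * ((real n + 1) * V (n + 1) - (2 * real n + 1) * V n + real n * V (n - 1)))"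
    by (simp only: laplace_cmult laplace_add laplace_diff p_swap(2) laplace_integrable_cmult laplace_integrable_diff V_def)
  finally have "laplace (\<lambda>y. laplace (\<lambda>x. p n x y) z\<^sub>1) z\<^sub>2 = of_bool (n = 0) / (z\<^sub>1 * z\<^sub>2) + z\<^sub>1 powr - \<alpha>\<^sub>1 *
      (z\<^sub>2 powr - \<alpha>\<^sub>2 * (r * ((real n + 1) * V (n + 1) - (2 * real n + 1) * V n + real n * V (n - 1))))"
    by (simp only: divide_divide_eq_left)
  moreover have "V n = laplace (\<lambda>y. laplace (\<lambda>x. p n x y) z\<^sub>1) z\<^sub>2"
    unfolding V_def by (rule p_swap(1))
  ultimately show ?thesis by (rule trans[rotated])
qed

text \<open>At each point the probabilities are summable in n, hence tend to 0; dominated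
  convergence, once in each variable, passes this on to the double transform.\<close>

lemma V_tendsto_0: "V \<longlonglongrightarrow> 0"
proof -
  have lim: "(\<lambda>n. laplace (p n t\<^sub>1) z\<^sub>2) \<longlonglongrightarrow> laplace (\<lambda>_. 0) z\<^sub>2" if t\<^sub>1: "0 < t\<^sub>1" for t\<^sub>1
    by (rule laplace_tendsto[OF z(2) measurable_p2[OF t\<^sub>1] p_bounds(2)]) (use t\<^sub>1 in \<open>auto intro: p_tendsto_0\<close>)
  have "V \<longlonglongrightarrow> laplace (\<lambda>_. laplace (\<lambda>_. 0) z\<^sub>2) z\<^sub>1"
    unfolding V_def[abs_def]
  proof (rule laplace_tendsto[OF z(1) _ _ lim])
    show "\<bar>laplace (p n t) z\<^sub>2\<bar> \<le> 1 / z\<^sub>2" for n t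
      by (rule abs_laplace_le[OF z(2) p_bounds(2)])
    show "(\<lambda>t. indicator {0<..} t * laplace (p n t) z\<^sub>2) \<in> borel_measurable borel" for n
    proof -
      have "(\<lambda>t. indicator {0<..} t * (exp (- z\<^sub>1 * t) * laplace (p n t) z\<^sub>2)) \<in> borel_measurable borel"
        using p_swap(2)[of n] by (auto simp: laplace_integrable_def)
      \<comment> \<open>Integrability provides measurability of the weighted transform; multiplying
        by the inverse exponential removes the weight.\<close>
      then have "(\<lambda>t. exp (z\<^sub>1 * t) * (indicator {0<..} t * (exp (- z\<^sub>1 * t) * laplace (p n t) z\<^sub>2))) \<in> borel_measurable borel"
        by measurable
      also have "(\<lambda>t. exp (z\<^sub>1 * t) * (indicator {0<..} t * (exp (- z\<^sub>1 * t) * laplace (p n t) z\<^sub>2))) = (\<lambda>t. indicator {0<..} t * laplace (p n t) z\<^sub>2)"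
        by (simp add: fun_eq_iff exp_minus)
      finally show ?thesis .
    qed
  qed
  then show ?thesis by (simp add: laplace_const z)
qed

text \<open>After multiplication by \<open>z\<^sub>1 * z\<^sub>2\<close>, the recursion for V is
  that of the Poisson mixture with rates \<open>z\<^sub>1 powr \<alpha>\<^sub>1\<close> and
  \<open>z\<^sub>2 powr \<alpha>\<^sub>2\<close>, and both sequences tend to 0.\<close>

lemma V_eq_poisson_mixture:
  "z\<^sub>1 * z\<^sub>2 * V n = z\<^sub>1 powr \<alpha>\<^sub>1 * laplace (\<lambda>x. geometric_weight (z\<^sub>2 powr \<alpha>\<^sub>2) n (r * x)) (z\<^sub>1 powr \<alpha>\<^sub>1)"
proof -
  \<comment> \<open>\<mu> is the reciprocal of the factor in front of the three-term combination in
    \<open>V_recursion\<close>, and the coefficient in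
    \<open>poisson_mixture_recursion\<close>.\<close>
  define \<mu> where "\<mu> = z\<^sub>1 powr \<alpha>\<^sub>1 * z\<^sub>2 powr \<alpha>\<^sub>2 / r"
  have b: "0 < z\<^sub>1 powr \<alpha>\<^sub>1" "0 < z\<^sub>2 powr \<alpha>\<^sub>2" and \<mu>: "0 < \<mu>" using z r by (auto simp: \<mu>_def)
  note mix = poisson_mixture_recursion[OF r b]
  show ?thesis
  proof (rule birth_death_resolvent_unique[OF \<mu>, where c="\<lambda>n. \<mu> * of_bool (n = 0)"
        and v="\<lambda>n. z\<^sub>1 * z\<^sub>2 * V n"
        and w="\<lambda>n. z\<^sub>1 powr \<alpha>\<^sub>1 * laplace (\<lambda>x. geometric_weight (z\<^sub>2 powr \<alpha>\<^sub>2) n (r * x)) (z\<^sub>1 powr \<alpha>\<^sub>1)"])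
    fix n
    define S where "S = (real n + 1) * V (n + 1) - (2 * real n + 1) * V n + real n * V (n - 1)"
    have "V n - of_bool (n = 0) / (z\<^sub>1 * z\<^sub>2) = S / \<mu>"
      using V_recursion[of n] unfolding S_def[symmetric]
      by (simp add: \<mu>_def powr_minus divide_simps)
    then have "\<mu> * V n - \<mu> * of_bool (n = 0) / (z\<^sub>1 * z\<^sub>2) = S"
      using \<mu> by (simp add: field_simps)
    then have "z\<^sub>1 * z\<^sub>2 * (\<mu> * V n - \<mu> * of_bool (n = 0) / (z\<^sub>1 * z\<^sub>2)) = z\<^sub>1 * z\<^sub>2 * S" by simp
    then have "\<mu> * (z\<^sub>1 * z\<^sub>2 * V n) - \<mu> * of_bool (n = 0) = z\<^sub>1 * z\<^sub>2 * S"
      using z by (simp add: right_diff_distrib mult_ac)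
    then show "\<mu> * (z\<^sub>1 * z\<^sub>2 * V n) - \<mu> * of_bool (n = 0) = (real n + 1) * (z\<^sub>1 * z\<^sub>2 * V (n + 1))
        - (2 * real n + 1) * (z\<^sub>1 * z\<^sub>2 * V n) + real n * (z\<^sub>1 * z\<^sub>2 * V (n - 1))"
      by (simp add: S_def algebra_simps)
  next
    show "(\<lambda>n. z\<^sub>1 * z\<^sub>2 * V n) \<longlonglongrightarrow> 0" using tendsto_mult_right_zero[OF V_tendsto_0] by simp
  qed (use mix in \<open>simp_all add: \<mu>_def\<close>)
qed

end

text \<open>Dominated convergence in \<open>p_eq\<close>: D is continuous in the second time, and
  \<open>D_bound\<close> is locally bounded in it and independent of the first time.\<close>

lemma continuous_on_p2:
  assumes t\<^sub>1: "0 < t\<^sub>1"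
  shows "continuous_on {0<..} (p n t\<^sub>1)"
  unfolding continuous_on_sequentially comp_def
proof (intro allI impI ballI)
  fix u :: "nat \<Rightarrow> real" and t assume t: "t \<in> {0<..}" and u: "(\<forall>k. u k \<in> {0<..}) \<and> u \<longlonglongrightarrow> t"
  have "0 < Gamma (\<alpha>\<^sub>2 + 1)" by (rule Gamma_real_pos) (use \<alpha>\<^sub>2 in simp)
  then have "Gamma (\<alpha>\<^sub>2 + 1) \<noteq> 0" by linarith
  then have "(\<lambda>k. rl_kernel (\<alpha>\<^sub>2 + 1) (u k)) \<longlonglongrightarrow> t powr \<alpha>\<^sub>2 / Gamma (\<alpha>\<^sub>2 + 1)"
    using t u \<alpha>\<^sub>2 by (auto simp: rl_kernel_def intro!: tendsto_intros)
  \<comment> \<open>A convergent sequence of kernel values is bounded, which makes the majorant of D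
    uniform in k.\<close>
  then have "Bseq (\<lambda>k. rl_kernel (\<alpha>\<^sub>2 + 1) (u k))" by (rule convergentI[THEN convergent_imp_Bseq])
  then obtain K where K: "\<And>k. \<bar>rl_kernel (\<alpha>\<^sub>2 + 1) (u k)\<bar> \<le> K" by (auto simp: Bseq_def)
  define B where "B = r * (4 * real n + 2) * K"
  have B: "\<bar>D n s (u k)\<bar> \<le> B" if "0 < s" for s k
  proof -
    have "r * (4 * real n + 2) * rl_kernel (\<alpha>\<^sub>2 + 1) (u k) \<le> B"
      unfolding B_def using K[of k] r by (intro mult_left_mono) auto
    then show ?thesis using D_bound[OF that, of "u k" n] u by force
  qed
  have "(\<lambda>k. rl_integral \<alpha>\<^sub>1 (\<lambda>s. D n s (u k)) t\<^sub>1) \<longlonglongrightarrow> rl_integral \<alpha>\<^sub>1 (\<lambda>s. D n s t) t\<^sub>1"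
    unfolding rl_integral_def
  proof (rule integral_dominated_convergence[where w="\<lambda>s. B * (rl_kernel \<alpha>\<^sub>1 (t\<^sub>1 - s) * rl_kernel 1 s)"])
    show "(\<lambda>s. rl_kernel \<alpha>\<^sub>1 (t\<^sub>1 - s) * (indicator {0<..} s * D n s (u k))) \<in> borel_measurable lborel" for k
    proof -
      have [measurable]: "(\<lambda>s. indicator {0<..} s * D n s (u k)) \<in> borel_measurable borel"
        using u by (intro measurable_D1) auto
      show ?thesis by measurable
    qed
    show "(\<lambda>s. rl_kernel \<alpha>\<^sub>1 (t\<^sub>1 - s) * (indicator {0<..} s * D n s t)) \<in> borel_measurable lborel"
    proof -
      have [measurable]: "(\<lambda>s. indicator {0<..} s * D n s t) \<in> borel_measurable borel"
        using t by (intro measurable_D1) auto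
      show ?thesis by measurable
    qed
    show "integrable lborel (\<lambda>s. B * (rl_kernel \<alpha>\<^sub>1 (t\<^sub>1 - s) * rl_kernel 1 s))"
      using has_bochner_integral_rl_kernel_conv[OF \<alpha>\<^sub>1(1) zero_less_one, of t\<^sub>1]
      by (simp add: has_bochner_integral_iff)
    show "AE s in lborel. (\<lambda>k. rl_kernel \<alpha>\<^sub>1 (t\<^sub>1 - s) * (indicator {0<..} s * D n s (u k))) \<longlonglongrightarrow> rl_kernel \<alpha>\<^sub>1 (t\<^sub>1 - s) * (indicator {0<..} s * D n s t)"
    proof (rule AE_I2)
      fix s :: real
      show "(\<lambda>k. rl_kernel \<alpha>\<^sub>1 (t\<^sub>1 - s) * (indicator {0<..} s * D n s (u k))) \<longlonglongrightarrow> rl_kernel \<alpha>\<^sub>1 (t\<^sub>1 - s) * (indicator {0<..} s * D n s t)"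
      proof (cases "0 < s")
        case True
        then have "(\<lambda>k. D n s (u k)) \<longlonglongrightarrow> D n s t"
          using continuous_on_D[OF True] t u unfolding continuous_on_sequentially comp_def by blast
        then show ?thesis by (intro tendsto_mult tendsto_const)
      qed simp
    qed
    show "AE s in lborel. norm (rl_kernel \<alpha>\<^sub>1 (t\<^sub>1 - s) * (indicator {0<..} s * D n s (u k))) \<le> B * (rl_kernel \<alpha>\<^sub>1 (t\<^sub>1 - s) * rl_kernel 1 s)" for k
    proof (rule AE_I2)
      fix s :: real
      show "norm (rl_kernel \<alpha>\<^sub>1 (t\<^sub>1 - s) * (indicator {0<..} s * D n s (u k))) \<le> B * (rl_kernel \<alpha>\<^sub>1 (t\<^sub>1 - s) * rl_kernel 1 s)"
      proof (cases "0 < s")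
        case True
        have "rl_kernel \<alpha>\<^sub>1 (t\<^sub>1 - s) * \<bar>D n s (u k)\<bar> \<le> rl_kernel \<alpha>\<^sub>1 (t\<^sub>1 - s) * B"
          using B[OF True] rl_kernel_nonneg[OF \<alpha>\<^sub>1(1)] by (intro mult_left_mono)
        then show ?thesis using True rl_kernel_nonneg[OF \<alpha>\<^sub>1(1), of "t\<^sub>1 - s"]
          by (simp add: abs_mult rl_kernel_def[of 1] mult.commute)
      qed (simp add: rl_kernel_def[of 1])
    qed
  qed
  then have "(\<lambda>k. of_bool (n = 0) + rl_integral \<alpha>\<^sub>1 (\<lambda>s. D n s (u k)) t\<^sub>1) \<longlonglongrightarrow> of_bool (n = 0) + rl_integral \<alpha>\<^sub>1 (\<lambda>s. D n s t) t\<^sub>1"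
    by (intro tendsto_add tendsto_const)
  then show "(\<lambda>k. p n t\<^sub>1 (u k)) \<longlonglongrightarrow> p n t\<^sub>1 t" using p_eq[OF t\<^sub>1] t u by simp
qed

lemma continuous_on_laplace_p:
  assumes z: "0 < z"
  shows "continuous_on {0<..} (\<lambda>t\<^sub>1. laplace (p n t\<^sub>1) z)"
  unfolding continuous_on_sequentially comp_def
proof (intro allI impI ballI)
  fix u :: "nat \<Rightarrow> real" and t assume t: "t \<in> {0<..}" and u: "(\<forall>k. u k \<in> {0<..}) \<and> u \<longlonglongrightarrow> t"
  show "(\<lambda>k. laplace (p n (u k)) z) \<longlonglongrightarrow> laplace (p n t) z"
  proof (rule laplace_tendsto[OF z _ p_bounds(2)])
    show "(\<lambda>s. indicator {0<..} s * p n (u k) s) \<in> borel_measurable borel" for k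
      using u by (intro measurable_p2) auto
    show "(\<lambda>k. p n (u k) s) \<longlonglongrightarrow> p n t s" if "0 < s" for s
      using continuous_on_p[OF that, of n] t u unfolding continuous_on_sequentially comp_def by blast
  qed
qed

text \<open>Uniqueness of Laplace transforms is applied twice: for fixed \<open>z\<^sub>2\<close> to
  functions of the first time, then for each fixed first time to functions of the second. Each stage
  compares bounded functions that are continuous on (0, \<infinity>), so both times are
  positive.\<close>

theorem p_eq_mixture:
  assumes "two_folded_processes M' \<alpha>\<^sub>1 \<alpha>\<^sub>2 T\<^sub>1 T\<^sub>2 r" and t: "0 < t\<^sub>1" "0 < t\<^sub>2"
  shows "p n t\<^sub>1 t\<^sub>2 = two_folded_processes.mixture M' T\<^sub>1 T\<^sub>2 r n t\<^sub>1 t\<^sub>2"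
proof -
  interpret two_folded_processes M' \<alpha>\<^sub>1 \<alpha>\<^sub>2 T\<^sub>1 T\<^sub>2 r by fact
  have mix_int: "laplace_integrable (mixture n t\<^sub>1) z" if "0 < t\<^sub>1" "0 < z" for t\<^sub>1 z
    by (rule laplace_integrable_bounded[OF borel_measurable_continuous_on_greaterThan[OF continuous_on_mixture], of _ _ 1])
      (use that mixture_bound in auto)
  have L: "laplace (p n t\<^sub>1) z\<^sub>2 = laplace (mixture n t\<^sub>1) z\<^sub>2" if t\<^sub>1: "0 < t\<^sub>1" and z\<^sub>2: "0 < z\<^sub>2" for t\<^sub>1 z\<^sub>2
  proof -
    define g where "g s = laplace (p n s) z\<^sub>2 - laplace (mixture n s) z\<^sub>2" for s
    have mix_le: "\<bar>laplace (mixture n s) z\<^sub>2\<bar> \<le> 1 / z\<^sub>2" if "0 < s" for s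
      by (rule abs_laplace_le[OF z\<^sub>2]) (use that mixture_bound in auto)
    have p_le: "\<bar>laplace (p n s) z\<^sub>2\<bar> \<le> 1 / z\<^sub>2" for s
      by (rule abs_laplace_le[OF z\<^sub>2 p_bounds(2)])
    have "g t\<^sub>1 = 0"
    proof (rule laplace_eq_0_imp_eq_0[OF _ _ _ t\<^sub>1])
      show "continuous_on {0<..} g"
        unfolding g_def by (intro continuous_on_diff continuous_on_laplace_p continuous_on_laplace_mixture z\<^sub>2)
      show "\<bar>g s\<bar> \<le> 2 / z\<^sub>2" if "0 < s" for s
        using mix_le[OF that] p_le[of s] unfolding g_def by linarith
      show "laplace g z\<^sub>1 = 0" if z\<^sub>1: "0 < z\<^sub>1" for z\<^sub>1
      proof -
        have "z\<^sub>1 * (z\<^sub>2 * laplace (\<lambda>t. laplace (p n t) z\<^sub>2) z\<^sub>1) = z\<^sub>1 * (z\<^sub>2 * laplace (\<lambda>t. laplace (mixture n t) z\<^sub>2) z\<^sub>1)"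
          using V_eq_poisson_mixture[OF z\<^sub>1 z\<^sub>2, of n] laplace_laplace_mixture[OF z\<^sub>2 z\<^sub>1, of n]
          unfolding V_def[OF z\<^sub>1 z\<^sub>2] laplace_cmult by simp
        then have "laplace (\<lambda>t. laplace (p n t) z\<^sub>2) z\<^sub>1 = laplace (\<lambda>t. laplace (mixture n t) z\<^sub>2) z\<^sub>1"
          using z\<^sub>1 z\<^sub>2 by simp
        moreover have "laplace_integrable (\<lambda>t. laplace (p n t) z\<^sub>2) z\<^sub>1"
          using p_le by (intro laplace_integrable_bounded[OF borel_measurable_continuous_on_greaterThan[OF continuous_on_laplace_p[OF z\<^sub>2]] _ z\<^sub>1])
        moreover have "laplace_integrable (\<lambda>t. laplace (mixture n t) z\<^sub>2) z\<^sub>1"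
          using mix_le by (intro laplace_integrable_bounded[OF borel_measurable_continuous_on_greaterThan[OF continuous_on_laplace_mixture[OF z\<^sub>2]] _ z\<^sub>1])
        ultimately show ?thesis unfolding g_def by (simp add: laplace_diff)
      qed
    qed
    then show ?thesis by (simp add: g_def)
  qed
  have "p n t\<^sub>1 t\<^sub>2 - mixture n t\<^sub>1 t\<^sub>2 = 0"
  proof (rule laplace_eq_0_imp_eq_0[where f="\<lambda>s. p n t\<^sub>1 s - mixture n t\<^sub>1 s", OF _ _ _ t(2)])
    show "continuous_on {0<..} (\<lambda>s. p n t\<^sub>1 s - mixture n t\<^sub>1 s)"
      using t by (intro continuous_on_diff continuous_on_p2 continuous_on_mixture) auto
    show "\<bar>p n t\<^sub>1 s - mixture n t\<^sub>1 s\<bar> \<le> 2" if "0 < s" for s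
    proof -
      have "\<bar>mixture n t\<^sub>1 s\<bar> \<le> 1" using t that by (intro mixture_bound) auto
      then show ?thesis using p_bounds(2)[of n t\<^sub>1 s] by linarith
    qed
    show "laplace (\<lambda>s. p n t\<^sub>1 s - mixture n t\<^sub>1 s) z = 0" if "0 < z" for z
      using laplace_diff[OF laplace_integrable_p[OF t(1) that] mix_int[OF t(1) that]] L[OF t(1) that] by simp
  qed
  then show ?thesis by simp
qed

end

text \<open>Laplace transforms carry no information about time 0. There one of the folded times
  vanishes almost surely, so the Poisson weight is taken at 0 whatever the other time is.\<close>

lemma (in two_folded_processes) mixture_axes:
  assumes "0 \<le> t\<^sub>1" "0 \<le> t\<^sub>2" "t\<^sub>1 = 0 \<or> t\<^sub>2 = 0"
  shows "mixture n t\<^sub>1 t\<^sub>2 = of_bool (n = 0)"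
proof -
  note T1.measurable_T[OF assms(1), measurable] T2.measurable_T[OF assms(2), measurable]
  have zero: "AE \<omega>' in M. AE \<omega> in M. T\<^sub>1 t\<^sub>1 \<omega> * T\<^sub>2 t\<^sub>2 \<omega>' = 0"
  proof (cases "t\<^sub>1 = 0")
    case True
    show ?thesis
      by (rule AE_I2) (use T1.T_0 True in \<open>auto elim: eventually_mono\<close>)
  next
    case False
    then have "t\<^sub>2 = 0" using assms by simp
    then show ?thesis using T2.T_0 by (auto elim: eventually_mono)
  qed
  have "mixture n t\<^sub>1 t\<^sub>2 = (LINT \<omega>'|M. of_bool (n = 0))"
    unfolding mixture_def
  proof (rule integral_cong_AE)
    show "(\<lambda>\<omega>'. LINT \<omega>|M. poisson_weight n (r * (T\<^sub>1 t\<^sub>1 \<omega> * T\<^sub>2 t\<^sub>2 \<omega>'))) \<in> borel_measurable M" by measurable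
    show "AE \<omega>' in M. (LINT \<omega>|M. poisson_weight n (r * (T\<^sub>1 t\<^sub>1 \<omega> * T\<^sub>2 t\<^sub>2 \<omega>'))) = of_bool (n = 0)"
      using zero
    proof eventually_elim
      case (elim \<omega>')
      have "(LINT \<omega>|M. poisson_weight n (r * (T\<^sub>1 t\<^sub>1 \<omega> * T\<^sub>2 t\<^sub>2 \<omega>'))) = (LINT \<omega>|M. of_bool (n = 0))"
      proof (rule integral_cong_AE)
        show "AE \<omega> in M. poisson_weight n (r * (T\<^sub>1 t\<^sub>1 \<omega> * T\<^sub>2 t\<^sub>2 \<omega>')) = of_bool (n = 0)"
          using elim
        proof eventually_elim
          case (elim \<omega>)
          show ?case unfolding elim by (simp add: poisson_weight_0)
        qed
      qed measurable
      then show ?case by (simp add: T1.prob_space)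
    qed
  qed measurable
  then show ?thesis by (simp add: T1.prob_space)
qed

theorem theorem5p4:
  fixes r \<alpha>\<^sub>1 \<alpha>\<^sub>2 :: real
    and M\<^sub>F :: "'b measure" and X :: "real \<Rightarrow> real \<Rightarrow> 'b \<Rightarrow> nat"
    and M :: "'a measure" and N :: "real \<Rightarrow> 'a \<Rightarrow> nat"
    and T\<^sub>1 T\<^sub>2 :: "real \<Rightarrow> 'a \<Rightarrow> real"
  assumes "0 < r" and "0 < \<alpha>\<^sub>1" "\<alpha>\<^sub>1 \<le> 1" and "0 < \<alpha>\<^sub>2" "\<alpha>\<^sub>2 \<le> 1"
    and "prob_space M\<^sub>F" and "time_fractional_poisson_field r \<alpha>\<^sub>1 \<alpha>\<^sub>2 M\<^sub>F X"
    and "prob_space M" and "poisson_process r M N"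
    and "folded_solution_process (2 * \<alpha>\<^sub>1) M T\<^sub>1"
    and "folded_solution_process (2 * \<alpha>\<^sub>2) M T\<^sub>2"
    and "prob_space.indep_sets M
           (\<lambda>i. [process_events M (count_space UNIV) N,
                 process_events M borel T\<^sub>1,
                 process_events M borel T\<^sub>2] ! i) {..<3::nat}"
    and "0 \<le> t\<^sub>1" and "0 \<le> t\<^sub>2"
  shows "equal_in_distribution M\<^sub>F (X t\<^sub>1 t\<^sub>2)
           M (\<lambda>\<omega>. N (T\<^sub>1 t\<^sub>1 \<omega> * T\<^sub>2 t\<^sub>2 \<omega>) \<omega>) (count_space UNIV)"
proof -
  interpret F: fractional_poisson_field M\<^sub>F r \<alpha>\<^sub>1 \<alpha>\<^sub>2 X
    using assms by (intro fractional_poisson_field.intro fractional_poisson_field_axioms.intro)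
  interpret two_folded_processes M \<alpha>\<^sub>1 \<alpha>\<^sub>2 T\<^sub>1 T\<^sub>2 r
    using assms by (intro two_folded_processes.intro two_folded_processes_axioms.intro
        folded_process.intro folded_process_axioms.intro)
  have N: "\<And>t. 0 \<le> t \<Longrightarrow> N t \<in> M \<rightarrow>\<^sub>M count_space UNIV"
    and N0: "\<And>\<omega>. \<omega> \<in> space M \<Longrightarrow> N 0 \<omega> = 0"
    and N_right: "\<And>\<omega> t. \<omega> \<in> space M \<Longrightarrow> 0 \<le> t \<Longrightarrow> ((\<lambda>s. N s \<omega>) \<longlongrightarrow> N t \<omega>) (at_right t)"
    and N_incr: "\<And>t. 0 < t \<Longrightarrow> distr M (count_space UNIV) (\<lambda>\<omega>. N t \<omega> - N 0 \<omega>) = measure_pmf (poisson_pmf (r * (t - 0)))"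
    using assms(9) unfolding poisson_process_def by blast+
  have N_law: "T1.prob {\<omega> \<in> space M. N c \<omega> = n} = poisson_weight n (r * c)" if c: "0 < c" for c n
  proof -
    \<comment> \<open>The law is prescribed for increments; since N starts at 0, \<open>N c\<close>
      is the increment from 0.\<close>
    have "distr M (count_space UNIV) (N c) = distr M (count_space UNIV) (\<lambda>\<omega>. N c \<omega> - N 0 \<omega>)"
      by (rule distr_cong) (auto simp: N0)
    then have "measure (distr M (count_space UNIV) (N c)) {n} = pmf (poisson_pmf (r * c)) n"
      using N_incr[OF c] by (simp add: pmf.rep_eq)
    moreover have "measure (distr M (count_space UNIV) (N c)) {n} = T1.prob (N c -` {n} \<inter> space M)"
      using N[of c] c by (intro measure_distr) auto
    moreover have "N c -` {n} \<inter> space M = {\<omega> \<in> space M. N c \<omega> = n}" by auto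
    ultimately show ?thesis using pmf_poisson_weight[of "r * c" n] c assms(1) by simp
  qed
  have indep: "T1.prob {\<omega> \<in> space M. N c \<omega> = n \<and> T\<^sub>1 t\<^sub>1 \<omega> \<in> S \<and> T\<^sub>2 t\<^sub>2 \<omega> \<in> S'} =
      T1.prob {\<omega> \<in> space M. N c \<omega> = n} * T1.prob {\<omega> \<in> space M. T\<^sub>1 t\<^sub>1 \<omega> \<in> S} * T1.prob {\<omega> \<in> space M. T\<^sub>2 t\<^sub>2 \<omega> \<in> S'}"
    if "0 < c" "S \<in> sets borel" "S' \<in> sets borel" for c n S S'
  proof -
    \<comment> \<open>One event from each of the three sigma-algebras, in the order in which the
      independence hypothesis lists them.\<close>
    let ?E = "\<lambda>i. [{\<omega> \<in> space M. N c \<omega> = n}, {\<omega> \<in> space M. T\<^sub>1 t\<^sub>1 \<omega> \<in> S}, {\<omega> \<in> space M. T\<^sub>2 t\<^sub>2 \<omega> \<in> S'}] ! i"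
    have vimage: "{\<omega> \<in> space M. Y \<omega> \<in> A} = Y -` A \<inter> space M" for Y :: "'a \<Rightarrow> 'c" and A by auto
    have "{\<omega> \<in> space M. N c \<omega> \<in> {n}} \<in> process_events M (count_space UNIV) N"
      unfolding vimage process_events_def using that
      by (intro sigma_sets.Basic CollectI exI[of _ c] exI[of _ "{n}"]) auto
    moreover have "{\<omega> \<in> space M. T\<^sub>1 t\<^sub>1 \<omega> \<in> S} \<in> process_events M borel T\<^sub>1"
      unfolding vimage process_events_def using that assms
      by (intro sigma_sets.Basic CollectI exI[of _ t\<^sub>1] exI[of _ S]; simp)
    moreover have "{\<omega> \<in> space M. T\<^sub>2 t\<^sub>2 \<omega> \<in> S'} \<in> process_events M borel T\<^sub>2"
      unfolding vimage process_events_def using that assms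
      by (intro sigma_sets.Basic CollectI exI[of _ t\<^sub>2] exI[of _ S']; simp)
    ultimately have "?E i \<in> [process_events M (count_space UNIV) N, process_events M borel T\<^sub>1, process_events M borel T\<^sub>2] ! i"
      if "i \<in> {..<3::nat}" for i using that by (auto simp: less_Suc_eq numeral_3_eq_3)
    then have "T1.prob (\<Inter>i\<in>{..<3}. ?E i) = (\<Prod>i<3. T1.prob (?E i))"
      by (intro T1.indep_setsD[OF assms(12)]) (simp_all add: lessThan_empty_iff)
    moreover have "(\<Inter>i\<in>{..<3}. ?E i) = {\<omega> \<in> space M. N c \<omega> = n \<and> T\<^sub>1 t\<^sub>1 \<omega> \<in> S \<and> T\<^sub>2 t\<^sub>2 \<omega> \<in> S'}"
      by (auto simp: numeral_3_eq_3 lessThan_Suc)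
    ultimately show ?thesis by (simp add: numeral_3_eq_3)
  qed
  note T = T1.measurable_T[OF assms(13)] T1.T_nonneg[OF assms(13)] T2.measurable_T[OF assms(14)] T2.T_nonneg[OF assms(14)]
  have Y: "(\<lambda>\<omega>. N (T\<^sub>1 t\<^sub>1 \<omega> * T\<^sub>2 t\<^sub>2 \<omega>) \<omega>) \<in> M \<rightarrow>\<^sub>M count_space UNIV"
    by (rule T1.poisson_subordination(1)[where n=0 and r=r and N=N]; fact N N_right N_law T indep assms(1))
  have law: "T1.prob {\<omega> \<in> space M. N (T\<^sub>1 t\<^sub>1 \<omega> * T\<^sub>2 t\<^sub>2 \<omega>) \<omega> = n} = mixture n t\<^sub>1 t\<^sub>2" for n
    unfolding mixture_def
    by (rule T1.poisson_subordination(2)[where n=n and r=r and N=N]; fact N N_right N_law T indep assms(1))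
  have X: "X t\<^sub>1 t\<^sub>2 \<in> M\<^sub>F \<rightarrow>\<^sub>M count_space UNIV" by (rule F.measurable_X) fact+
  have "distr M\<^sub>F (count_space UNIV) (X t\<^sub>1 t\<^sub>2) = distr M (count_space UNIV) (\<lambda>\<omega>. N (T\<^sub>1 t\<^sub>1 \<omega> * T\<^sub>2 t\<^sub>2 \<omega>) \<omega>)"
  proof (rule measure_eqI_countable[of _ UNIV])
    fix n :: nat
    have "F.p n t\<^sub>1 t\<^sub>2 = mixture n t\<^sub>1 t\<^sub>2"
    proof (cases "t\<^sub>1 = 0 \<or> t\<^sub>2 = 0")
      case True
      then show ?thesis using F.p_axes mixture_axes assms(13,14) by simp
    next
      case False
      then show ?thesis using assms(13,14) by (intro F.p_eq_mixture two_folded_processes_axioms) auto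
    qed
    also have "\<dots> = T1.prob {\<omega> \<in> space M. N (T\<^sub>1 t\<^sub>1 \<omega> * T\<^sub>2 t\<^sub>2 \<omega>) \<omega> = n}"
      by (rule law[symmetric])
    finally have "F.prob (X t\<^sub>1 t\<^sub>2 -` {n} \<inter> space M\<^sub>F) = T1.prob ((\<lambda>\<omega>. N (T\<^sub>1 t\<^sub>1 \<omega> * T\<^sub>2 t\<^sub>2 \<omega>) \<omega>) -` {n} \<inter> space M)"
      by (simp add: F.p_def vimage_def Int_def conj_commute)
    then show "emeasure (distr M\<^sub>F (count_space UNIV) (X t\<^sub>1 t\<^sub>2)) {n} = emeasure (distr M (count_space UNIV) (\<lambda>\<omega>. N (T\<^sub>1 t\<^sub>1 \<omega> * T\<^sub>2 t\<^sub>2 \<omega>) \<omega>)) {n}"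
      using X Y by (simp add: emeasure_distr F.emeasure_eq_measure T1.emeasure_eq_measure)
  qed auto
  then show ?thesis using X Y by (simp add: equal_in_distribution_def)
qed

end
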